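(* Let $H$ be a graph on $h$ vertices with pathwidth at most $2$, and suppose $h > 5$. Then there is a function $f_H(k) = 2^{O(h^2)}\cdot k^2 \cdot \log k$ such that for every graph $G$, if $k = \mathbf{pack}_H(G)$, then $k \le \mathbf{cover}_H(G) \le f_H(k)$.
   Context: All graphs are finite, undirected, without loops. For a graph $H$, $\mathcal{M}(H)$ denotes the set of all graphs that can be contracted to $H$ (i.e. $H$ is obtained from them by a sequence of edge contractions); members of $\mathcal{M}(H)$ are called models of $H$. For a graph $G$, $\mathbf{cover}_H(G)$ is the minimum number of vertices of $G$ meeting every subgraph of $G$ that belongs to $\mathcal{M}(H)$, and $\mathbf{pack}_H(G)$ is the maximum number of pairwise vertex-disjoint subgraphs of $G$ belonging to $\mathcal{M}(H)$. Logarithms are binary. The constant hidden in $O(h^2)$ does not depend on $H$ or $k$.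
   Formalization: The factor log k is read as log max(2,k), since at k = 1 the stated bound is 0 while the cover is at least 1 (take G = H); graphs are simple, with natural numbers as vertices, which covers every finite simple graph up to isomorphism. *)

theory Defs
  imports Complex_Main "Graph_Theory.Graph_Theory"
begin

text \<open>
  Finite simple undirected graphs are the finite, loop-free, symmetric digraphs without parallel
  arcs of the locale \<^locale>\<open>pair_graph\<close>: an edge \<open>uv\<close> is the pair of arcs \<open>(u, v)\<close>, \<open>(v, u)\<close>.
\<close>

section \<open>Contractions and models\<close>

text \<open>
  The vertex created by contracting \<open>uv\<close> is represented by \<open>u\<close>. Loops are discarded, and parallel
  edges are merged since the arcs form a set.
\<close>

definition contract_edge :: "'a \<Rightarrow> 'a \<Rightarrow> 'a pair_pre_digraph \<Rightarrow> 'a pair_pre_digraph" where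
  "contract_edge u v G =
     (let r = id(v := u) in
      \<lparr> pverts = pverts G - {v},
        parcs = {(r x, r y) | x y. (x, y) \<in> parcs G \<and> r x \<noteq> r y} \<rparr>)"

definition contraction_step :: "'a pair_pre_digraph \<Rightarrow> 'a pair_pre_digraph \<Rightarrow> bool" where
  "contraction_step G G' \<longleftrightarrow> (\<exists>u v. (u, v) \<in> parcs G \<and> G' = contract_edge u v G)"

definition contractible_to :: "'a pair_pre_digraph \<Rightarrow> 'b pair_pre_digraph \<Rightarrow> bool" where
  "contractible_to G H \<longleftrightarrow>
     (\<exists>G'. contraction_step\<^sup>*\<^sup>* G G' \<and> digraph_iso (with_proj G') (with_proj H))"

text \<open>The subgraphs of \<open>G\<close> that are models of \<open>H\<close>, i.e. that belong to \<open>\<M>(H)\<close>.\<close>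

definition submodels :: "'b pair_pre_digraph \<Rightarrow> 'a pair_pre_digraph \<Rightarrow> 'a pair_pre_digraph set" where
  "submodels H G =
     {M. pair_graph M \<and> subgraph (with_proj M) (with_proj G) \<and> contractible_to M H}"


section \<open>Packing and covering numbers\<close>

definition is_packing ::
    "'b pair_pre_digraph \<Rightarrow> 'a pair_pre_digraph \<Rightarrow> 'a pair_pre_digraph set \<Rightarrow> bool" where
  "is_packing H G F \<longleftrightarrow>
     F \<subseteq> submodels H G \<and> pairwise (\<lambda>M N. disjnt (pverts M) (pverts N)) F"

definition pack :: "'b pair_pre_digraph \<Rightarrow> 'a pair_pre_digraph \<Rightarrow> nat" where
  "pack H G = Max {card F | F. is_packing H G F}"

definition is_cover :: "'b pair_pre_digraph \<Rightarrow> 'a pair_pre_digraph \<Rightarrow> 'a set \<Rightarrow> bool" where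
  "is_cover H G X \<longleftrightarrow> X \<subseteq> pverts G \<and> (\<forall>M \<in> submodels H G. pverts M \<inter> X \<noteq> {})"

definition cover :: "'b pair_pre_digraph \<Rightarrow> 'a pair_pre_digraph \<Rightarrow> nat" where
  "cover H G = Min {card X | X. is_cover H G X}"


section \<open>Pathwidth\<close>

definition path_decomposition :: "'a pair_pre_digraph \<Rightarrow> 'a set list \<Rightarrow> bool" where
  "path_decomposition G Xs \<longleftrightarrow>
     Xs \<noteq> [] \<and>
     \<Union> (set Xs) = pverts G \<and>
     (\<forall>(u, v) \<in> parcs G. \<exists>X \<in> set Xs. u \<in> X \<and> v \<in> X) \<and>
     (\<forall>i j k. i \<le> j \<and> j \<le> k \<and> k < length Xs \<longrightarrow> Xs ! i \<inter> Xs ! k \<subseteq> Xs ! j)"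

definition pd_width :: "'a set list \<Rightarrow> nat" where
  "pd_width Xs = Max (card ` set Xs) - 1"

text \<open>The subtraction truncates only for the null graph, which gets pathwidth 0 instead of -1.\<close>

definition pathwidth :: "'a pair_pre_digraph \<Rightarrow> nat" where
  "pathwidth G = (LEAST w. \<exists>Xs. path_decomposition G Xs \<and> pd_width Xs = w)"


section \<open>Well-definedness\<close>

text \<open>The extrema in \<^const>\<open>pack\<close>, \<^const>\<open>cover\<close> and \<^const>\<open>pathwidth\<close> are taken over nonempty sets,
  which are finite in the case of \<^const>\<open>Max\<close> and \<^const>\<open>Min\<close>.\<close>

lemma pair_graph_contract_edge:
  assumes "pair_graph G" "(u, v) \<in> parcs G"
  shows "pair_graph (contract_edge u v G)"
proof -
  interpret pair_graph G by fact
  define r where "r = id(v := u)"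
  have uv: "u \<in> pverts G" "u \<noteq> v" using assms(2) no_loops' in_arcsD1 by auto
  have pv: "pverts (contract_edge u v G) = pverts G - {v}"
    and pa: "parcs (contract_edge u v G) = {(r x, r y) | x y. (x, y) \<in> parcs G \<and> r x \<noteq> r y}"
    by (simp_all add: contract_edge_def Let_def r_def)
  have r: "r x \<in> pverts G - {v}" if "x \<in> pverts G" for x
    using that uv by (auto simp: r_def)
  have sub: "parcs (contract_edge u v G) \<subseteq> (pverts G - {v}) \<times> (pverts G - {v})"
    using r in_arcsD1 in_arcsD2 unfolding pa by blast
  show ?thesis
  proof
    show "fst e \<in> pverts (contract_edge u v G)" if "e \<in> parcs (contract_edge u v G)" for e
      using that sub unfolding pv by auto
    show "snd e \<in> pverts (contract_edge u v G)" if "e \<in> parcs (contract_edge u v G)" for e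
      using that sub unfolding pv by auto
    show "finite (pverts (contract_edge u v G))"
      unfolding pv using pair_finite_verts by simp
    show "finite (parcs (contract_edge u v G))"
      by (rule finite_subset[OF sub]) (simp add: pair_finite_verts)
    show "fst e \<noteq> snd e" if "e \<in> parcs (contract_edge u v G)" for e
      using that unfolding pa by auto
    show "symmetric (with_proj (contract_edge u v G))"
      unfolding symmetric_def with_proj_simps
    proof (rule symI)
      fix a b assume "(a, b) \<in> parcs (contract_edge u v G)"
      then obtain x y where "(x, y) \<in> parcs G" "r x \<noteq> r y" "a = r x" "b = r y"
        unfolding pa by auto
      then show "(b, a) \<in> parcs (contract_edge u v G)"
        using arcs_symmetric[of x y] unfolding pa mem_Collect_eq by metis
    qed
  qed
qed

lemma finite_submodels:
  assumes "pair_graph G"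
  shows "finite (submodels H G)"
proof -
  interpret pair_graph G by fact
  have "submodels H G \<subseteq> (\<lambda>(V, A). \<lparr> pverts = V, parcs = A \<rparr>) ` (Pow (pverts G) \<times> Pow (parcs G))"
  proof
    fix M assume "M \<in> submodels H G"
    then have "pverts M \<subseteq> pverts G" "parcs M \<subseteq> parcs G"
      by (auto simp: submodels_def subgraph_def)
    then show "M \<in> (\<lambda>(V, A). \<lparr> pverts = V, parcs = A \<rparr>) ` (Pow (pverts G) \<times> Pow (parcs G))"
      by (intro image_eqI[where x = "(pverts M, parcs M)"]) auto
  qed
  then show ?thesis
    by (rule finite_subset) (simp add: pair_finite_verts pair_finite_arcs)
qed

lemma packings_finite_nonempty:
  assumes "pair_graph G"
  shows "finite {card F | F. is_packing H G F}" "{card F | F. is_packing H G F} \<noteq> {}"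
proof -
  have "{card F | F. is_packing H G F} \<subseteq> card ` Pow (submodels H G)"
    by (auto simp: is_packing_def)
  then show "finite {card F | F. is_packing H G F}"
    by (rule finite_subset) (simp add: finite_submodels[OF assms])
  have "is_packing H G {}" by (simp add: is_packing_def)
  then show "{card F | F. is_packing H G F} \<noteq> {}" by blast
qed

lemma contractible_to_null:
  assumes "contractible_to M H" "pverts M = {}"
  shows "pverts H = {}"
proof -
  from assms(1) obtain M' where st: "contraction_step\<^sup>*\<^sup>* M M'"
    and iso: "digraph_iso (with_proj M') (with_proj H)"
    by (auto simp: contractible_to_def)
  from st have "pverts M' = {}"
    by induction (auto simp: assms(2) contraction_step_def contract_edge_def Let_def)
  moreover from iso obtain f where "with_proj H = app_iso f (with_proj M')"
    by (auto simp: digraph_iso_def)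
  then have "pverts H = iso_verts f ` pverts M'"
    by (metis verts_app_iso with_proj_simps(1))
  ultimately show ?thesis by simp
qed

lemma covers_finite_nonempty:
  assumes "pair_graph G" "pverts H \<noteq> {}"
  shows "finite {card X | X. is_cover H G X}" "{card X | X. is_cover H G X} \<noteq> {}"
proof -
  interpret pair_graph G by fact
  have "{card X | X. is_cover H G X} \<subseteq> card ` Pow (pverts G)"
    by (auto simp: is_cover_def)
  then show "finite {card X | X. is_cover H G X}"
    by (rule finite_subset) (simp add: pair_finite_verts)
  have "is_cover H G (pverts G)"
    using contractible_to_null assms(2)
    by (fastforce simp: is_cover_def submodels_def subgraph_def)
  then show "{card X | X. is_cover H G X} \<noteq> {}" by blast
qed

lemma path_decomposition_exists:
  assumes "pair_graph G"
  shows "path_decomposition G [pverts G]"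
proof -
  interpret pair_graph G by fact
  show ?thesis by (auto simp: path_decomposition_def dest: in_arcsD1 in_arcsD2)
qed

end

theory Submission
  imports Defs
begin

text \<open>
  A family of pairwise intersecting connected sets (a bramble) of order \<open>T\<close> is met by a path, which
  can be cut into \<open>kh\<close> segments that are pairwise joined by \<open>T / (kh)\<close> disjoint paths. If all
  segments are adjacent, they give a clique minor containing \<open>k\<close> copies of \<open>H\<close>. Otherwise two
  nonadjacent segments and the paths between them form a ladder with permuted, subdivided rungs.
  Cut its rails into blocks of 2^O(h^2) rungs. Two blocks joined by h^2 rungs contain an ordinary
  ladder with subdivided rungs (Erdos-Szekeres), which has every \<open>h\<close>-vertex graph of pathwidth at
  most 2 as a minor; if there are no such blocks, the block graph is dense and contains a clique minor
  on few, O(h^2 log k), blocks (Kostochka-Pyber). Removing these models greedily yields \<open>k\<close> disjoint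
  ones as long as the ladder has 2^O(h^2) k log k rungs, so T = 2^O(h^2) k^2 log k suffices.

  Without a bramble of order \<open>T\<close>, a graph in which every component of \<open>H\<close> has a large covering number
  can be split by O(T) vertices so that one part still has a large covering number for one component
  of \<open>H\<close>, while all its covering numbers are at most a constant times as large. For connected \<open>H\<close>
  one recurses into both parts with \<open>k\<close> halved, which costs only a constant factor because \<open>T\<close> grows
  quadratically; in general one first splits off one part for every component of \<open>H\<close>.
\<close>

section \<open>Connectivity and minors\<close>

text \<open>The adjacency relation stays fixed and only vertex sets vary: a set of vertices contains
  a model of \<open>H\<close> exactly if \<open>minor\<close> holds there, so contractions appear
  only at the end.

  Two circumstances shape the recursion. Covering numbers add up across a separation only for
  connected graphs, because a disconnected graph may have parts of a model on both sides; they are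
  therefore measured for the components of \<open>H\<close>, while a set that covers the models of
  one component already covers those of \<open>H\<close>. And a part that is split off must be
  bounded from above as well as from below, since whatever it has in excess is lost to the rest. The
  upper bound comes from minimality: a smallest rich connected set with small boundary falls into
  poor pieces, and these are regrouped only until the threshold is reached.

  In the ladder the parameters are circular: the size of a removed clique model grows with the
  logarithm of the number of blocks, which in turn must exceed \<open>k\<close> times that size. A
  factor exponential in \<open>h\<^sup>2\<close> for the number of blocks breaks the circle.\<close>

definition conn :: "('a \<times> 'a) set \<Rightarrow> 'a set \<Rightarrow> bool" where
  "conn E B \<longleftrightarrow> B \<noteq> {} \<and> (\<forall>x\<in>B. \<forall>y\<in>B. (x, y) \<in> (E \<inter> B \<times> B)\<^sup>*)"

definition walk :: "('a \<times> 'a) set \<Rightarrow> 'a list \<Rightarrow> bool" where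
  "walk E xs \<longleftrightarrow> xs \<noteq> [] \<and> successively (\<lambda>u v. (u, v) \<in> E) xs"

text \<open>The condition \<open>u \<noteq> v\<close> in the edge requirement lets
  \<open>UNIV\<close> stand for the edge relation of a complete graph. Branch sets are nonempty
  because \<open>conn\<close> excludes the empty set.\<close>

definition minor_model ::
    "('a \<times> 'a) set \<Rightarrow> 'a set \<Rightarrow> 'b set \<Rightarrow> ('b \<times> 'b) set \<Rightarrow> ('b \<Rightarrow> 'a set) \<Rightarrow> bool" where
  "minor_model E W U F \<phi> \<longleftrightarrow>
     (\<forall>u\<in>U. conn E (\<phi> u) \<and> \<phi> u \<subseteq> W) \<and>
     (\<forall>u\<in>U. \<forall>v\<in>U. u \<noteq> v \<longrightarrow> \<phi> u \<inter> \<phi> v = {}) \<and>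
     (\<forall>u\<in>U. \<forall>v\<in>U. u \<noteq> v \<and> (u, v) \<in> F \<longrightarrow> (\<exists>x\<in>\<phi> u. \<exists>y\<in>\<phi> v. (x, y) \<in> E))"

definition minor :: "('a \<times> 'a) set \<Rightarrow> 'a set \<Rightarrow> 'b set \<Rightarrow> ('b \<times> 'b) set \<Rightarrow> bool" where
  "minor E W U F \<longleftrightarrow> (\<exists>\<phi>. minor_model E W U F \<phi>)"

definition packs :: "('a \<times> 'a) set \<Rightarrow> 'a set \<Rightarrow> nat \<Rightarrow> 'b set \<Rightarrow> ('b \<times> 'b) set \<Rightarrow> bool" where
  "packs E W n U F \<longleftrightarrow>
     (\<exists>X. (\<forall>i<n. X i \<subseteq> W \<and> minor E (X i) U F) \<and> disjoint_family_on X {..<n})"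

section \<open>Connected sets, walks and components\<close>

lemma conn_not_empty: "conn E B \<Longrightarrow> B \<noteq> {}"
  by (simp add: conn_def)

lemma conn_singleton [simp]: "conn E {x}"
  by (simp add: conn_def)

lemma conn_rootI:
  assumes "sym E" "r \<in> B" "\<And>x. x \<in> B \<Longrightarrow> (r, x) \<in> (E \<inter> B \<times> B)\<^sup>*"
  shows "conn E B"
proof -
  have s: "sym ((E \<inter> B \<times> B)\<^sup>*)"
    using assms(1) by (intro sym_rtrancl) (auto simp: sym_def)
  have "(x, y) \<in> (E \<inter> B \<times> B)\<^sup>*" if "x \<in> B" "y \<in> B" for x y
    using assms(3)[OF that(1)] assms(3)[OF that(2)] s by (meson rtrancl_trans symD)
  then show ?thesis using assms(2) by (auto simp: conn_def)
qed

lemma conn_rtrancl_mono: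
  assumes "conn E B" "B \<subseteq> C" "x \<in> B" "y \<in> B"
  shows "(x, y) \<in> (E \<inter> C \<times> C)\<^sup>*"
proof -
  have "(x, y) \<in> (E \<inter> B \<times> B)\<^sup>*" using assms by (auto simp: conn_def)
  moreover have "(E \<inter> B \<times> B)\<^sup>* \<subseteq> (E \<inter> C \<times> C)\<^sup>*"
    using assms(2) by (intro rtrancl_mono) auto
  ultimately show ?thesis by blast
qed

text \<open>Induction along a walk of indices: once a vertex of one part is reached, the
  connectedness of that part reaches all of it, in particular the exit to the next part.\<close>

lemma conn_UN:
  assumes "sym E" "conn F J" "\<And>j. j \<in> J \<Longrightarrow> conn E (\<psi> j)"
    and "\<And>i j. i \<in> J \<Longrightarrow> j \<in> J \<Longrightarrow> i \<noteq> j \<Longrightarrow> (i, j) \<in> F \<Longrightarrow> \<exists>x\<in>\<psi> i. \<exists>y\<in>\<psi> j. x = y \<or> (x, y) \<in> E"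
  shows "conn E (\<Union>(\<psi> ` J))"
proof -
  let ?B = "\<Union>(\<psi> ` J)"
  obtain j0 where j0: "j0 \<in> J" using conn_not_empty[OF assms(2)] by auto
  obtain r where r: "r \<in> \<psi> j0" using conn_not_empty[OF assms(3)[OF j0]] by auto
  have "\<forall>x\<in>\<psi> j. (r, x) \<in> (E \<inter> ?B \<times> ?B)\<^sup>*" if j: "j \<in> J" for j
  proof -
    have "(j0, j) \<in> (F \<inter> J \<times> J)\<^sup>*" using assms(2) j j0 by (auto simp: conn_def)
    then show ?thesis
    proof induction
      case base
      show ?case using conn_rtrancl_mono[OF assms(3)[OF j0], of ?B] r j0 by blast
    next
      case (step i j)
      show ?case
      proof (cases "i = j")
        case True then show ?thesis using step.IH by simp
      next
        case False
        have ij: "i \<in> J" "j \<in> J" "(i, j) \<in> F" using step.hyps by auto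
        then obtain x y where xy: "x \<in> \<psi> i" "y \<in> \<psi> j" "x = y \<or> (x, y) \<in> E"
          using assms(4)[of i j] False by blast
        have "(r, x) \<in> (E \<inter> ?B \<times> ?B)\<^sup>*" using step.IH xy by blast
        moreover have "(x, y) \<in> (E \<inter> ?B \<times> ?B)\<^sup>*" using xy ij by auto
        moreover have "\<forall>z\<in>\<psi> j. (y, z) \<in> (E \<inter> ?B \<times> ?B)\<^sup>*"
          using conn_rtrancl_mono[OF assms(3)[OF ij(2)], of ?B y] xy ij by blast
        ultimately show ?thesis by (meson rtrancl_trans)
      qed
    qed
  qed
  then show ?thesis
    by (intro conn_rootI[OF assms(1), of r]) (use r j0 in auto)
qed

lemma conn_Un:
  assumes "sym E" "conn E A" "conn E B" "\<exists>x\<in>A. \<exists>y\<in>B. x = y \<or> (x, y) \<in> E"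
  shows "conn E (A \<union> B)"
proof -
  let ?C = "A \<union> B"
  obtain a b where ab: "a \<in> A" "b \<in> B" "a = b \<or> (a, b) \<in> E" using assms(4) by blast
  have "(a, x) \<in> (E \<inter> ?C \<times> ?C)\<^sup>*" if "x \<in> ?C" for x
  proof (cases "x \<in> A")
    case True then show ?thesis using conn_rtrancl_mono[OF assms(2), of ?C a x] ab by blast
  next
    case False
    then have "(b, x) \<in> (E \<inter> ?C \<times> ?C)\<^sup>*"
      using conn_rtrancl_mono[OF assms(3), of ?C b x] ab that by blast
    moreover have "(a, b) \<in> (E \<inter> ?C \<times> ?C)\<^sup>*" using ab by auto
    ultimately show ?thesis by (meson rtrancl_trans)
  qed
  then show ?thesis by (intro conn_rootI[OF assms(1), of a]) (use ab in auto)
qed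

lemma conn_UN_common:
  assumes "sym E" "conn E A" "\<And>j. j \<in> J \<Longrightarrow> conn E (B j)"
    and "\<And>j. j \<in> J \<Longrightarrow> \<exists>x\<in>A. \<exists>y\<in>B j. x = y \<or> (x, y) \<in> E"
  shows "conn E (A \<union> (\<Union>j\<in>J. B j))"
proof -
  let ?C = "A \<union> (\<Union>j\<in>J. B j)"
  obtain r where r: "r \<in> A" using conn_not_empty[OF assms(2)] by auto
  have "(r, x) \<in> (E \<inter> ?C \<times> ?C)\<^sup>*" if x: "x \<in> ?C" for x
  proof (cases "x \<in> A")
    case True then show ?thesis using conn_rtrancl_mono[OF assms(2), of ?C r x] r by blast
  next
    case False
    then obtain j where j: "j \<in> J" "x \<in> B j" using x by auto
    have "conn E (A \<union> B j)" using conn_Un[OF assms(1,2) assms(3,4)[OF j(1)]] .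
    from conn_rtrancl_mono[OF this, of ?C r x] show ?thesis using r j by blast
  qed
  then show ?thesis by (intro conn_rootI[OF assms(1), of r]) (use r in auto)
qed

lemma conn_edge_out:
  assumes "conn E B" "x \<in> B" "x \<in> X" "y \<in> B" "y \<notin> X"
  obtains a b where "a \<in> B" "a \<in> X" "b \<in> B" "b \<notin> X" "(a, b) \<in> E"
proof -
  have "(x, y) \<in> (E \<inter> B \<times> B)\<^sup>*" using assms by (auto simp: conn_def)
  then have "y \<notin> X \<Longrightarrow> \<exists>a b. a \<in> B \<and> a \<in> X \<and> b \<in> B \<and> b \<notin> X \<and> (a, b) \<in> E"
    by (induction) (use assms in auto)
  then show ?thesis using that assms by blast
qed

lemma conn_walk:
  assumes "sym E" "walk E xs"
  shows "conn E (set xs)"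
  using assms(2)
proof (induction xs)
  case (Cons x xs)
  show ?case
  proof (cases "xs = []")
    case False
    then have "walk E xs" "(x, hd xs) \<in> E"
      using Cons.prems by (auto simp: walk_def successively_Cons)
    then have "conn E ({x} \<union> set xs)"
      using Cons.IH False by (intro conn_Un[OF assms(1)]) (auto intro: hd_in_set)
    then show ?thesis by simp
  qed simp
qed (simp add: walk_def)

lemma walk_append: "walk E xs \<Longrightarrow> walk E ys \<Longrightarrow> (last xs, hd ys) \<in> E \<Longrightarrow> walk E (xs @ ys)"
  by (auto simp: walk_def successively_append_iff)

lemma walk_appendD1: "walk E (xs @ ys) \<Longrightarrow> xs \<noteq> [] \<Longrightarrow> walk E xs"
  by (auto simp: walk_def successively_append_iff)

lemma walk_appendD2: "walk E (xs @ ys) \<Longrightarrow> ys \<noteq> [] \<Longrightarrow> walk E ys"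
  by (auto simp: walk_def successively_append_iff)

lemma walk_mono: "walk E xs \<Longrightarrow> E \<subseteq> E' \<Longrightarrow> walk E' xs"
  unfolding walk_def by (auto intro: successively_mono)

lemma conn_path:
  assumes "conn E B" "x \<in> B" "y \<in> B"
  obtains xs where "walk E xs" "distinct xs" "hd xs = x" "last xs = y" "set xs \<subseteq> B"
proof -
  have "(x, y) \<in> (E \<inter> B \<times> B)\<^sup>*" using assms by (auto simp: conn_def)
  then have "\<exists>xs. walk E xs \<and> distinct xs \<and> hd xs = x \<and> last xs = y \<and> set xs \<subseteq> B"
  proof induction
    case base
    show ?case by (rule exI[of _ "[x]"]) (use assms in \<open>auto simp: walk_def\<close>)
  next
    case (step y z)
    then obtain xs where xs: "walk E xs" "distinct xs" "hd xs = x" "last xs = y" "set xs \<subseteq> B"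
      by blast
    show ?case
    proof (cases "z \<in> set xs")
      case True
      then obtain us vs where "xs = (us @ [z]) @ vs"
        by (metis split_list append.assoc append_Cons append_Nil)
      then show ?thesis using xs
        by (intro exI[of _ "us @ [z]"]) (auto intro: walk_appendD1 simp: hd_append)
    next
      case False
      then show ?thesis using xs step.hyps
        by (intro exI[of _ "xs @ [z]"]) (auto simp: walk_def successively_append_iff)
    qed
  qed
  then show ?thesis using that by blast
qed

lemma walk_nth: "walk E p \<Longrightarrow> Suc a < length p \<Longrightarrow> (p ! a, p ! Suc a) \<in> E"
  by (auto simp: walk_def dest: successively_nth)

lemma conn_nth:
  assumes "sym E" "walk E p" "a \<le> b" "b < length p"
  shows "conn E ((!) p ` {a..b})"
  using assms(3,4)
proof (induction b rule: dec_induct)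
  case (step b)
  have "conn E ((!) p ` {a..b} \<union> {p ! Suc b})"
    using step walk_nth[OF assms(2), of b] by (intro conn_Un[OF assms(1)]) auto
  moreover have "(!) p ` {a..Suc b} = (!) p ` {a..b} \<union> {p ! Suc b}"
    using step.hyps by (auto simp: atLeastAtMostSuc_conv)
  ultimately show ?case by simp
qed simp

text \<open>For \<open>x\<close> outside \<open>X\<close> only the reflexive step remains and the
  component is \<open>{x}\<close>, which is why \<open>component_subset\<close> asks for
  \<open>x \<in> X\<close>.\<close>

definition component :: "('a \<times> 'a) set \<Rightarrow> 'a set \<Rightarrow> 'a \<Rightarrow> 'a set" where
  "component E X x = {y. (x, y) \<in> (E \<inter> X \<times> X)\<^sup>*}"

lemma component_self [simp]: "x \<in> component E X x"
  by (simp add: component_def)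

lemma component_subset: "x \<in> X \<Longrightarrow> component E X x \<subseteq> X"
  by (auto simp: component_def elim: rtranclE)

lemma component_closed: "y \<in> component E X x \<Longrightarrow> y \<in> X \<Longrightarrow> z \<in> X \<Longrightarrow> (y, z) \<in> E \<Longrightarrow> z \<in> component E X x"
  by (auto simp: component_def intro: rtrancl_into_rtrancl)

lemma conn_component:
  assumes "sym E" "x \<in> X"
  shows "conn E (component E X x)"
proof (rule conn_rootI[OF assms(1), of x])
  fix y assume "y \<in> component E X x"
  then have "(x, y) \<in> (E \<inter> X \<times> X)\<^sup>*" by (simp add: component_def)
  then show "(x, y) \<in> (E \<inter> component E X x \<times> component E X x)\<^sup>*"
  proof induction
    case (step y z)
    then have "y \<in> component E X x" "z \<in> component E X x"
      by (auto simp: component_def intro: rtrancl_into_rtrancl)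
    then show ?case using step by (auto intro: rtrancl_into_rtrancl)
  qed simp
qed simp

lemma conn_subset_component:
  assumes "conn E B" "B \<subseteq> X" "x \<in> X" "y \<in> B" "y \<in> component E X x"
  shows "B \<subseteq> component E X x"
proof
  fix z assume "z \<in> B"
  then have "(y, z) \<in> (E \<inter> X \<times> X)\<^sup>*" using conn_rtrancl_mono[OF assms(1,2)] assms by blast
  then show "z \<in> component E X x" using assms(5) by (auto simp: component_def)
qed

section \<open>Composition of minors and of packings\<close>

lemma minor_modelI:
  assumes "\<And>u. u \<in> U \<Longrightarrow> conn E (\<phi> u)" "\<And>u. u \<in> U \<Longrightarrow> \<phi> u \<subseteq> W"
    and "\<And>u v. u \<in> U \<Longrightarrow> v \<in> U \<Longrightarrow> u \<noteq> v \<Longrightarrow> \<phi> u \<inter> \<phi> v = {}"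
    and "\<And>u v. u \<in> U \<Longrightarrow> v \<in> U \<Longrightarrow> u \<noteq> v \<Longrightarrow> (u, v) \<in> F \<Longrightarrow> \<exists>x\<in>\<phi> u. \<exists>y\<in>\<phi> v. (x, y) \<in> E"
  shows "minor_model E W U F \<phi>"
  using assms by (simp add: minor_model_def)

lemma minor_modelD:
  assumes "minor_model E W U F \<phi>"
  shows "u \<in> U \<Longrightarrow> conn E (\<phi> u)" "u \<in> U \<Longrightarrow> \<phi> u \<subseteq> W"
    and "u \<in> U \<Longrightarrow> v \<in> U \<Longrightarrow> u \<noteq> v \<Longrightarrow> \<phi> u \<inter> \<phi> v = {}"
    and "u \<in> U \<Longrightarrow> v \<in> U \<Longrightarrow> u \<noteq> v \<Longrightarrow> (u, v) \<in> F \<Longrightarrow> \<exists>x\<in>\<phi> u. \<exists>y\<in>\<phi> v. (x, y) \<in> E"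
  using assms by (simp_all add: minor_model_def)

lemma minor_model_mono:
  assumes "minor_model E W U F \<phi>" "W \<subseteq> W'" "U' \<subseteq> U"
  shows "minor_model E W' U' F \<phi>"
  using minor_modelD[OF assms(1)] assms(2,3)
  by (intro minor_modelI) (simp_all add: subset_iff, blast)

lemma minor_mono: "minor E W U F \<Longrightarrow> W \<subseteq> W' \<Longrightarrow> minor E W' U F"
  unfolding minor_def using minor_model_mono by blast

lemma minor_subset: "minor E W U F \<Longrightarrow> U' \<subseteq> U \<Longrightarrow> minor E W U' F"
  unfolding minor_def using minor_model_mono by blast

text \<open>The branch sets of the composition are unions of sets \<open>\<psi> y\<close> over the
  branch sets of the inner model. The conclusion is confined to the branch sets of \<open>Y\<close>,
  not merely to \<open>W\<close>, so that disjoint choices of \<open>Y\<close> give disjoint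
  models.\<close>

lemma minor_trans:
  assumes "sym E" and \<psi>: "minor_model E W X F \<psi>" and "minor F Y U H" "Y \<subseteq> X"
  shows "minor E (\<Union>(\<psi> ` Y)) U H"
proof -
  obtain \<phi> where \<phi>: "minor_model F Y U H \<phi>" using assms(3) by (auto simp: minor_def)
  note P = minor_modelD[OF \<psi>] and Q = minor_modelD[OF \<phi>]
  have sub: "\<phi> u \<subseteq> X" if "u \<in> U" for u using Q(2)[OF that] assms(4) by auto
  have "minor_model E (\<Union>(\<psi> ` Y)) U H (\<lambda>u. \<Union>(\<psi> ` \<phi> u))"
  proof (rule minor_modelI)
    fix u assume u: "u \<in> U"
    show "conn E (\<Union>(\<psi> ` \<phi> u))"
    proof (rule conn_UN[OF assms(1) Q(1)[OF u]])
      show "conn E (\<psi> j)" if "j \<in> \<phi> u" for j using P(1) sub[OF u] that by auto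
      fix i j assume "i \<in> \<phi> u" "j \<in> \<phi> u" "i \<noteq> j" "(i, j) \<in> F"
      then have "\<exists>x\<in>\<psi> i. \<exists>y\<in>\<psi> j. (x, y) \<in> E" using P(4)[of i j] sub[OF u] by auto
      then show "\<exists>x\<in>\<psi> i. \<exists>y\<in>\<psi> j. x = y \<or> (x, y) \<in> E" by blast
    qed
    show "\<Union>(\<psi> ` \<phi> u) \<subseteq> \<Union>(\<psi> ` Y)" using Q(2)[OF u] by auto
    fix v assume v: "v \<in> U" "u \<noteq> v"
    have "\<phi> u \<inter> \<phi> v = {}" using Q(3) u v by blast
    moreover have "\<psi> x \<inter> \<psi> y = {}" if "x \<in> \<phi> u" "y \<in> \<phi> v" "x \<noteq> y" for x y
      using P(3)[of x y] sub[OF u] sub[OF v(1)] that by auto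
    ultimately show "\<Union>(\<psi> ` \<phi> u) \<inter> \<Union>(\<psi> ` \<phi> v) = {}" by fast
    assume "(u, v) \<in> H"
    then obtain x y where xy: "x \<in> \<phi> u" "y \<in> \<phi> v" "(x, y) \<in> F" using Q(4) u v by blast
    moreover have "x \<noteq> y" using xy \<open>\<phi> u \<inter> \<phi> v = {}\<close> by auto
    ultimately show "\<exists>x\<in>\<Union>(\<psi> ` \<phi> u). \<exists>y\<in>\<Union>(\<psi> ` \<phi> v). (x, y) \<in> E"
      using P(4)[of x y] sub[OF u] sub[OF v(1)] by blast
  qed
  then show ?thesis by (auto simp: minor_def)
qed

lemma packs_mono: "packs E W n U F \<Longrightarrow> W \<subseteq> W' \<Longrightarrow> packs E W' n U F"
  unfolding packs_def by (meson order_trans)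

lemma packs_subset: "packs E W n U F \<Longrightarrow> U' \<subseteq> U \<Longrightarrow> packs E W n U' F"
  unfolding packs_def by (meson minor_subset)

lemma disjoint_family_on_upd:
  assumes "disjoint_family_on Y J" "\<And>j. j \<in> J \<Longrightarrow> j \<noteq> i \<Longrightarrow> Y j \<inter> A = {}"
  shows "disjoint_family_on (Y(i := A)) (insert i J)"
  using assms unfolding disjoint_family_on_def by (auto simp: Int_commute)

lemma packs_of_parts:
  assumes \<psi>: "minor_model E W Y F \<psi>" and X: "\<And>i. i < n \<Longrightarrow> X i \<subseteq> Y" "disjoint_family_on X {..<n}"
    and "\<And>i. i < n \<Longrightarrow> minor E (\<Union>(\<psi> ` X i)) U H"
  shows "packs E W n U H"
  unfolding packs_def
proof (intro exI[of _ "\<lambda>i. \<Union>(\<psi> ` X i)"] conjI allI impI)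
  fix i assume i: "i < n"
  show "\<Union>(\<psi> ` X i) \<subseteq> W" using minor_modelD(2)[OF \<psi>] X(1)[OF i] by blast
  show "minor E (\<Union>(\<psi> ` X i)) U H" by (rule assms(4)[OF i])
next
  show "disjoint_family_on (\<lambda>i. \<Union>(\<psi> ` X i)) {..<n}"
    unfolding disjoint_family_on_def
  proof (intro ballI impI)
    fix i j assume ij: "i \<in> {..<n}" "j \<in> {..<n}" "i \<noteq> j"
    then have "X i \<inter> X j = {}" using X(2) by (auto simp: disjoint_family_on_def)
    moreover have "\<psi> x \<inter> \<psi> y = {}" if "x \<in> X i" "y \<in> X j" "x \<noteq> y" for x y
      using minor_modelD(3)[OF \<psi>, of x y] X(1)[of i] X(1)[of j] ij that by auto
    ultimately show "\<Union>(\<psi> ` X i) \<inter> \<Union>(\<psi> ` X j) = {}" by fast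
  qed
qed

lemma packs_trans:
  assumes "sym E" and \<psi>: "minor_model E W Y F \<psi>" and "packs F Y n U H"
  shows "packs E W n U H"
proof -
  obtain X where X: "\<And>i. i < n \<Longrightarrow> X i \<subseteq> Y" "\<And>i. i < n \<Longrightarrow> minor F (X i) U H"
    and d: "disjoint_family_on X {..<n}"
    using assms(3) by (auto simp: packs_def)
  show ?thesis by (rule packs_of_parts[OF \<psi> X(1) d minor_trans[OF assms(1) \<psi> X(2,1)]])
qed

section \<open>Graphs of pathwidth at most 2 are minors of ladders\<close>

text \<open>Rail vertices are \<open>(0, i)\<close> and \<open>(2, i)\<close>, and
  \<open>(1, i)\<close> subdivides the rung from \<open>(0, i)\<close> to
  \<open>(2, \<pi> i)\<close>. Thus every rung has an interior of its own, like a path between two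
  nonadjacent segments, and every column a private vertex from which a branch set can start. The
  ladder is infinite; \<open>cells\<close> cuts out a finite piece.\<close>

definition ladder :: "(nat \<Rightarrow> nat) \<Rightarrow> ((nat \<times> nat) \<times> (nat \<times> nat)) set" where
  "ladder \<pi> =
     (let A = {((0, i), (0, Suc i)) |i. True} \<union> {((2, i), (2, Suc i)) |i. True} \<union>
              {((0, i), (1, i)) |i. True} \<union> {((1, i), (2, \<pi> i)) |i. True}
      in A \<union> A\<inverse>)"

abbreviation cells :: "nat \<Rightarrow> (nat \<times> nat) set" where
  "cells n \<equiv> {..2} \<times> {..<n}"

lemma sym_ladder: "sym (ladder \<pi>)"
  by (auto simp: ladder_def Let_def sym_Un_converse)

lemma ladderI:
  "((0, i), (0, Suc i)) \<in> ladder \<pi>" "((2, i), (2, Suc i)) \<in> ladder \<pi>"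
  "((0, i), (1, i)) \<in> ladder \<pi>" "((1, i), (2, \<pi> i)) \<in> ladder \<pi>"
  "((0, Suc i), (0, i)) \<in> ladder \<pi>" "((2, Suc i), (2, i)) \<in> ladder \<pi>"
  "((1, i), (0, i)) \<in> ladder \<pi>" "((2, \<pi> i), (1, i)) \<in> ladder \<pi>"
  by (auto simp: ladder_def Let_def)

lemma ladderE:
  assumes "(x, y) \<in> ladder \<pi>"
  obtains i where "x = (0, i)" "y = (0, Suc i)" | i where "x = (2, i)" "y = (2, Suc i)"
    | i where "x = (0, i)" "y = (1, i)" | i where "x = (1, i)" "y = (2, \<pi> i)"
    | i where "y = (0, i)" "x = (0, Suc i)" | i where "y = (2, i)" "x = (2, Suc i)"
    | i where "y = (0, i)" "x = (1, i)" | i where "y = (1, i)" "x = (2, \<pi> i)"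
  using assms by (auto simp: ladder_def Let_def)

text \<open>The owners of the two rails of a ladder after column \<open>j\<close>, when vertex \<open>i\<close> is alive during
  \<open>[i, e i]\<close>. A vertex surviving its own column takes over a rail whose owner dies, or one of
  two rails with the same owner.\<close>

fun rail_owners :: "(nat \<Rightarrow> nat) \<Rightarrow> nat \<Rightarrow> nat \<times> nat" where
  "rail_owners e 0 = (0, 0)"
| "rail_owners e (Suc j) =
     (let (t, b) = rail_owners e j in
      if e (Suc j) \<le> Suc j then (t, b)
      else if t = b \<or> e t \<le> Suc j then (Suc j, b)
      else if e b \<le> Suc j then (t, Suc j)
      else (t, b))"

lemma rail_owners_Suc:
  "fst (rail_owners e (Suc j)) \<in> {fst (rail_owners e j), Suc j}"
  "snd (rail_owners e (Suc j)) \<in> {snd (rail_owners e j), Suc j}"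
  by (auto simp: Let_def split: prod.splits)

lemma rail_owners_le: "fst (rail_owners e j) \<le> j" "snd (rail_owners e j) \<le> j"
proof (induction j)
  case (Suc j)
  { case 1 show ?case using rail_owners_Suc(1)[of e j] Suc(1) by auto }
  { case 2 show ?case using rail_owners_Suc(2)[of e j] Suc(2) by auto }
qed auto

text \<open>Every column needs room for its own new vertex, which leaves at most two survivors from
  before, one per rail. If both owners and \<open>Suc j\<close> all lived on into the next column,
  that column would hold four vertices.\<close>

lemma rail_owners_alive:
  assumes card: "\<And>j. j < n \<Longrightarrow> card {i. i \<le> j \<and> j \<le> e i} \<le> 3" and ge: "\<And>i. i < n \<Longrightarrow> i \<le> e i"
    and "Suc j < n" "i \<le> j" "Suc j \<le> e i"
  shows "i = fst (rail_owners e j) \<or> i = snd (rail_owners e j)"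
  using assms(3-5)
proof (induction j arbitrary: i)
  case (Suc j)
  obtain t b where tb: "rail_owners e j = (t, b)" by fastforce
  have le: "t \<le> j" "b \<le> j" using rail_owners_le[of e j] tb by auto
  have old: "i = t \<or> i = b" if "i \<le> j" using Suc.IH[of i] Suc.prems that tb by auto
  show ?case
  proof (cases "e (Suc j) \<le> Suc j \<or> t = b \<or> e t \<le> Suc j \<or> e b \<le> Suc j")
    case True
    then show ?thesis using old Suc.prems tb by (cases "i = Suc j") (auto simp: Let_def)
  next
    case False
    let ?S = "{i. i \<le> Suc (Suc j) \<and> Suc (Suc j) \<le> e i}"
    have "{t, b, Suc j, Suc (Suc j)} \<subseteq> ?S"
      using False le ge[OF Suc.prems(1)] by auto
    then have "card {t, b, Suc j, Suc (Suc j)} \<le> card ?S" by (intro card_mono) auto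
    moreover have "card {t, b, Suc j, Suc (Suc j)} = 4" using False le by auto
    ultimately show ?thesis using card[OF Suc.prems(1)] by simp
  qed
qed auto

text \<open>The branch set of \<open>v\<close> is the middle of rung \<open>v\<close> together with
  the rail cells that \<open>v\<close> owns. An earlier neighbour \<open>i\<close> of
  \<open>j\<close> owns a rail in column \<open>j - 1\<close>; either it keeps this rail in column
  \<open>j\<close> and is adjacent to \<open>(1, j)\<close>, or \<open>j\<close> takes the rail over
  and the two branch sets are adjacent along it.\<close>

lemma ladder_interval_minor:
  assumes card: "\<And>j. j < n \<Longrightarrow> card {i. i \<le> j \<and> j \<le> e i} \<le> 3" and ge: "\<And>i. i < n \<Longrightarrow> i \<le> e i"
  obtains \<phi> where "minor_model (ladder id) (cells n) {..<n}
     {(i, j). i < j \<and> j \<le> e i \<or> j < i \<and> i \<le> e j} \<phi>"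
proof -
  define E where "E = ladder id"
  have EI: "((0, i), (0, Suc i)) \<in> E" "((2, i), (2, Suc i)) \<in> E" "((0, i), (1, i)) \<in> E"
    "((1, i), (0, i)) \<in> E" "((1, i), (2, i)) \<in> E" "((2, i), (1, i)) \<in> E" for i
    using ladderI[where i = i and \<pi> = id] unfolding E_def by simp_all
  have symE: "sym E" unfolding E_def by (rule sym_ladder)
  define t b where "t j = fst (rail_owners e j)" and "b j = snd (rail_owners e j)" for j
  define \<phi> :: "nat \<Rightarrow> (nat \<times> nat) set"
    where "\<phi> v = {(1, v)} \<union> {(0, c) |c. c < n \<and> t c = v} \<union> {(2, c) |c. c < n \<and> b c = v}" for v
  have tS: "t (Suc j) \<in> {t j, Suc j}" and bS: "b (Suc j) \<in> {b j, Suc j}" for j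
    unfolding t_def b_def by (rule rail_owners_Suc)+
  have conn: "conn E (\<phi> v)" if "v < n" for v
  proof (rule conn_rootI[OF symE, of "(1, v)"])
    \<comment> \<open>A vertex acquires a rail only in its own column, so the cells that it owns on
      one rail form an interval starting there.\<close>
    have rail: "((1, v), (s, c)) \<in> (E \<inter> \<phi> v \<times> \<phi> v)\<^sup>*"
      if so: "s = 0 \<and> ow = t \<or> s = 2 \<and> ow = b" and "c < n" "ow c = v" for s ow c
      using that(2,3)
    proof (induction c)
      case 0
      then have "v = 0" using so by (auto simp: t_def b_def)
      moreover have "(1, v) \<in> \<phi> v" "(s, 0) \<in> \<phi> v" using 0 so by (auto simp: \<phi>_def)
      ultimately show ?case using EI(4)[of 0] EI(5)[of 0] so by blast
    next
      case (Suc c)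
      have v: "(1, v) \<in> \<phi> v" "(s, Suc c) \<in> \<phi> v" using Suc.prems so by (auto simp: \<phi>_def)
      show ?case
      proof (cases "v = Suc c")
        case True
        then show ?thesis using EI(4)[of v] EI(5)[of v] so v by blast
      next
        case False
        then have c: "ow c = v" using tS[of c] bS[of c] Suc.prems so by auto
        then have "((1, v), (s, c)) \<in> (E \<inter> \<phi> v \<times> \<phi> v)\<^sup>*" using Suc by auto
        moreover have "(s, c) \<in> \<phi> v" using Suc.prems so c by (auto simp: \<phi>_def)
        then have "((s, c), (s, Suc c)) \<in> E \<inter> \<phi> v \<times> \<phi> v" using v EI(1,2) so by blast
        ultimately show ?thesis by (rule rtrancl_into_rtrancl)
      qed
    qed
    fix x assume "x \<in> \<phi> v"
    then show "((1, v), x) \<in> (E \<inter> \<phi> v \<times> \<phi> v)\<^sup>*" using rail unfolding \<phi>_def by blast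
  qed (simp add: \<phi>_def)
  have edge: "\<exists>x\<in>\<phi> i. \<exists>y\<in>\<phi> j. (x, y) \<in> E" if ij: "i < j" "j \<le> e i" "j < n" for i j
  proof -
    obtain j' where j': "j = Suc j'" using ij(1) by (cases j) auto
    have "i = t j' \<or> i = b j'"
      unfolding t_def b_def using rail_owners_alive[OF card ge, of n j' i] ij j' by auto
    then consider "i = t j'" "t j = i" | "i = t j'" "t j = j"
      | "i = b j'" "b j = i" | "i = b j'" "b j = j"
      using tS[of j'] bS[of j'] j' by auto
    then show ?thesis
    proof cases
      case 1
      have "(0, j) \<in> \<phi> i" "(1, j) \<in> \<phi> j" using 1 ij by (auto simp: \<phi>_def)
      then show ?thesis using EI(3) by blast
    next
      case 2
      have "(0, j') \<in> \<phi> i" "(0, Suc j') \<in> \<phi> j" using 2 ij j' by (auto simp: \<phi>_def)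
      then show ?thesis using EI(1) by blast
    next
      case 3
      have "(2, j) \<in> \<phi> i" "(1, j) \<in> \<phi> j" using 3 ij by (auto simp: \<phi>_def)
      then show ?thesis using EI(6) by blast
    next
      case 4
      have "(2, j') \<in> \<phi> i" "(2, Suc j') \<in> \<phi> j" using 4 ij j' by (auto simp: \<phi>_def)
      then show ?thesis using EI(2) by blast
    qed
  qed
  have "minor_model E (cells n) {..<n} {(i, j). i < j \<and> j \<le> e i \<or> j < i \<and> i \<le> e j} \<phi>"
  proof (rule minor_modelI)
    fix u v assume uv: "u \<in> {..<n}" "v \<in> {..<n}"
      "(u, v) \<in> {(i, j). i < j \<and> j \<le> e i \<or> j < i \<and> i \<le> e j}"
    then consider "u < v" "v \<le> e u" | "v < u" "u \<le> e v" by auto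
    then show "\<exists>x\<in>\<phi> u. \<exists>y\<in>\<phi> v. (x, y) \<in> E"
    proof cases
      case 1 then show ?thesis using edge uv by auto
    next
      case 2
      then obtain x y where "x \<in> \<phi> v" "y \<in> \<phi> u" "(x, y) \<in> E" using edge[of v u] uv by auto
      then show ?thesis using symE by (blast dest: symD)
    qed
  qed (use conn in \<open>auto simp: \<phi>_def\<close>)
  then show ?thesis unfolding E_def by (rule that)
qed

text \<open>Sorting the vertices by their first bag gives one column per vertex, however many bags
  there are. Column \<open>j\<close> stands for the first bag of its vertex, and vertex
  \<open>i\<close> lives until the last such bag that contains it; bags of at most three vertices
  then bound the number of vertices alive in a column.\<close>

lemma pathwidth_2_ladder_minor:
  assumes "pair_graph H" "pathwidth H \<le> 2"
  shows "minor (ladder id) (cells (card (pverts H))) (pverts H) (parcs H)"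
proof -
  interpret pair_graph H by fact
  let ?V = "pverts H" let ?n = "card ?V"
  have "\<exists>w Xs. path_decomposition H Xs \<and> pd_width Xs = w"
    using path_decomposition_exists[OF assms(1)] by blast
  then have "\<exists>Xs. path_decomposition H Xs \<and> pd_width Xs = pathwidth H"
    unfolding pathwidth_def by (rule LeastI_ex)
  then obtain Xs where pd: "path_decomposition H Xs" and w: "pd_width Xs \<le> 2"
    using assms(2) by metis
  have cov: "\<Union>(set Xs) = ?V" using pd by (simp add: path_decomposition_def)
  have edge: "\<exists>X\<in>set Xs. u \<in> X \<and> v \<in> X" if "(u, v) \<in> parcs H" for u v
    using pd that by (auto simp: path_decomposition_def)
  have int: "v \<in> Xs ! j" if "i \<le> j" "j \<le> k" "k < length Xs" "v \<in> Xs ! i" "v \<in> Xs ! k" for i j k v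
  proof -
    have "Xs ! i \<inter> Xs ! k \<subseteq> Xs ! j" using pd that(1-3) by (simp add: path_decomposition_def)
    then show ?thesis using that(4,5) by auto
  qed
  have bag: "card X \<le> 3" "finite X" if "X \<in> set Xs" for X
  proof -
    have "card X \<le> Max (card ` set Xs)" using that by (intro Max_ge) auto
    then show "card X \<le> 3" using w by (auto simp: pd_width_def)
    show "finite X" using cov that pair_finite_verts by (auto intro: finite_subset)
  qed
  define l where "l v = (LEAST i. i < length Xs \<and> v \<in> Xs ! i)" for v
  have l: "l v < length Xs" "v \<in> Xs ! l v" if "v \<in> ?V" for v
  proof -
    have "\<exists>i. i < length Xs \<and> v \<in> Xs ! i" using that cov by (metis UnionE in_set_conv_nth)
    from LeastI_ex[OF this] show "l v < length Xs" "v \<in> Xs ! l v" by (auto simp: l_def)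
  qed
  have l_le: "l v \<le> i" if "i < length Xs" "v \<in> Xs ! i" for v i
    unfolding l_def by (rule Least_le) (use that in auto)
  obtain us where us: "set us = ?V" "distinct us"
    using finite_distinct_list[OF pair_finite_verts] by auto
  define vs where "vs = sort_key l us"
  have vs: "set vs = ?V" "distinct vs" "length vs = ?n" "sorted (map l vs)"
    using us by (auto simp: vs_def distinct_card[symmetric])
  have mono: "l (vs ! i) \<le> l (vs ! j)" if "i \<le> j" "j < ?n" for i j
    using sorted_nth_mono[OF vs(4), of i j] that vs(3) by auto
  have V: "vs ! i \<in> ?V" if "i < ?n" for i using that vs by (metis nth_mem)
  define e where "e i = Max {j. i \<le> j \<and> j < ?n \<and> vs ! i \<in> Xs ! l (vs ! j)}" for i
  have e_mem: "i \<le> e i \<and> e i < ?n \<and> vs ! i \<in> Xs ! l (vs ! e i)" if "i < ?n" for i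
  proof -
    have "e i \<in> {j. i \<le> j \<and> j < ?n \<and> vs ! i \<in> Xs ! l (vs ! j)}"
      unfolding e_def by (rule Max_in) (use that V l in auto)
    then show ?thesis by simp
  qed
  have e_ge: "j \<le> e i" if "i \<le> j" "j < ?n" "vs ! i \<in> Xs ! l (vs ! j)" for i j
    unfolding e_def by (rule Max_ge) (use that in auto)
  have card: "card {i. i \<le> j \<and> j \<le> e i} \<le> 3" if j: "j < ?n" for j
  proof -
    have "vs ! i \<in> Xs ! l (vs ! j)" if "i \<le> j" "j \<le> e i" for i
    proof (rule int[of "l (vs ! i)" _ "l (vs ! e i)"])
      have i: "i < ?n" using that j by simp
      show "l (vs ! i) \<le> l (vs ! j)" "l (vs ! j) \<le> l (vs ! e i)"
        using mono that e_mem[OF i] j by auto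
      show "l (vs ! e i) < length Xs" "vs ! i \<in> Xs ! l (vs ! i)" "vs ! i \<in> Xs ! l (vs ! e i)"
        using l V e_mem[OF i] i by auto
    qed
    then have "(!) vs ` {i. i \<le> j \<and> j \<le> e i} \<subseteq> Xs ! l (vs ! j)" by auto
    moreover have "inj_on ((!) vs) {i. i \<le> j \<and> j \<le> e i}"
      using vs(2,3) j by (auto simp: inj_on_def nth_eq_iff_index_eq)
    moreover have "Xs ! l (vs ! j) \<in> set Xs" using l V j by auto
    ultimately show ?thesis using bag by (meson card_inj_on_le order_trans)
  qed
  obtain \<phi> where \<phi>: "minor_model (ladder id) (cells ?n) {..<?n}
     {(i, j). i < j \<and> j \<le> e i \<or> j < i \<and> i \<le> e j} \<phi>"
    by (rule ladder_interval_minor[of ?n e]) (use card e_mem in auto)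
  note P = minor_modelD[OF \<phi>]
  define ix where "ix v = (SOME i. i < ?n \<and> vs ! i = v)" for v
  have ix: "ix v < ?n" "vs ! ix v = v" if "v \<in> ?V" for v
  proof -
    have "\<exists>i. i < ?n \<and> vs ! i = v" using that vs by (metis in_set_conv_nth)
    from someI_ex[OF this] show "ix v < ?n" "vs ! ix v = v" by (auto simp: ix_def)
  qed
  have one: "ix v \<le> e (ix u)"
    if uv: "u \<in> ?V" "v \<in> ?V" "(u, v) \<in> parcs H \<or> (v, u) \<in> parcs H" "ix u < ix v" for u v
  proof -
    obtain k where k: "k < length Xs" "u \<in> Xs ! k" "v \<in> Xs ! k"
      using edge uv(3) by (metis in_set_conv_nth)
    \<comment> \<open>The first bag of \<open>v\<close> lies between the first bag of
      \<open>u\<close> and a bag common to both.\<close>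
    have "u \<in> Xs ! l v"
      by (rule int[of "l u" _ k]) (use l_le k l mono[of "ix u" "ix v"] ix uv in auto)
    then show ?thesis using e_ge[of "ix u" "ix v"] ix uv by auto
  qed
  have "minor_model (ladder id) (cells ?n) ?V (parcs H) (\<lambda>v. \<phi> (ix v))"
  proof (rule minor_modelI)
    fix u assume u: "u \<in> ?V"
    show "conn (ladder id) (\<phi> (ix u))" "\<phi> (ix u) \<subseteq> cells ?n" using P(1,2) ix[OF u] by auto
    fix v assume v: "v \<in> ?V" "u \<noteq> v"
    have ne: "ix u \<noteq> ix v" using ix u v by metis
    then show "\<phi> (ix u) \<inter> \<phi> (ix v) = {}" using P(3) ix u v by auto
    assume "(u, v) \<in> parcs H"
    then have "(ix u, ix v) \<in> {(i, j). i < j \<and> j \<le> e i \<or> j < i \<and> i \<le> e j}"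
      using one[of u v] one[of v u] u v ne by (auto simp: nat_neq_iff)
    then show "\<exists>x\<in>\<phi> (ix u). \<exists>y\<in>\<phi> (ix v). (x, y) \<in> ladder id"
      using P(4) ix u v ne by auto
  qed
  then show ?thesis by (auto simp: minor_def)
qed

section \<open>Monotone subsequences and ladders with permuted rungs\<close>

lemma finite_enumeration:
  assumes "finite (T :: nat set)" "n \<le> card T"
  obtains g where "\<And>i. i < n \<Longrightarrow> g i \<in> T" "\<And>i j. i < j \<Longrightarrow> j < n \<Longrightarrow> g i < g j"
proof -
  let ?xs = "sorted_list_of_set T"
  have "sorted_wrt (<) ?xs" by simp
  then have "?xs ! i < ?xs ! j" if "i < j" "j < n" for i j
    using that assms by (intro sorted_wrt_nth_less[of "(<)"]) auto
  moreover have "?xs ! i \<in> T" if "i < n" for i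
    using that assms by (metis length_sorted_list_of_set
    nth_mem order_less_le_trans set_sorted_list_of_set)
  ultimately show ?thesis using that by blast
qed

text \<open>Each position is labelled by the sizes of the largest increasing and the largest
  decreasing chain ending there. Of two positions the later one has the larger label in one
  coordinate, so the labels are distinct; without a chain of size \<open>n\<close> there would be
  too few of them.\<close>

lemma erdos_szekeres:
  fixes f :: "nat \<Rightarrow> nat"
  assumes "finite S" "inj_on f S" "n\<^sup>2 \<le> card S"
  obtains g where "\<And>i. i < n \<Longrightarrow> g i \<in> S" "\<And>i j. i < j \<Longrightarrow> j < n \<Longrightarrow> g i < g j"
    "(\<forall>i j. i < j \<and> j < n \<longrightarrow> f (g i) < f (g j)) \<or> (\<forall>i j. i < j \<and> j < n \<longrightarrow> f (g j) < f (g i))"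
proof (cases "n = 0")
  case True then show ?thesis using that[of id] by auto
next
  case n: False
  define chain where "chain P T \<longleftrightarrow> T \<subseteq> S \<and> (\<forall>x\<in>T. \<forall>y\<in>T. x < y \<longrightarrow> P (f x) (f y))"
    for P :: "nat \<Rightarrow> nat \<Rightarrow> bool" and T
  have "\<exists>T. (chain (<) T \<or> chain (>) T) \<and> n \<le> card T"
  proof (rule ccontr)
    assume no: "\<not> ?thesis"
    define a where "a P x = Max {card T |T. chain P T \<and> x \<in> T \<and> (\<forall>y\<in>T. y \<le> x)}" for P x
    have fin: "finite {card T |T. chain P T \<and> x \<in> T \<and> (\<forall>y\<in>T. y \<le> x)}" for P x
    proof (rule finite_subset)
      show "{card T |T. chain P T \<and> x \<in> T \<and> (\<forall>y\<in>T. y \<le> x)} \<subseteq> card ` Pow S"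
        by (auto simp: chain_def)
    qed (use assms in auto)
    have ex: "\<exists>T. chain P T \<and> x \<in> T \<and> (\<forall>y\<in>T. y \<le> x) \<and> card T = a P x" if "x \<in> S" for P x
    proof -
      have "card {x} \<in> {card T |T. chain P T \<and> x \<in> T \<and> (\<forall>y\<in>T. y \<le> x)}"
        using that by (intro CollectI exI[of _ "{x}"]) (auto simp: chain_def)
      then have "a P x \<in> {card T |T. chain P T \<and> x \<in> T \<and> (\<forall>y\<in>T. y \<le> x)}"
        unfolding a_def using fin by (intro Max_in) auto
      then show ?thesis by auto
    qed
    have less: "a P x < a P y" if xS: "x \<in> S" and "y \<in> S" "x < y" "P (f x) (f y)" "transp P"
      for P x y
    proof -
      obtain T where T: "chain P T" "x \<in> T" "\<forall>z\<in>T. z \<le> x" "card T = a P x"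
        using ex[OF xS, of P] by auto
      have "P (f z) (f y)" if "z \<in> T" for z
      proof (cases "z = x")
        case False
        then have "z < x" using T(3) \<open>z \<in> T\<close> by (simp add: order_less_le)
        then have "P (f z) (f x)" using T(1,2) \<open>z \<in> T\<close> by (auto simp: chain_def)
        then show ?thesis using \<open>P (f x) (f y)\<close> \<open>transp P\<close> by (auto dest: transpD)
      qed (use \<open>P (f x) (f y)\<close> in auto)
      moreover have "\<And>z. z \<in> T \<Longrightarrow> z < y" using T(3) \<open>x < y\<close> by (meson le_less_trans)
      ultimately have "chain P (insert y T)"
        using T(1) \<open>y \<in> S\<close> unfolding chain_def
        by (metis insert_iff insert_subset order_less_asym)
      moreover have "y \<notin> T" using T(3) \<open>x < y\<close> by auto
      moreover have "finite T" using T(1) assms(1) by (auto simp: chain_def intro: finite_subset)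
      moreover have "card (insert y T) \<le> a P y"
        unfolding a_def
      proof (rule Max_ge[OF fin])
        show "card (insert y T) \<in> {card T |T. chain P T \<and> y \<in> T \<and> (\<forall>z\<in>T. z \<le> y)}"
          using \<open>chain P (insert y T)\<close> \<open>\<And>z. z \<in> T \<Longrightarrow> z < y\<close>
          by (intro CollectI exI[of _ "insert y T"]) (auto intro: less_imp_le)
      qed
      ultimately show ?thesis using T(4) by simp
    qed
    have "inj_on (\<lambda>x. (a (<) x, a (>) x)) S"
    proof (rule inj_onI, rule ccontr)
      fix x y assume xy: "x \<in> S" "y \<in> S" "(a (<) x, a (>) x) = (a (<) y, a (>) y)" "x \<noteq> y"
      then have "f x \<noteq> f y" using assms(2) by (auto dest: inj_onD)
      then have "x < y \<and> f x < f y \<or> x < y \<and> f x > f y \<or> y < x \<and> f y < f x \<or> y < x \<and> f y > f x"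
        using xy by linarith
      moreover have "transp ((<) :: nat \<Rightarrow> _)" "transp ((>) :: nat \<Rightarrow> _)" by (auto simp: transp_def)
      ultimately show False
        using less[of x y "(<)"] less[of x y "(>)"] less[of y x "(<)"] less[of y x "(>)"] xy
        by auto
    qed
    \<comment> \<open>Excluding 0 from one coordinate leaves only \<open>n * (n - 1)\<close> labels,
      which makes the comparison with \<open>n\<^sup>2\<close> strict.\<close>
    moreover have "(\<lambda>x. (a (<) x, a (>) x)) ` S \<subseteq> {..<n} \<times> {1..<n}"
    proof -
      have "a P x < n" "1 \<le> a P x" if x: "x \<in> S" and P: "P = (<) \<or> P = (>)" for P x
      proof -
        obtain T where T: "chain P T" "x \<in> T" "card T = a P x"
          using ex[OF x, of P] by auto
        then show "a P x < n" using no P by (metis not_le)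
        have "finite T" using T(1) assms(1) by (auto simp: chain_def intro: finite_subset)
        then show "1 \<le> a P x" using T card_gt_0_iff[of T] by (auto simp: Suc_le_eq)
      qed
      then show ?thesis by auto
    qed
    ultimately have "card S \<le> card ({..<n} \<times> {1..<n})" by (intro card_inj_on_le) auto
    also have "\<dots> < n\<^sup>2" using n by (simp add: power2_eq_square)
    finally show False using assms(3) by simp
  qed
  then obtain T where T: "chain (<) T \<or> chain (>) T" "n \<le> card T" by blast
  moreover have sub: "T \<subseteq> S" using T(1) by (auto simp: chain_def)
  ultimately obtain g where g: "\<And>i. i < n \<Longrightarrow> g i \<in> T" "\<And>i j. i < j \<Longrightarrow> j < n \<Longrightarrow> g i < g j"
    using finite_enumeration[of T n] assms(1) finite_subset by metis
  have "f (g i) < f (g j)" if "i < j" "j < n" "chain (<) T" for i j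
    using g(1)[of i] g(1)[of j] g(2)[OF that(1,2)] that by (auto simp: chain_def)
  moreover have "f (g j) < f (g i)" if "i < j" "j < n" "chain (>) T" for i j
    using g(1)[of i] g(1)[of j] g(2)[OF that(1,2)] that by (auto simp: chain_def)
  ultimately show ?thesis using g sub T(1) by (intro that[of g]) blast+
qed

text \<open>The consecutive intervals \<open>A j\<close> may run in either direction, for increasing and for decreasing rungs.\<close>

definition rail_parts :: "nat \<Rightarrow> (nat \<Rightarrow> nat) \<Rightarrow> (nat \<Rightarrow> nat set) \<Rightarrow> bool" where
  "rail_parts n x A \<longleftrightarrow>
     (\<forall>j<n. x j \<in> A j \<and> (\<exists>a b. A j = {a..b})) \<and>
     (\<forall>i<n. \<forall>j<n. i \<noteq> j \<longrightarrow> A i \<inter> A j = {}) \<and>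
     (\<forall>j. Suc j < n \<longrightarrow> (\<exists>u\<in>A j. \<exists>v\<in>A (Suc j). v = Suc u \<or> u = Suc v)) \<and>
     (\<forall>j<n. \<forall>y\<in>A j. (\<exists>i<n. x i \<le> y) \<and> (\<exists>i<n. y \<le> x i))"

lemma strict_mono_below:
  fixes x :: "nat \<Rightarrow> nat"
  assumes "\<And>i j. i < j \<Longrightarrow> j < n \<Longrightarrow> x i < x j" "i \<le> j" "j < n"
  shows "x i \<le> x j"
  using assms(1)[of i j] assms(2,3) by (cases "i = j") auto

lemma rail_parts_increasing:
  assumes "\<And>i j. i < j \<Longrightarrow> j < n \<Longrightarrow> x i < x j"
  obtains A where "rail_parts n x A"
proof
  note le = strict_mono_below[of n x, OF assms]
  \<comment> \<open>Each interval runs up to the next mark; the last one is a single index, so that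
    all parts stay between the smallest and the largest mark.\<close>
  let ?A = "\<lambda>j. {x j..if Suc j < n then x (Suc j) - 1 else x j}"
  have S: "x j < x (Suc j)" if "Suc j < n" for j using assms[of j "Suc j"] that by simp
  have disj: "?A i \<inter> ?A j = {}" if "i < j" "j < n" for i j
  proof -
    have "Suc i < n" "x (Suc i) \<le> x j" using le[of "Suc i" j] that by auto
    then show ?thesis using S[of i] by auto
  qed
  show "rail_parts n x ?A"
    unfolding rail_parts_def
  proof (intro conjI allI impI ballI)
    fix j assume j: "j < n"
    show "x j \<in> ?A j" using S[of j] by auto
    show "\<exists>a b. ?A j = {a..b}" by blast
    fix i assume "i < n" "i \<noteq> j"
    then show "?A i \<inter> ?A j = {}" using disj[of i j] disj[of j i] j by (cases "i < j") auto
  next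
    fix j assume j: "Suc j < n"
    show "\<exists>u\<in>?A j. \<exists>v\<in>?A (Suc j). v = Suc u \<or> u = Suc v"
      by (rule bexI[of _ "x (Suc j) - 1"], rule bexI[of _ "x (Suc j)"])
        (use S[of j] S[of "Suc j"] j in auto)
  next
    fix j y assume j: "j < n" "y \<in> ?A j"
    then show "\<exists>i<n. x i \<le> y" by auto
    show "\<exists>i<n. y \<le> x i"
      using j by (intro exI[of _ "if Suc j < n then Suc j else j"]) auto
  qed
qed

lemma rail_parts_decreasing:
  assumes "\<And>i j. i < j \<Longrightarrow> j < n \<Longrightarrow> x j < x i"
  obtains A where "rail_parts n x A"
proof
  have le: "x j \<le> x i" if "i \<le> j" "j < n" for i j using assms[of i j] that by (cases "i = j") auto
  let ?A = "\<lambda>j. {if Suc j < n then Suc (x (Suc j)) else x j..x j}"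
  have S: "x (Suc j) < x j" if "Suc j < n" for j using assms[of j "Suc j"] that by simp
  have disj: "?A i \<inter> ?A j = {}" if "i < j" "j < n" for i j
  proof -
    have "Suc i < n" "x j \<le> x (Suc i)" using le[of "Suc i" j] that by auto
    then show ?thesis using S[of i] by auto
  qed
  show "rail_parts n x ?A"
    unfolding rail_parts_def
  proof (intro conjI allI impI ballI)
    fix j assume j: "j < n"
    show "x j \<in> ?A j" using S[of j] by auto
    show "\<exists>a b. ?A j = {a..b}" by blast
    fix i assume "i < n" "i \<noteq> j"
    then show "?A i \<inter> ?A j = {}" using disj[of i j] disj[of j i] j by (cases "i < j") auto
  next
    fix j assume j: "Suc j < n"
    show "\<exists>u\<in>?A j. \<exists>v\<in>?A (Suc j). v = Suc u \<or> u = Suc v"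
      by (rule bexI[of _ "Suc (x (Suc j))"], rule bexI[of _ "x (Suc j)"])
        (use S[of j] S[of "Suc j"] j in auto)
  next
    fix j y assume j: "j < n" "y \<in> ?A j"
    then show "\<exists>i<n. y \<le> x i" by auto
    show "\<exists>i<n. x i \<le> y"
      using j by (intro exI[of _ "if Suc j < n then Suc j else j"]) auto
  qed
qed

lemma conn_rail:
  assumes "a \<le> b" "c = 0 \<or> c = 2"
  shows "conn (ladder \<pi>) ({c} \<times> {a..b})"
proof (rule conn_rootI[OF sym_ladder, of "(c, a)"])
  let ?R = "(ladder \<pi> \<inter> ({c} \<times> {a..b}) \<times> ({c} \<times> {a..b}))\<^sup>*"
  have "((c, a), (c, a + k)) \<in> ?R" if "a + k \<le> b" for k
    using that
  proof (induction k)
    case (Suc k)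
    have "((c, a + k), (c, a + Suc k)) \<in> ladder \<pi> \<inter> ({c} \<times> {a..b}) \<times> ({c} \<times> {a..b})"
      using Suc.prems assms(2) ladderI(1,2)[of "a + k" \<pi>] by auto
    then show ?case using Suc by (auto intro: rtrancl_into_rtrancl)
  qed simp
  then show "((c, a), y) \<in> ?R" if "y \<in> {c} \<times> {a..b}" for y
    using that by (cases y) (force dest: le_Suc_ex)
qed (use assms in auto)

text \<open>This serves twice: to find a ladder in a graph from two paths and the connections
  between them, and to find an ordinary ladder inside one with permuted rungs. The sets
  \<open>I j\<close> become the rung vertices, and the intervals \<open>A j\<close> and
  \<open>B j\<close> of the two paths become the rail vertices.\<close>

lemma rails_minor_model:
  assumes sym: "sym E" and p: "walk E p" "distinct p" and q: "walk E q" "distinct q"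
    and pq: "set p \<inter> set q = {}"
    and "rail_parts n x A" "rail_parts n y B"
    and xl: "\<And>j. j < n \<Longrightarrow> x j < length p" and yl: "\<And>j. j < n \<Longrightarrow> y j < length q"
    and AW: "\<And>j. j < n \<Longrightarrow> (!) p ` A j \<subseteq> W" and BW: "\<And>j. j < n \<Longrightarrow> (!) q ` B j \<subseteq> W"
    and I: "\<And>j. j < n \<Longrightarrow> I j \<subseteq> W - set p - set q" "\<And>j. j < n \<Longrightarrow>
    conn E (I j)" "disjoint_family_on I {..<n}"
      "\<And>j. j < n \<Longrightarrow> \<exists>z\<in>I j. (p ! x j, z) \<in> E" "\<And>j. j < n \<Longrightarrow> \<exists>z\<in>I j. (z, q ! y (\<pi> j)) \<in> E"
  shows "\<exists>\<psi>. minor_model E W (cells n) (ladder \<pi>) \<psi>"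
proof -
  note A = assms(7)[unfolded rail_parts_def] and B = assms(8)[unfolded rail_parts_def]
  have Al: "A j \<subseteq> {..<length p}" and Bl: "B j \<subseteq> {..<length q}" if j: "j < n" for j
  proof -
    have "\<exists>i<n. k \<le> x i" if "k \<in> A j" for k using A j that by simp
    then show "A j \<subseteq> {..<length p}" using xl by (auto dest: le_less_trans)
    have "\<exists>i<n. k \<le> y i" if "k \<in> B j" for k using B j that by simp
    then show "B j \<subseteq> {..<length q}" using yl by (auto dest: le_less_trans)
  qed
  have xA: "x j \<in> A j" and yB: "y j \<in> B j" if "j < n" for j using A B that by auto
  define \<psi> where "\<psi> u = (if fst u = 0 then (!) p ` A (snd u) else if fst u = 1 then I (snd u)
      else (!) q ` B (snd u))" for u :: "nat \<times> nat"
  have cA: "conn E ((!) p ` A j)" and cB: "conn E ((!) q ` B j)" if j: "j < n" for j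
  proof -
    obtain k l where mn: "A j = {k..l}" using A j by auto
    then show "conn E ((!) p ` A j)"
      using conn_nth[OF sym p(1), of k l] xA[OF j] subsetD[OF Al[OF j], of l] by auto
    obtain k l where mn: "B j = {k..l}" using B j by auto
    then show "conn E ((!) q ` B j)"
      using conn_nth[OF sym q(1), of k l] yB[OF j] subsetD[OF Bl[OF j], of l] by auto
  qed
  have pA: "(!) p ` A j \<subseteq> set p" and qB: "(!) q ` B j \<subseteq> set q" if "j < n" for j
    using Al[OF that] Bl[OF that] by (auto intro!: nth_mem)
  have dA: "(!) p ` A i \<inter> (!) p ` A j = {}" and dB: "(!) q ` B i \<inter> (!) q ` B j = {}"
    if ij: "i < n" "j < n" "i \<noteq> j" for i j
  proof -
    have d: "A i \<inter> A j = {}" "B i \<inter> B j = {}" using A B ij by simp_all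
    show "(!) p ` A i \<inter> (!) p ` A j = {}"
    proof (rule ccontr)
      assume "(!) p ` A i \<inter> (!) p ` A j \<noteq> {}"
      then obtain k l where "k \<in> A i" "l \<in> A j" "p ! k = p ! l" by auto
      moreover from this have "k < length p" "l < length p" using Al ij by auto
      ultimately show False using d p(2) by (metis disjoint_iff nth_eq_iff_index_eq)
    qed
    show "(!) q ` B i \<inter> (!) q ` B j = {}"
    proof (rule ccontr)
      assume "(!) q ` B i \<inter> (!) q ` B j \<noteq> {}"
      then obtain k l where "k \<in> B i" "l \<in> B j" "q ! k = q ! l" by auto
      moreover from this have "k < length q" "l < length q" using Bl ij by auto
      ultimately show False using d q(2) by (metis disjoint_iff nth_eq_iff_index_eq)
    qed
  qed
  have dI: "I i \<inter> I j = {}" if "i < n" "j < n" "i \<noteq> j" for i j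
    using I(3) that by (auto simp: disjoint_family_on_def)
  have edge: "\<exists>a\<in>\<psi> u. \<exists>b\<in>\<psi> v. (a, b) \<in> E"
    if uv: "snd u < n" "snd v < n"
      and adj: "(\<exists>i. u = (0, i) \<and> v = (0, Suc i)) \<or> (\<exists>i. u = (2, i) \<and> v = (2, Suc i)) \<or>
       (\<exists>i. u = (0, i) \<and> v = (1, i)) \<or> (\<exists>i. u = (1, i) \<and> v = (2, \<pi> i))" for u v
  proof -
    have nbr: "(r ! k, r ! l) \<in> E"
      if "walk E r" "l = Suc k \<or> k = Suc l" "k < length r" "l < length r" for r k l
      using walk_nth[OF that(1)] that(2-4) sym by (auto dest: symD)
    consider i where "u = (0, i)" "v = (0, Suc i)" | i where "u = (2, i)" "v = (2, Suc i)"
      | i where "u = (0, i)" "v = (1, i)" | i where "u = (1, i)" "v = (2, \<pi> i)" using adj by blast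
    then show ?thesis
    proof cases
      case (1 i)
      then have i: "i < n" "Suc i < n" using uv by auto
      then obtain k l where "k \<in> A i" "l \<in> A (Suc i)" "l = Suc k \<or> k = Suc l" using A by auto
      moreover from this have "k < length p" "l < length p"
        using subsetD[OF Al[OF i(1)]] subsetD[OF Al[OF i(2)]] by auto
      ultimately show ?thesis using nbr[OF p(1)] 1 by (auto simp: \<psi>_def)
    next
      case (2 i)
      then have i: "i < n" "Suc i < n" using uv by auto
      then obtain k l where "k \<in> B i" "l \<in> B (Suc i)" "l = Suc k \<or> k = Suc l" using B by auto
      moreover from this have "k < length q" "l < length q"
        using subsetD[OF Bl[OF i(1)]] subsetD[OF Bl[OF i(2)]] by auto
      ultimately show ?thesis using nbr[OF q(1)] 2 by (auto simp: \<psi>_def)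
    next
      case (3 i)
      then have i: "i < n" using uv by auto
      then show ?thesis using I(4)[OF i] xA[OF i] 3 by (auto simp: \<psi>_def)
    next
      case (4 i)
      then have i: "i < n" "\<pi> i < n" using uv by auto
      then show ?thesis using I(5)[OF i(1)] yB[OF i(2)] 4 by (auto simp: \<psi>_def)
    qed
  qed
  have "minor_model E W (cells n) (ladder \<pi>) \<psi>"
  proof (rule minor_modelI)
    fix u :: "nat \<times> nat" assume u: "u \<in> cells n"
    then have k: "fst u = 0 \<or> fst u = 1 \<or> fst u = 2" "snd u < n" by auto
    show "conn E (\<psi> u)" using cA[OF k(2)] cB[OF k(2)] I(2)[OF k(2)] by (auto simp: \<psi>_def)
    show "\<psi> u \<subseteq> W"
      using AW[OF k(2)] BW[OF k(2)] I(1)[OF k(2)] by (auto simp: \<psi>_def)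
    fix v :: "nat \<times> nat" assume v: "v \<in> cells n" "u \<noteq> v"
    then have k': "fst v = 0 \<or> fst v = 1 \<or> fst v = 2" "snd v < n" by auto
    show "\<psi> u \<inter> \<psi> v = {}"
    proof (cases "fst u = fst v")
      case True
      then have "snd u \<noteq> snd v" using v(2) by (auto simp: prod_eq_iff)
      then show ?thesis using dA dB dI k(2) k'(2) True unfolding \<psi>_def by simp
    next
      case False
      have "(!) p ` A i \<inter> (!) q ` B j = {}" "(!) p ` A i \<inter> I j = {}" "(!) q ` B i \<inter> I j = {}"
        if "i < n" "j < n" for i j
        using pA[OF that(1)] qB[OF that(1)] qB[OF that(2)] I(1)[OF that(2)] pq(1) by blast+
      then show ?thesis using False k k' unfolding \<psi>_def by (auto simp: Int_commute)
    qed
    assume "(u, v) \<in> ladder \<pi>"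
    then consider "\<exists>a\<in>\<psi> u. \<exists>b\<in>\<psi> v. (a, b) \<in> E" | "\<exists>a\<in>\<psi> v. \<exists>b\<in>\<psi> u. (a, b) \<in> E"
    proof (cases rule: ladderE)
      case (1 i) then show ?thesis using edge[of u v] k k' that by auto
    next
      case (2 i) then show ?thesis using edge[of u v] k k' that by auto
    next
      case (3 i) then show ?thesis using edge[of u v] k k' that by auto
    next
      case (4 i) then show ?thesis using edge[of u v] k k' that by auto
    next
      case (5 i) then show ?thesis using edge[of v u] k k' that by auto
    next
      case (6 i) then show ?thesis using edge[of v u] k k' that by auto
    next
      case (7 i) then show ?thesis using edge[of v u] k k' that by auto
    next
      case (8 i) then show ?thesis using edge[of v u] k k' that by auto
    qed
    then show "\<exists>a\<in>\<psi> u. \<exists>b\<in>\<psi> v. (a, b) \<in> E"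
      using sym by cases (auto dest: symD)
  qed
  then show ?thesis by blast
qed

text \<open>Erdos-Szekeres selects \<open>n\<close> rungs whose ends on the second rail are
  monotone; if they decrease, that rail is traversed backwards, which \<open>rail_parts\<close>
  permits. The two index ranges are recorded because they will be the two blocks between which the
  rungs run.\<close>

lemma parallel_rungs_minor:
  assumes "finite S" "inj_on \<pi> S" "n\<^sup>2 \<le> card S" "S \<subseteq> {p..<p'}" "\<pi> ` S \<subseteq> {q..<q'}"
  shows "minor (ladder \<pi>) ({0, 1} \<times> {p..<p'} \<union> {2} \<times> {q..<q'}) (cells n) (ladder id)"
proof -
  obtain g where g: "\<And>i. i < n \<Longrightarrow> g i \<in> S" "\<And>i j. i < j \<Longrightarrow> j < n \<Longrightarrow> g i < g j"
    "(\<forall>i j. i < j \<and> j < n \<longrightarrow> \<pi> (g i) < \<pi> (g j)) \<or> (\<forall>i j. i < j \<and> j < n \<longrightarrow> \<pi> (g j) < \<pi> (g i))"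
    by (rule erdos_szekeres[OF assms(1-3)]) blast
  obtain A where A: "rail_parts n g A" using rail_parts_increasing[of n g] g(2) by blast
  obtain B where B: "rail_parts n (\<lambda>i. \<pi> (g i)) B"
    using g(3) rail_parts_increasing[of n "\<lambda>i. \<pi> (g i)"] rail_parts_decreasing[of n "\<lambda>i. \<pi> (g i)"]
    by meson
  \<comment> \<open>The rails start at index 0 so that list positions and ladder columns agree; the
    bounds in \<open>rail_parts\<close> keep the model out of the columns below \<open>p\<close> and
    \<open>q\<close>.\<close>
  let ?rail = "\<lambda>c n. map (Pair c) [0..<n]" and ?W = "{0 :: nat, 1} \<times> {p..<p'} \<union> {2} \<times> {q..<q'}"
  have gI: "g i \<in> {p..<p'}" "\<pi> (g i) \<in> {q..<q'}" if "i < n" for i using g(1)[OF that] assms(4,5)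
    by auto
  have walk: "walk (ladder \<pi>) (?rail c m)" if "c = 0 \<or> c = 2" "m > 0" for c m
    unfolding walk_def successively_conv_nth using that ladderI(1,2) by auto
  have parts: "(!) (?rail d m') ` C j \<subseteq> {d} \<times> {m..<m'}"
    if "rail_parts n z C" "\<And>i. i < n \<Longrightarrow> z i \<in> {m..<m'}" "j < n" for d :: nat and m m' z C j
  proof -
    have "m \<le> y \<and> y < m'" if "y \<in> C j" for y
    proof -
      obtain i k where "i < n" "z i \<le> y" "k < n" "y \<le> z k"
        using \<open>rail_parts n z C\<close> \<open>j < n\<close> \<open>y \<in> C j\<close> unfolding rail_parts_def by meson
      then show ?thesis using \<open>\<And>i. i < n \<Longrightarrow> z i \<in> {m..<m'}\<close>[of i] \<open>\<And>i. i < n \<Longrightarrow> z i \<in> {m..<m'}\<close>[of k]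
        by auto
    qed
    then show ?thesis by auto
  qed
  show ?thesis
  proof (cases "n = 0")
    case True then show ?thesis by (simp add: minor_def minor_model_def)
  next
    case False
    then have pos: "p' > 0" "q' > 0" using gI[of 0] by auto
    have "\<exists>\<psi>. minor_model (ladder \<pi>) ?W (cells n) (ladder id) \<psi>"
    proof (rule rails_minor_model[OF sym_ladder walk[of 0 p'] _ walk[of 2 q'] _ _ A B,
      where I = "\<lambda>j. {(1, g j)}"])
      fix j assume j: "j < n"
      have lt: "g j < p'" "\<pi> (g j) < q'" using gI[OF j] by auto
      then show "g j < length (?rail 0 p')" "\<pi> (g j) < length (?rail 2 q')" by simp_all
      have "(!) (?rail 0 p') ` A j \<subseteq> {0 :: nat} \<times> {p..<p'}" by (rule parts[OF A gI(1) j])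
      then show "(!) (?rail 0 p') ` A j \<subseteq> ?W" by (rule order_trans) auto
      have "(!) (?rail 2 q') ` B j \<subseteq> {2 :: nat} \<times> {q..<q'}" by (rule parts[OF B gI(2) j])
      then show "(!) (?rail 2 q') ` B j \<subseteq> ?W" by (rule order_trans) auto
      show "{(1, g j)} \<subseteq> ?W - set (?rail 0 p') - set (?rail 2 q')" using gI[OF j] by auto
      show "\<exists>z\<in>{(1, g j)}. (?rail 0 p' ! g j, z) \<in> ladder \<pi>"
        "\<exists>z\<in>{(1, g j)}. (z, ?rail 2 q' ! \<pi> (g (id j))) \<in> ladder \<pi>"
        using lt ladderI(3)[of "g j" \<pi>] ladderI(4)[of "g j" \<pi>] by simp_all
    next
      show "disjoint_family_on (\<lambda>j. {(1, g j)}) {..<n}"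
        unfolding disjoint_family_on_def using g(2) by (auto simp: nat_neq_iff)
    qed (use pos in \<open>auto simp: distinct_map inj_on_def\<close>)
    then show ?thesis by (simp add: minor_def)
  qed
qed

section \<open>Small clique minors in dense bipartite graphs\<close>

text \<open>A clique minor will use every connector for one pair only. Demanding it for all pairs
  allows \<open>X\<close> to be shrunk and the pairs to be assigned after the connectors have been
  set aside.\<close>

definition connector :: "('a \<times> 'a) set \<Rightarrow> nat \<Rightarrow> 'a set \<Rightarrow> 'a set \<Rightarrow> bool" where
  "connector E m X Y \<longleftrightarrow>
     (\<forall>x\<in>X. \<forall>y\<in>X. x \<noteq> y \<longrightarrow>
       (\<exists>Z \<subseteq> Y. conn E Z \<and> card Z \<le> m \<and> (\<exists>z\<in>Z. (x, z) \<in> E) \<and> (\<exists>z\<in>Z. (z, y) \<in> E)))"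

text \<open>In a minimal nonempty subset of density \<open>4 * D\<close>, every vertex set meets
  many arcs. Among at most \<open>2 ^ r\<close> vertices the balls around a fixed vertex cannot keep
  doubling, so some ball of radius \<open>R \<le> r\<close> fails to double. The arcs meeting it are
  covered by pairs of consecutive layers whose total size is below three times that of the ball, and
  one pair must have density \<open>D\<close>. Two vertices in the inner layer of this pair are
  joined through the centre, inside the smaller ball.\<close>

lemma dense_bipartite_step:
  fixes E :: "('a \<times> 'a) set"
  assumes sym: "sym E" and bip: "\<And>x y. (x, y) \<in> E \<Longrightarrow> \<sigma> x \<noteq> (\<sigma> y :: bool)"
    and V: "finite V" "V \<noteq> {}" "card V \<le> 2 ^ r" and "D > 0"
    and dense: "4 * D * card V \<le> card (E \<inter> V \<times> V)"
  shows "\<exists>V' s. V' \<subseteq> V \<and> V' \<noteq> {} \<and> D * card V' \<le> card (E \<inter> V' \<times> V') \<and>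
           connector E (2 * r) {x \<in> V'. \<sigma> x = s} (V - V')"
proof -
  let ?P = "\<lambda>S. S \<subseteq> V \<and> S \<noteq> {} \<and> 4 * D * card S \<le> card (E \<inter> S \<times> S)"
  obtain V1 where V1: "?P V1" and min: "\<And>S. ?P S \<Longrightarrow> card V1 \<le> card S"
    using arg_min_nat_lemma[of ?P V card] V dense by blast
  have finV1: "finite V1" using V1 V finite_subset by blast
  \<comment> \<open>By minimality \<open>V1 - S\<close> falls short of the density, so the arcs that
    meet \<open>S\<close> make up the difference.\<close>
  have touch: "4 * D * card S \<le> card (E \<inter> V1 \<times> V1 - (V1 - S) \<times> (V1 - S))"
    if S: "S \<subseteq> V1" "S \<noteq> {}" for S
  proof (cases "S = V1")
    case True then show ?thesis using V1 by simp
  next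
    case False
    have fin: "finite S" using S finV1 finite_subset by blast
    have lt: "card (V1 - S) < card V1" using S finV1 by (intro psubset_card_mono) auto
    then have less: "card (E \<inter> (V1 - S) \<times> (V1 - S)) < 4 * D * card (V1 - S)"
      using min[of "V1 - S"] V1 False S
      by (meson Diff_eq_empty_iff Diff_subset not_le order_trans subset_antisym)
    have "card (E \<inter> V1 \<times> V1 - (V1 - S) \<times> (V1 - S)) = card (E \<inter> V1 \<times> V1) - card (E \<inter> (V1 - S) \<times> (V1 - S))"
    proof -
      have "E \<inter> V1 \<times> V1 - (V1 - S) \<times> (V1 - S) = E \<inter> V1 \<times> V1 - E \<inter> (V1 - S) \<times> (V1 - S)" by auto
      moreover have "finite (E \<inter> (V1 - S) \<times> (V1 - S))" using finV1 by simp
      moreover have "E \<inter> (V1 - S) \<times> (V1 - S) \<subseteq> E \<inter> V1 \<times> V1" by auto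
      ultimately show ?thesis by (metis card_Diff_subset)
    qed
    moreover have "card (V1 - S) = card V1 - card S" "card S \<le> card V1"
      using fin S finV1 by (auto intro: card_Diff_subset card_mono)
    moreover have "4 * D * card V1 \<le> card (E \<inter> V1 \<times> V1)" using V1 by blast
    ultimately show ?thesis using less by (simp add: right_diff_distrib')
  qed
  obtain v where v: "v \<in> V1" using V1 by blast
  define B where "B = rec_nat {v} (\<lambda>_ B. B \<union> {y \<in> V1. \<exists>x\<in>B. (x, y) \<in> E})"
  have B0: "B 0 = {v}" and BS: "B (Suc i) = B i \<union> {y \<in> V1. \<exists>x\<in>B i. (x, y) \<in> E}" for i
    by (simp_all add: B_def)
  have BV: "B i \<subseteq> V1" for i by (induction i) (use B0 BS v in auto)
  have finB: "finite (B i)" for i using BV finV1 finite_subset by blast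
  have Bmono: "B i \<subseteq> B j" if "i \<le> j" for i j
    using that by (induction j rule: dec_induct) (use BS in auto)
  have vB: "v \<in> B i" for i using Bmono[of 0 i] B0 by auto
  have "\<exists>R\<le>r. card (B (Suc R)) < 2 * card (B R)"
  proof (rule ccontr)
    assume "\<not> ?thesis"
    then have grow: "2 * card (B i) \<le> card (B (Suc i))" if "i \<le> r" for i using that
      by (simp add: not_less)
    have "2 ^ i \<le> card (B i)" if "i \<le> Suc r" for i
      using that by (induction i) (use B0 grow in \<open>fastforce+\<close>)
    then have "2 ^ Suc r \<le> card (B (Suc r))" by blast
    also have "\<dots> \<le> card V" using BV V1 V by (intro card_mono) auto
    finally have "2 * 2 ^ r \<le> card V" by simp
    moreover have "(0::nat) < 2 ^ r" by simp
    ultimately show False using V(3) by linarith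
  qed
  then obtain R where R: "R \<le> r" "card (B (Suc R)) < 2 * card (B R)" by blast
  define L where "L i = B i - (case i of 0 \<Rightarrow> {} | Suc j \<Rightarrow> B j)" for i
  have L0: "L 0 = {v}" and LS: "L (Suc i) = B (Suc i) - B i" for i by (simp_all add: L_def B0)
  have LB: "L i \<subseteq> B i" for i by (auto simp: L_def)
  have sumL: "(\<Sum>i\<le>n. card (L i)) = card (B n)" for n
  proof (induction n)
    case (Suc n)
    have "card (L (Suc n)) = card (B (Suc n)) - card (B n)"
      unfolding LS by (intro card_Diff_subset finB) (auto simp: BS)
    moreover have "card (B n) \<le> card (B (Suc n))" by (intro card_mono finB) (auto simp: BS)
    ultimately show ?case using Suc by simp
  qed (simp add: L0 B0)
  have ex_layer: "\<exists>i\<le>n. x \<in> L i" if "x \<in> B n" for x n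
    using that
  proof (induction n)
    case (Suc n)
    show ?case
    proof (cases "x \<in> B n")
      case True then show ?thesis using Suc.IH le_SucI by blast
    next
      case False then show ?thesis using Suc.prems LS by blast
    qed
  qed (simp add: L0 B0)
  \<comment> \<open>Layers alternate between the two colour classes. Hence no arc stays inside a
    layer, and the pairs \<open>P i\<close> of consecutive layers catch all arcs at the
    ball.\<close>
  have side: "x \<in> L i \<Longrightarrow> \<sigma> x = (\<sigma> v = even i)" for x i
  proof (induction i arbitrary: x)
    case 0 then show ?case by (simp add: L0)
  next
    case (Suc i)
    then have x: "x \<in> B (Suc i)" "x \<notin> B i" by (auto simp: LS)
    then obtain y where y: "y \<in> B i" "(y, x) \<in> E" using BS by auto
    obtain j where j: "j \<le> i" "y \<in> L j" using ex_layer[OF y(1)] by blast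
    have "j = i"
    proof (rule ccontr)
      assume "j \<noteq> i"
      then have "Suc j \<le> i" using j by simp
      moreover have "y \<in> B j" "x \<in> V1" using j(2) LB x(1) BV by blast+
      then have "x \<in> B (Suc j)" using y(2) by (auto simp: BS)
      ultimately show False using Bmono x by blast
    qed
    then have "\<sigma> y = (\<sigma> v = even i)" using Suc.IH j by blast
    then show ?case using bip[OF y(2)] by auto
  qed
  define P where "P i = L i \<union> L (Suc i)" for i
  have PV: "P i \<subseteq> V" for i using LB BV V1 unfolding P_def by blast
  have finP: "finite (P i)" for i using PV V finite_subset by blast
  have cover1: "\<exists>i\<le>R. x \<in> P i \<and> y \<in> P i"
    if xy: "(x, y) \<in> E" "x \<in> B R" "y \<in> V1" for x y
  proof -
    obtain i where i: "i \<le> R" "x \<in> L i" using ex_layer xy by blast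
    have "x \<in> B i" using i(2) LB by blast
    then have "y \<in> B (Suc i)" using xy by (auto simp: BS)
    then obtain j where j: "j \<le> Suc i" "y \<in> L j" using ex_layer by blast
    have "i \<le> Suc j"
    proof (rule ccontr)
      assume "\<not> i \<le> Suc j"
      then obtain i' where i': "i = Suc i'" "Suc j \<le> i'" by (cases i) auto
      have "x \<in> V1" "y \<in> B j" "(y, x) \<in> E"
        using xy BV j(2) LB sym by (blast dest: symD)+
      then have "x \<in> B (Suc j)" by (auto simp: BS)
      then show False using Bmono[OF i'(2)] i i' by (auto simp: LS)
    qed
    moreover have "i \<noteq> j" using side[OF i(2)] side[OF j(2)] bip[OF xy(1)] by auto
    ultimately have "j = Suc i \<or> i = Suc j" using j by linarith
    then show ?thesis
    proof
      assume "j = Suc i" then show ?thesis using i j by (intro exI[of _ i]) (auto simp: P_def)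
    next
      assume "i = Suc j" then show ?thesis using i j by (intro exI[of _ j]) (auto simp: P_def)
    qed
  qed
  \<comment> \<open>Averaging: at least \<open>4 * D * card (B R)\<close> arcs are distributed over
    pairs of total size below \<open>3 * card (B R)\<close>.\<close>
  have "\<exists>i\<le>R. P i \<noteq> {} \<and> D * card (P i) \<le> card (E \<inter> P i \<times> P i)"
  proof (rule ccontr)
    assume no: "\<not> ?thesis"
    have le: "card (E \<inter> P i \<times> P i) \<le> D * card (P i)" if "i \<le> R" for i
    proof (cases "P i = {}")
      case False
      then have "\<not> D * card (P i) \<le> card (E \<inter> P i \<times> P i)" using no that by blast
      then show ?thesis by simp
    qed simp
    have "4 * D * card (B R) \<le> card (E \<inter> V1 \<times> V1 - (V1 - B R) \<times> (V1 - B R))"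
      using touch[of "B R"] BV vB by blast
    also have "\<dots> \<le> card (\<Union>i\<le>R. E \<inter> P i \<times> P i)"
    proof (rule card_mono)
      show "E \<inter> V1 \<times> V1 - (V1 - B R) \<times> (V1 - B R) \<subseteq> (\<Union>i\<le>R. E \<inter> P i \<times> P i)"
      proof
        fix e assume "e \<in> E \<inter> V1 \<times> V1 - (V1 - B R) \<times> (V1 - B R)"
        then obtain x y where e: "e = (x, y)" "(x, y) \<in> E" "x \<in> V1" "y \<in> V1" "x \<in> B R \<or> y \<in> B R"
          by auto
        then have "\<exists>i\<le>R. x \<in> P i \<and> y \<in> P i"
          using cover1[of x y] cover1[of y x] sym by (auto dest: symD)
        then show "e \<in> (\<Union>i\<le>R. E \<inter> P i \<times> P i)" using e by auto
      qed
    qed (use finP in auto)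
    also have "\<dots> \<le> (\<Sum>i\<le>R. card (E \<inter> P i \<times> P i))" by (rule card_UN_le) simp
    also have "\<dots> \<le> (\<Sum>i\<le>R. D * (card (L i) + card (L (Suc i))))"
    proof (rule sum_mono)
      fix i assume "i \<in> {..R}"
      then have "card (E \<inter> P i \<times> P i) \<le> D * card (P i)" using le by simp
      also have "\<dots> \<le> D * (card (L i) + card (L (Suc i)))"
        unfolding P_def by (intro mult_le_mono2 card_Un_le)
      finally show "card (E \<inter> P i \<times> P i) \<le> D * (card (L i) + card (L (Suc i)))" .
    qed
    also have "\<dots> = D * ((\<Sum>i\<le>R. card (L i)) + (\<Sum>i\<le>R. card (L (Suc i))))"
      by (simp add: sum_distrib_left[symmetric] sum.distrib)
    also have "\<dots> \<le> D * (card (B R) + card (B (Suc R)))"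
    proof (intro mult_le_mono2 add_mono)
      have "card (B (Suc R)) = card (L 0) + (\<Sum>i\<le>R. card (L (Suc i)))"
        unfolding sumL[of "Suc R", symmetric] by (rule sum.atMost_Suc_shift)
      then show "(\<Sum>i\<le>R. card (L (Suc i))) \<le> card (B (Suc R))" by simp
    qed (simp add: sumL)
    also have "\<dots> \<le> D * (3 * card (B R))" using R by (intro mult_le_mono2) simp
    finally have "4 * (D * card (B R)) \<le> 3 * (D * card (B R))" by (simp only: mult_ac)
    moreover have "card (B R) > 0" using vB[of R] finB[of R] by (auto simp: card_gt_0_iff)
    then have "D * card (B R) > 0" using \<open>D > 0\<close> by simp
    ultimately show False by linarith
  qed
  then obtain i where i: "i \<le> R" "P i \<noteq> {}" "D * card (P i) \<le> card (E \<inter> P i \<times> P i)" by blast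
  have tree: "\<exists>Z \<subseteq> B j. conn E Z \<and> v \<in> Z \<and> z \<in> Z \<and> card Z \<le> Suc j" if "z \<in> B j" for z j
    using that
  proof (induction j arbitrary: z)
    case 0 then show ?case by (intro exI[of _ "{v}"]) (simp add: B0)
  next
    case (Suc j)
    show ?case
    proof (cases "z \<in> B j")
      case True
      then obtain Z where "Z \<subseteq> B j" "conn E Z" "v \<in> Z" "z \<in> Z" "card Z \<le> Suc j" using Suc.IH
        by blast
      then show ?thesis using BS by (intro exI[of _ Z]) auto
    next
      case False
      then obtain y where y: "y \<in> B j" "(y, z) \<in> E" using Suc.prems BS by auto
      obtain Z where Z: "Z \<subseteq> B j" "conn E Z" "v \<in> Z" "y \<in> Z" "card Z \<le> Suc j" using Suc.IH[OF y(1)]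
        by blast
      have "conn E (Z \<union> {z})" using Z y by (intro conn_Un[OF sym]) auto
      moreover have "card (Z \<union> {z}) \<le> Suc (Suc j)" using card_Un_le[of Z "{z}"] Z(5) by simp
      moreover have "Z \<union> {z} \<subseteq> B (Suc j)" using Z(1) Suc.prems BS by auto
      ultimately show ?thesis using Z by (intro exI[of _ "Z \<union> {z}"]) auto
    qed
  qed
  \<comment> \<open>The vertices of \<open>P i\<close> with the colour of layer \<open>i\<close> all
    lie in \<open>L i\<close>. For \<open>i = 0\<close> this is the centre alone and there is no
    pair to join; for \<open>i = Suc j\<close> two branches of at most \<open>Suc j \<le> r\<close>
    vertices suffice.\<close>
  have "connector E (2 * r) {x \<in> P i. \<sigma> x = (\<sigma> v = even i)} (V - P i)"
    unfolding connector_def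
  proof (intro ballI impI)
    fix x y assume "x \<in> {x \<in> P i. \<sigma> x = (\<sigma> v = even i)}"
      "y \<in> {x \<in> P i. \<sigma> x = (\<sigma> v = even i)}" "x \<noteq> y"
    then have xy: "x \<in> P i" "y \<in> P i" "\<sigma> x = (\<sigma> v = even i)" "\<sigma> y = (\<sigma> v = even i)" "x \<noteq> y" by auto
    have "x \<notin> L (Suc i)" "y \<notin> L (Suc i)" using side[of x "Suc i"] side[of y "Suc i"] xy(3,4) by auto
    then have xyL: "x \<in> L i" "y \<in> L i" using xy by (auto simp: P_def)
    then have "i \<noteq> 0" using xy(5) L0 by (metis singletonD)
    then obtain j where j: "i = Suc j" by (cases i) auto
    obtain x' where x': "x' \<in> B j" "(x', x) \<in> E" using xyL(1) BS[of j] unfolding j LS by auto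
    obtain y' where y': "y' \<in> B j" "(y', y) \<in> E" using xyL(2) BS[of j] unfolding j LS by auto
    obtain Z1 where Z1: "Z1 \<subseteq> B j" "conn E Z1" "v \<in> Z1" "x' \<in> Z1" "card Z1 \<le> Suc j"
      using tree[OF x'(1)] by blast
    obtain Z2 where Z2: "Z2 \<subseteq> B j" "conn E Z2" "v \<in> Z2" "y' \<in> Z2" "card Z2 \<le> Suc j"
      using tree[OF y'(1)] by blast
    have "conn E (Z1 \<union> Z2)" using Z1 Z2 by (intro conn_Un[OF sym]) auto
    moreover have "card (Z1 \<union> Z2) \<le> 2 * r" using card_Un_le[of Z1 Z2] Z1(5) Z2(5) i(1) R(1) j
      by simp
    moreover have "Z1 \<union> Z2 \<subseteq> V - P i"
    proof -
      have "B j \<inter> P i = {}" using BS[of j] unfolding P_def j LS by blast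
      then show ?thesis using Z1(1) Z2(1) BV[of j] V1 by blast
    qed
    moreover have "(x, x') \<in> E" using x' sym by (auto dest: symD)
    ultimately show "\<exists>Z \<subseteq> V - P i. conn E Z \<and> card Z \<le> 2 * r \<and> (\<exists>z\<in>Z. (x, z) \<in> E) \<and>
      (\<exists>z\<in>Z. (z, y) \<in> E)"
      using Z1(4) Z2(4) y'(2) by blast
  qed
  then show ?thesis using PV i(2,3) by blast
qed

lemma dense_bipartite_side:
  assumes bip: "\<And>x y. (x, y) \<in> E \<Longrightarrow> \<sigma> x \<noteq> \<sigma> y"
    and V: "finite V" "V \<noteq> {}" and "t > 0" "2 * t * card V \<le> card (E \<inter> V \<times> V)"
  shows "\<exists>X \<subseteq> V. card X = t \<and> (\<forall>x\<in>X. \<sigma> x = (s :: bool))"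
proof -
  let ?A = "{x\<in>V. \<sigma> x = s}" let ?B = "{x\<in>V. \<sigma> x \<noteq> s}"
  have "E \<inter> V \<times> V \<subseteq> ?A \<times> ?B \<union> ?B \<times> ?A" using bip by auto
  then have "card (E \<inter> V \<times> V) \<le> card (?A \<times> ?B \<union> ?B \<times> ?A)" using V by (intro card_mono) auto
  also have "\<dots> \<le> card (?A \<times> ?B) + card (?B \<times> ?A)" by (rule card_Un_le)
  also have "\<dots> = 2 * (card ?A * card ?B)" by (simp add: card_cartesian_product)
  finally have le: "t * card V \<le> card ?A * card ?B" using assms(5) by simp
  have "card V > 0" using V by (simp add: card_gt_0_iff)
  then have "card ?B > 0" using le \<open>t > 0\<close> by (intro gr0I) auto
  moreover have "t * card ?B \<le> t * card V" using V by (intro mult_le_mono2 card_mono) auto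
  then have "t * card ?B \<le> card ?A * card ?B" using le by (rule order_trans)
  ultimately have "t \<le> card ?A" by simp
  then obtain X where "X \<subseteq> ?A" "card X = t" by (meson obtain_subset_with_card_n)
  then show ?thesis by blast
qed

text \<open>\<open>a\<close> and \<open>b\<close> count the connectors still wanted for the two
  colour classes. A step costs a factor 4 of density and yields a connector for whichever class it
  happens to serve, so within \<open>a + b\<close> steps one class is complete. Each connector
  avoids the subset kept for the later steps, which makes all of them disjoint.\<close>

lemma dense_bipartite_connectors:
  assumes sym: "sym E" and bip: "\<And>x y. (x, y) \<in> E \<Longrightarrow> \<sigma> x \<noteq> \<sigma> y" and "t > 0"
    and "finite V" "V \<noteq> {}" "card V \<le> 2 ^ r" "2 * t * 4 ^ (a + b) * card V \<le> card (E \<inter> V \<times> V)"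
  shows "\<exists>s X Y. X \<subseteq> V \<and> card X = t \<and> (\<forall>x\<in>X. \<sigma> x = s) \<and>
    (\<forall>i<(if s then a else b). Y i \<subseteq> V - X \<and> connector E (2 * r) X (Y i)) \<and>
    disjoint_family_on Y {..<(if s then a else b)}"
  using assms(4-)
proof (induction "a + b" arbitrary: a b V)
  case 0
  then show ?case using dense_bipartite_side[where \<sigma> = \<sigma> and V = V and t = t
    and s = True, OF bip] \<open>t > 0\<close>
    by (auto simp: disjoint_family_on_def)
next
  case (Suc n)
  show ?case
  proof (cases "a = 0 \<or> b = 0")
    case True
    define s where "s \<longleftrightarrow> a = 0"
    have s: "(if s then a else b) = 0" using True by (cases "a = 0") (auto simp: s_def)
    have "2 * t * card V \<le> 2 * t * 4 ^ (a + b) * card V" by simp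
    also have "\<dots> \<le> card (E \<inter> V \<times> V)" by (rule Suc.prems)
    finally obtain X where "X \<subseteq> V" "card X = t" "\<forall>x\<in>X. \<sigma> x = s"
      using dense_bipartite_side[where \<sigma> = \<sigma> and V = V and t = t
      and s = s, OF bip] \<open>t > 0\<close> Suc.prems by auto
    then show ?thesis
      by (intro exI[of _ s] exI[of _ X] exI[of _ "\<lambda>_. {}"])
      (use s in \<open>auto simp: disjoint_family_on_def\<close>)
  next
    case False
    have n: "a + b = Suc n" using Suc.hyps by simp
    have "4 * (2 * t * 4 ^ n) * card V \<le> card (E \<inter> V \<times> V)" using Suc.prems n by (simp add: mult_ac)
    moreover have "2 * t * 4 ^ n > 0" using \<open>t > 0\<close> by simp
    ultimately obtain V' s'
      where V': "V' \<subseteq> V" "V' \<noteq> {}" "2 * t * 4 ^ n * card V' \<le> card (E \<inter> V' \<times> V')"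
      and con: "connector E (2 * r) {x \<in> V'. \<sigma> x = s'} (V - V')"
      using dense_bipartite_step[where \<sigma> = \<sigma> and D = "2 * t * 4 ^ n", OF sym bip Suc.prems(1,2,3)]
      by auto
    define a' b' where "a' = (if s' then a - 1 else a)" and "b' = (if s' then b else b - 1)"
    have ab': "n = a' + b'" using n False by (auto simp: a'_def b'_def)
    have fin: "finite V'" "card V' \<le> 2 ^ r"
      using V' Suc.prems by (auto intro: finite_subset order_trans[OF card_mono])
    obtain s X Y where X: "X \<subseteq> V'" "card X = t" "\<forall>x\<in>X. \<sigma> x = s"
      and Y: "\<forall>i<(if s then a' else b'). Y i \<subseteq> V' - X \<and> connector E (2 * r) X (Y i)"
      and d: "disjoint_family_on Y {..<(if s then a' else b')}"
      using Suc.hyps(1)[OF ab' fin(1) V'(2) fin(2)] V'(3) ab' by blast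
    show ?thesis
    proof (cases "s = s'")
      case False
      then have eq: "(if s then a' else b') = (if s then a else b)" by (auto simp: a'_def b'_def)
      have "Y i \<subseteq> V - X \<and> connector E (2 * r) X (Y i)" if "i < (if s then a else b)" for i
        using Y[unfolded eq, rule_format, OF that] V'(1) by blast
      then show ?thesis using X d[unfolded eq] V'(1)
        by (intro exI[of _ s] exI[of _ X] exI[of _ Y]) blast
    next
      case True
      let ?m = "if s then a' else b'"
      have m: "(if s then a else b) = Suc ?m" using True \<open>\<not> (a = 0 \<or> b = 0)\<close>
        by (auto simp: a'_def b'_def)
      define Y' where "Y' = Y(?m := V - V')"
      have Y': "Y' i = Y i" if "i < ?m" for i using that by (simp add: Y'_def)
      have Ym: "Y' ?m = V - V'" by (simp add: Y'_def)
      have "X \<subseteq> {x \<in> V'. \<sigma> x = s'}" using X True by auto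
      then have "connector E (2 * r) X (V - V')" using con unfolding connector_def by blast
      have "Y' i \<subseteq> V - X \<and> connector E (2 * r) X (Y' i)" if "i < Suc ?m" for i
      proof (cases "i = ?m")
        case True
        show ?thesis unfolding True Ym using \<open>connector E (2 * r) X (V - V')\<close> X(1) by blast
      next
        case False
        then have "i < ?m" using that by linarith
        from Y[rule_format, OF this] Y'[OF this] V'(1) show ?thesis by auto
      qed
      moreover have "disjoint_family_on Y' {..<Suc ?m}"
        unfolding Y'_def lessThan_Suc using Y by (intro disjoint_family_on_upd d) auto
      ultimately show ?thesis using X V'(1) unfolding m
        by (intro exI[of _ s] exI[of _ X] exI[of _ Y']) (auto simp: m simp del: if_split)
    qed
  qed
qed

text \<open>Take \<open>t\<close> vertices of one colour with \<open>t\<^sup>2\<close> disjoint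
  connectors and give every pair \<open>i < j\<close> a connector of its own: it becomes part of
  branch set \<open>i\<close> and is adjacent to the vertex of \<open>j\<close>. The factor
  \<open>16 ^ t\<^sup>2\<close> is \<open>4 ^ (a + b)\<close> with both counts equal to
  \<open>t\<^sup>2\<close>. Connectors of logarithmic size \<open>2 * r\<close> are what keeps the
  greedy removal of such minors cheap.\<close>

lemma small_clique_minor:
  assumes sym: "sym E" and bip: "\<And>x y. (x, y) \<in> E \<Longrightarrow> \<sigma> x \<noteq> (\<sigma> y :: bool)" and "t > 0"
    and "finite V" "V \<noteq> {}" "card V \<le> 2 ^ r" "2 * t * 16 ^ t\<^sup>2 * card V \<le> card (E \<inter> V \<times> V)"
  obtains \<phi> W where "minor_model E W {..<t} UNIV \<phi>" "W \<subseteq> V" "card W \<le> t + 2 * r * t\<^sup>2"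
proof -
  have "(16::nat) ^ t\<^sup>2 = 4 ^ (t\<^sup>2 + t\<^sup>2)" by (simp add: power_add power_mult_distrib[symmetric])
  then obtain s X Y where X: "X \<subseteq> V" "card X = t"
    and Y: "\<forall>i<(if s then t\<^sup>2 else t\<^sup>2). Y i \<subseteq> V - X \<and> connector E (2 * r) X (Y i)"
    and d: "disjoint_family_on Y {..<(if s then t\<^sup>2 else t\<^sup>2)}"
    using dense_bipartite_connectors[where \<sigma> = \<sigma> and a = "t\<^sup>2"
    and b = "t\<^sup>2", OF sym bip assms(3-6)] assms(7) by auto
  have "finite X" using X assms(4) finite_subset by blast
  then obtain x where x: "bij_betw x {..<t} X" using X(2) ex_bij_betw_nat_finite
    by (metis atLeast0LessThan)
  have xX: "x i \<in> X" if "i < t" for i using x that by (auto simp: bij_betw_def)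
  have xinj: "x i \<noteq> x j" if "i < t" "j < t" "i \<noteq> j" for i j
    using x that by (auto simp: bij_betw_def inj_on_def)
  \<comment> \<open>Pairs are numbered in base \<open>t\<close>, so the codes stay below
    \<open>t\<^sup>2\<close> and determine the pair.\<close>
  define c where "c i j = i * t + j" for i j
  have c: "c i j < t\<^sup>2" if "i < t" "j < t" for i j
  proof -
    have "i * t + j < Suc i * t" using that by simp
    also have "\<dots> \<le> t * t" using that by (intro mult_le_mono1) simp
    finally show ?thesis by (simp add: c_def power2_eq_square)
  qed
  have cinj: "i = i' \<and> j = j'" if "c i j = c i' j'" "j < t" "j' < t" for i j i' j'
  proof -
    have "c a b div t = a \<and> c a b mod t = b" if b: "b < t" for a b
    proof -
      have "t \<noteq> 0" using b by simp
      show ?thesis unfolding c_def div_mult_self3[OF \<open>t \<noteq> 0\<close>] mod_mult_self3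
        using div_less[OF b] mod_less[OF b] by simp
    qed
    note dm = this[THEN conjunct1] this[THEN conjunct2]
    show ?thesis
      using dm(1)[OF that(2), of i] dm(1)[OF that(3), of
      i'] dm(2)[OF that(2), of i] dm(2)[OF that(3), of i']
      unfolding that(1) by blast
  qed
  have "\<exists>Z \<subseteq> Y (c i j). conn E Z \<and> card Z \<le> 2 * r \<and> (\<exists>z\<in>Z. (x i, z) \<in> E) \<and> (\<exists>z\<in>Z. (z, x j) \<in> E)"
    if "i < j" "j < t" for i j
  proof -
    have "connector E (2 * r) X (Y (c i j))" using Y c that by auto
    then show ?thesis unfolding connector_def using xX[of i] xX[of j] xinj[of i j] that by auto
  qed
  then obtain Z where Z: "\<And>i j. i < j \<Longrightarrow> j < t \<Longrightarrow> Z i j \<subseteq> Y (c i j) \<and> conn E (Z i j) \<and> card (Z i j) \<le>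
    2 * r \<and>
      (\<exists>z\<in>Z i j. (x i, z) \<in> E) \<and> (\<exists>z\<in>Z i j. (z, x j) \<in> E)" by metis
  have ZV: "Z i j \<subseteq> V - X" if "i < j" "j < t" for i j
    using Z[OF that] Y c[of i j] that by fastforce
  have Zd: "Z i j \<inter> Z i' j' = {}" if "i < j" "j < t" "i' < j'" "j' < t" "i \<noteq> i'" for i j i' j'
  proof -
    have "c i j \<noteq> c i' j'" using cinj that by blast
    then have "Y (c i j) \<inter> Y (c i' j') = {}"
      using d c[of i j] c[of i' j'] that unfolding disjoint_family_on_def by auto
    then show ?thesis using Z[of i j] Z[of i' j'] that by blast
  qed
  define \<phi> where "\<phi> i = {x i} \<union> (\<Union>j\<in>{i<..<t}. Z i j)" for i
  let ?W = "\<Union>(\<phi> ` {..<t})"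
  have half: "\<exists>a\<in>\<phi> i. \<exists>b\<in>\<phi> j. (a, b) \<in> E" if "i < j" "j < t" for i j
    using Z[OF that] that by (force simp: \<phi>_def)
  have "minor_model E ?W {..<t} UNIV \<phi>"
  proof (rule minor_modelI)
    fix i assume i: "i \<in> {..<t}"
    show "conn E (\<phi> i)" unfolding \<phi>_def
    proof (rule conn_UN_common[OF sym])
      fix j assume "j \<in> {i<..<t}"
      then have "i < j" "j < t" by auto
      from Z[OF this] show "conn E (Z i j)" "\<exists>a\<in>{x i}. \<exists>b\<in>Z i j. a = b \<or> (a, b) \<in> E" by blast+
    qed simp
    show "\<phi> i \<subseteq> ?W" using i by blast
    fix j assume j: "j \<in> {..<t}" "i \<noteq> j"
    have notin: "x l \<notin> Z m k" if "m \<in> {i, j}" "l \<in> {i, j}" "k \<in> {m<..<t}" for l m k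
      using ZV[of m k] xX[of l] that i j by auto
    have "Z i k \<inter> Z j k' = {}" if "k \<in> {i<..<t}" "k' \<in> {j<..<t}" for k k'
      using Zd[of i k j k'] that j by auto
    then have "(\<Union>k\<in>{i<..<t}. Z i k) \<inter> (\<Union>k\<in>{j<..<t}. Z j k) = {}" by blast
    moreover have "x i \<notin> (\<Union>k\<in>{j<..<t}. Z j k)" "x j \<notin> (\<Union>k\<in>{i<..<t}. Z i k)"
      using notin by auto
    ultimately show "\<phi> i \<inter> \<phi> j = {}" using xinj[of i j] i j unfolding \<phi>_def by blast
    show "\<exists>x\<in>\<phi> i. \<exists>y\<in>\<phi> j. (x, y) \<in> E"
    proof (cases "i < j")
      case True then show ?thesis using half i j by auto
    next
      case False
      then obtain a b where "a \<in> \<phi> j" "b \<in> \<phi> i" "(a, b) \<in> E" using half[of j i] i j by auto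
      then show ?thesis using sym by (blast dest: symD)
    qed
  qed
  moreover have "\<phi> i \<subseteq> V" if "i < t" for i
  proof -
    have "Z i j \<subseteq> V" if "j \<in> {i<..<t}" for j using ZV[of i j] that by auto
    then show ?thesis using xX[OF that] X(1) unfolding \<phi>_def by blast
  qed
  then have "?W \<subseteq> V" by auto
  moreover have "card ?W \<le> t + 2 * r * t\<^sup>2"
  proof -
    have "card (\<phi> i) \<le> 1 + t * (2 * r)" for i
    proof -
      have "card (\<phi> i) \<le> card {x i} + card (\<Union>j\<in>{i<..<t}. Z i j)" unfolding \<phi>_def
        by (rule card_Un_le)
      also have "card (\<Union>j\<in>{i<..<t}. Z i j) \<le> (\<Sum>j\<in>{i<..<t}. card (Z i j))" by (rule card_UN_le) simp
      also have "\<dots> \<le> (\<Sum>j\<in>{i<..<t}. 2 * r)" by (rule sum_mono) (use Z in auto)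
      also have "\<dots> \<le> t * (2 * r)" by simp
      finally show ?thesis by simp
    qed
    then have "(\<Sum>i<t. card (\<phi> i)) \<le> (\<Sum>i<t. 1 + t * (2 * r))" by (intro sum_mono)
    moreover have "card ?W \<le> (\<Sum>i<t. card (\<phi> i))" by (rule card_UN_le) simp
    ultimately show ?thesis by (simp add: power2_eq_square algebra_simps)
  qed
  ultimately show ?thesis by (rule that)
qed

section \<open>Packings in ladders\<close>

lemma minor_of_clique:
  assumes "minor_model E W {..<h} UNIV \<phi>" "finite U" "card U \<le> h"
  shows "minor E W U F"
proof -
  obtain g where g: "bij_betw g U {..<card U}"
    using ex_bij_betw_finite_nat[OF assms(2)] by (auto simp: atLeast0LessThan)
  have lt: "g u < h" if "u \<in> U" for u
  proof -
    have "g u \<in> {..<card U}" using bij_betwE[OF g] that by blast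
    then show ?thesis using assms(3) by simp
  qed
  have inj: "g u \<noteq> g v" if "u \<in> U" "v \<in> U" "u \<noteq> v" for u v
    using g that by (auto simp: bij_betw_def inj_on_def)
  have "minor_model E W U F (\<lambda>u. \<phi> (g u))"
    by (rule minor_modelI) (use minor_modelD[OF assms(1)] lt inj in auto)
  then show ?thesis by (auto simp: minor_def)
qed

text \<open>The rung vertices \<open>(1, i)\<close> go with the first rail, so the second half of a
  rung is what joins a block of one rail to a block of the other.\<close>

definition block :: "nat \<Rightarrow> nat \<times> nat \<Rightarrow> (nat \<times> nat) set" where
  "block b u = (if fst u = 0 then {0, 1} else {2}) \<times> {snd u * b..<Suc (snd u) * b}"

definition block_arcs :: "nat \<Rightarrow> nat \<Rightarrow> (nat \<Rightarrow> nat) \<Rightarrow> ((nat \<times> nat) \<times> (nat \<times> nat)) set" where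
  "block_arcs b N \<pi> = {((0, i div b), (2, \<pi> i div b)) |i. i < N} \<union>
    {((2, \<pi> i div b), (0, i div b)) |i. i < N}"

lemma block_index: "b > 0 \<Longrightarrow> i \<in> {a * b..<Suc a * b} \<longleftrightarrow> i div b = (a :: nat)"
  by (simp add: div_nat_eqI dividend_less_times_div mult.commute)
     (metis div_nat_eqI dividend_less_times_div mult.commute
       mult_Suc_right times_div_less_eq_dividend)

lemma block_minor_model:
  assumes "b > 0"
  shows "minor_model (ladder \<pi>) (cells (b * M)) ({0, 2} \<times> {..<M}) (block_arcs b (b * M) \<pi>) (block b)"
proof (rule minor_modelI)
  fix u :: "nat \<times> nat" assume u: "u \<in> {0, 2} \<times> {..<M}"
  have lt: "i < b * M" if "i < Suc (snd u) * b" for i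
  proof -
    have "Suc (snd u) * b \<le> M * b" using u by (intro mult_le_mono1) auto
    then show ?thesis using that by (simp add: mult.commute)
  qed
  show "block b u \<subseteq> cells (b * M)" using lt by (auto simp: block_def)
  let ?a = "snd u * b" and ?b = "Suc (snd u) * b - 1"
  have le: "?a \<le> ?b" and I: "{snd u * b..<Suc (snd u) * b} = {?a..?b}" using assms by auto
  show "conn (ladder \<pi>) (block b u)"
  proof (cases "fst u = 0")
    case True
    have "conn (ladder \<pi>) ({0} \<times> {?a..?b} \<union> (\<Union>i\<in>{?a..?b}. {(1, i)}))"
    proof (rule conn_UN_common[OF sym_ladder])
      show "conn (ladder \<pi>) ({0} \<times> {?a..?b})" by (rule conn_rail[OF le]) simp
      fix i assume "i \<in> {?a..?b}"
      then show "\<exists>x\<in>{0} \<times> {?a..?b}. \<exists>y\<in>{(1, i)}. x = y \<or> (x, y) \<in> ladder \<pi>"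
        by (intro bexI[of _ "(0, i)"] bexI[of _ "(1, i)"] disjI2 ladderI) auto
    qed simp
    moreover have "{0::nat} \<times> {?a..?b} \<union> (\<Union>i\<in>{?a..?b}. {(1, i)}) = {0, 1} \<times> {?a..?b}" by auto
    ultimately show ?thesis unfolding block_def I if_P[OF True] by (simp only:)
  next
    case False
    then show ?thesis unfolding block_def I using conn_rail[OF le, of 2 \<pi>] by simp
  qed
  fix v :: "nat \<times> nat" assume v: "v \<in> {0, 2} \<times> {..<M}" "u \<noteq> v"
  show "block b u \<inter> block b v = {}"
  proof (cases "fst u = fst v")
    case True
    then have "snd u \<noteq> snd v" using v(2) by (auto simp: prod_eq_iff)
    then have "{snd u * b..<Suc (snd u) * b} \<inter> {snd v * b..<Suc (snd v) * b} = {}"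
      using block_index[OF assms, of _ "snd u"] block_index[OF assms, of _ "snd v"]
      by (metis disjoint_iff)
    then show ?thesis unfolding block_def by blast
  next
    case False
    then show ?thesis using u v by (auto simp: block_def)
  qed
  assume "(u, v) \<in> block_arcs b (b * M) \<pi>"
  then obtain i where "u = (0, i div b) \<and> v = (2, \<pi> i div b) \<or> u = (2, \<pi> i div b) \<and>
    v = (0, i div b)"
    by (auto simp: block_arcs_def)
  moreover have "(1, i) \<in> block b (0, i div b)" "(2, \<pi> i) \<in> block b (2, \<pi> i div b)"
    unfolding block_def using block_index[OF assms] by auto
  ultimately show "\<exists>x\<in>block b u. \<exists>y\<in>block b v. (x, y) \<in> ladder \<pi>"
    using ladderI(4)[of i \<pi>] ladderI(8)[where i = i and \<pi> = \<pi>] by blast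
qed

text \<open>Origin of \<open>b\<close>: at least half of the \<open>b * M\<close> rungs survive the
  removal of up to \<open>M / 2\<close> blocks. If fewer than \<open>h\<^sup>2\<close> of them share
  a pair of blocks, at least \<open>b * M / (2 * h\<^sup>2)\<close> arcs remain between at most
  \<open>2 * M\<close> blocks, and this has to reach the density
  \<open>2 * h * 16 ^ h\<^sup>2\<close> that forces a clique minor. In \<open>R\<close>, the 2 pays
  for a model inside two blocks and the rest for a clique minor.\<close>

lemma ladder_packs:
  assumes lad: "minor (ladder id) (cells h) U F" and U: "finite U" "card U \<le> h" and "h > 0"
    and b: "b = 8 * h ^ 3 * 16 ^ h\<^sup>2" and R: "R = 2 + h + 2 * r * h\<^sup>2"
    and M: "2 * k * R \<le> M" "2 * M \<le> 2 ^ r"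
    and inj: "inj_on \<pi> {..<b * M}" and im: "\<pi> ` {..<b * M} \<subseteq> {..<b * M}"
  shows "packs (ladder \<pi>) (cells (b * M)) k U F"
proof -
  have "b > 0" using b \<open>h > 0\<close> by simp
  let ?V = "{0, 2} \<times> {..<M} :: (nat \<times> nat) set"
  let ?N = "b * M"
  let ?G = "block_arcs b ?N \<pi>"
  note bm = block_minor_model[OF \<open>b > 0\<close>, of \<pi> M]
  have symG: "sym ?G" by (auto simp: block_arcs_def sym_def)
  have bip: "(fst x = 0) \<noteq> (fst y = (0::nat))" if "(x, y) \<in> ?G" for x y
    using that by (auto simp: block_arcs_def)
  have cardV: "card ?V = 2 * M" by (simp add: card_cartesian_product)
  have step: "\<exists>X \<subseteq> ?V - Y. card X \<le> R \<and> minor (ladder \<pi>) (\<Union>(block b ` X)) U F"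
    if Y: "Y \<subseteq> ?V" "2 * card Y \<le> M" and "M > 0" for Y
  proof -
    let ?W = "?V - Y"
    have finY: "finite Y" using Y finite_subset by blast
    have finW: "finite ?W" by simp
    have cW: "card ?W = 2 * M - card Y" using finY Y cardV by (simp add: card_Diff_subset)
    then have "card ?W > 0" using Y(2) \<open>M > 0\<close> by linarith
    then have W: "?W \<noteq> {}" by force
    \<comment> \<open>\<open>I\<close> collects the rungs between surviving blocks and
      \<open>K y\<close> those lost with block \<open>y\<close>. A block has \<open>b\<close>
      columns and \<open>\<pi>\<close> is injective, so a removed block costs at most
      \<open>b\<close> rungs.\<close>
    define I where "I = {i \<in> {..<?N}. (0, i div b) \<in> ?W \<and> (2, \<pi> i div b) \<in> ?W}"
    define K where "K y = {i \<in> {..<?N}. if fst y = 0 then i div b = snd y else \<pi> i div b = snd y}"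
      for y :: "nat \<times> nat"
    have K: "card (K y) \<le> b" for y
    proof -
      have c: "card {snd y * b..<Suc (snd y) * b} = b" by simp
      show ?thesis
      proof (cases "fst y = 0")
        case True
        then have "K y \<subseteq> {snd y * b..<Suc (snd y) * b}" using block_index[OF \<open>b > 0\<close>]
          by (auto simp: K_def)
        then show ?thesis using c by (metis card_mono finite_atLeastLessThan)
      next
        case False
        then have "\<pi> ` K y \<subseteq> {snd y * b..<Suc (snd y) * b}" using block_index[OF \<open>b > 0\<close>]
          by (auto simp: K_def)
        moreover have "inj_on \<pi> (K y)" using inj by (rule inj_on_subset) (auto simp: K_def)
        ultimately show ?thesis using c by (metis card_inj_on_le finite_atLeastLessThan)
      qed
    qed
    have "{..<?N} \<subseteq> I \<union> (\<Union>y\<in>Y. K y)"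
    proof
      fix i assume i: "i \<in> {..<?N}"
      then have "\<pi> i < ?N" using im by blast
      then have "i div b < M" "\<pi> i div b < M"
        using i \<open>b > 0\<close> by (auto simp: div_less_iff_less_mult mult.commute)
      then show "i \<in> I \<union> (\<Union>y\<in>Y. K y)" using i by (force simp: I_def K_def)
    qed
    then have "card {..<?N} \<le> card (I \<union> (\<Union>y\<in>Y. K y))"
      using finY by (intro card_mono) (auto simp: I_def K_def)
    also have "\<dots> \<le> card I + card (\<Union>y\<in>Y. K y)" by (rule card_Un_le)
    also have "card (\<Union>y\<in>Y. K y) \<le> (\<Sum>y\<in>Y. card (K y))" by (rule card_UN_le[OF finY])
    also have "\<dots> \<le> (\<Sum>y\<in>Y. b)" by (rule sum_mono) (rule K)
    finally have "b * M \<le> card I + card Y * b" by simp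
    moreover have "b * (2 * card Y) \<le> b * M" using Y(2) by (rule mult_le_mono2)
    moreover have "b * (2 * card Y) = 2 * (card Y * b)" by simp
    ultimately have cI: "b * M \<le> 2 * card I" by linarith
    define f where "f i = ((0::nat, i div b), (2::nat, \<pi> i div b))" for i
    have finI: "finite I" by (simp add: I_def)
    have fI: "f ` I \<subseteq> ?G \<inter> ?W \<times> ?W" by (auto simp: f_def I_def block_arcs_def)
    show ?thesis
    proof (cases "\<exists>e\<in>f ` I. h\<^sup>2 \<le> card {i \<in> I. f i = e}")
      case True
      then obtain j where j: "j \<in> I" and S: "h\<^sup>2 \<le> card {i \<in> I. f i = f j}" by blast
      let ?S = "{i \<in> I. f i = f j}" and ?a = "j div b" and ?c = "\<pi> j div b"
      have "minor (ladder \<pi>) ({0, 1} \<times> {?a * b..<Suc ?a * b} \<union>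
        {2} \<times> {?c * b..<Suc ?c * b}) (cells h) (ladder id)"
      proof (rule parallel_rungs_minor[OF _ _ S])
        show "finite ?S" using finI by simp
        show "inj_on \<pi> ?S" using inj by (rule inj_on_subset) (auto simp: I_def)
        show "?S \<subseteq> {?a * b..<Suc ?a * b}" using block_index[OF \<open>b > 0\<close>] by (auto simp: f_def)
        show "\<pi> ` ?S \<subseteq> {?c * b..<Suc ?c * b}" using block_index[OF \<open>b > 0\<close>] by (auto simp: f_def)
      qed
      then obtain \<chi> where \<chi>: "minor_model (ladder \<pi>)
          ({0, 1} \<times> {?a * b..<Suc ?a * b} \<union> {2} \<times> {?c * b..<Suc ?c * b}) (cells h) (ladder id) \<chi>"
        by (auto simp: minor_def)
      have "minor (ladder \<pi>) (\<Union>(\<chi> ` cells h)) U F"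
        by (rule minor_trans[OF sym_ladder \<chi> lad order_refl])
      moreover have "\<Union>(\<chi> ` cells h) \<subseteq> {0, 1} \<times> {?a * b..<Suc ?a * b} \<union> {2} \<times> {?c * b..<Suc ?c * b}"
        using minor_modelD(2)[OF \<chi>] by blast
      moreover have "{0, 1} \<times> {?a * b..<Suc ?a * b} \<union> {2} \<times> {?c * b..<Suc ?c * b} = \<Union>(block b ` {(0, ?a), (2, ?c)})"
        by (simp add: block_def)
      ultimately have "minor (ladder \<pi>) (\<Union>(block b ` {(0, ?a), (2, ?c)})) U F"
        using minor_mono by metis
      moreover have "card {(0::nat, ?a), (2, ?c)} \<le> R" using R by simp
      moreover have "{(0, ?a), (2, ?c)} \<subseteq> ?W" using j by (simp add: I_def)
      ultimately show ?thesis by blast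
    next
      case False
      have "card I = (\<Sum>e\<in>f ` I. card {i \<in> I. f i = e})"
        using sum.image_gen[OF finI, of "\<lambda>_. 1::nat" f] by simp
      also have "\<dots> \<le> (\<Sum>e\<in>f ` I. h\<^sup>2)"
        by (rule sum_mono) (use False in \<open>auto simp: not_le intro: less_imp_le\<close>)
      finally have "card I \<le> h\<^sup>2 * card (f ` I)" by (simp add: mult.commute)
      also have "card (f ` I) \<le> card (?G \<inter> ?W \<times> ?W)" by (rule card_mono[OF _ fI]) simp
      finally have "card I \<le> h\<^sup>2 * card (?G \<inter> ?W \<times> ?W)" by simp
      then have "b * M \<le> 2 * (h\<^sup>2 * card (?G \<inter> ?W \<times> ?W))" using cI by linarith
      moreover have "b * M = 2 * (h\<^sup>2 * (4 * h * 16 ^ h\<^sup>2 * M))"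
        unfolding b by (simp add: power2_eq_square power3_eq_cube)
      ultimately have "2 * (h\<^sup>2 * (4 * h * 16 ^ h\<^sup>2 * M)) \<le> 2 * (h\<^sup>2 * card (?G \<inter> ?W \<times> ?W))"
        by (simp only:)
      then have le: "4 * h * 16 ^ h\<^sup>2 * M \<le> card (?G \<inter> ?W \<times> ?W)" using \<open>h > 0\<close>
        by (simp add: mult_ac)
      have "2 * h * 16 ^ h\<^sup>2 * card ?W \<le> 2 * h * 16 ^ h\<^sup>2 * (2 * M)"
        unfolding cW by (intro mult_le_mono2) simp
      also have "\<dots> = 4 * h * 16 ^ h\<^sup>2 * M" by simp
      finally have dense: "2 * h * 16 ^ h\<^sup>2 * card ?W \<le> card (?G \<inter> ?W \<times> ?W)" using le
        by (rule order_trans)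
      have small: "card ?W \<le> 2 ^ r" using cW M(2) by simp
      obtain \<phi> X where X: "minor_model ?G X {..<h} UNIV \<phi>" "X \<subseteq> ?W" "card X \<le> h + 2 * r * h\<^sup>2"
        by (rule small_clique_minor[where \<sigma> = "\<lambda>x. fst x = 0",
        OF symG bip \<open>h > 0\<close> finW W small dense])
      have "minor ?G X U F" by (rule minor_of_clique[OF X(1) U])
      moreover have "X \<subseteq> ?V" using X(2) by blast
      ultimately have "minor (ladder \<pi>) (\<Union>(block b ` X)) U F"
        by (rule minor_trans[OF sym_ladder bm])
      moreover have "card X \<le> R" using X(3) R by simp
      ultimately show ?thesis using X(2) by blast
    qed
  qed
  have greedy: "\<exists>X. (\<forall>i<j. X i \<subseteq> ?V \<and> card (X i) \<le> R \<and> minor (ladder \<pi>) (\<Union>(block b ` X i)) U F) \<and>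
      disjoint_family_on X {..<j}" if "j \<le> k" for j
    using that
  proof (induction j)
    case (Suc j)
    then obtain X where X: "\<And>i. i < j \<Longrightarrow> X i \<subseteq> ?V" "\<And>i. i < j \<Longrightarrow> card (X i) \<le> R"
        "\<And>i. i < j \<Longrightarrow> minor (ladder \<pi>) (\<Union>(block b ` X i)) U F"
      and d: "disjoint_family_on X {..<j}" by auto
    let ?Y = "\<Union>i<j. X i"
    have "card ?Y \<le> (\<Sum>i<j. card (X i))" by (rule card_UN_le) simp
    also have "\<dots> \<le> (\<Sum>i<j. R)" by (rule sum_mono) (use X in auto)
    finally have "card ?Y \<le> j * R" by simp
    moreover have "Suc j * R \<le> k * R" using Suc.prems by (rule mult_le_mono1)
    ultimately have "2 * card ?Y \<le> M" "M > 0" using M(1) R by auto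
    moreover have "?Y \<subseteq> ?V" using X(1) by (intro UN_least) auto
    ultimately have "\<exists>Z \<subseteq> ?V - ?Y. card Z \<le> R \<and> minor (ladder \<pi>) (\<Union>(block b ` Z)) U F"
      by (intro step)
    then obtain Z where Z: "Z \<subseteq> ?V - ?Y" "card Z \<le> R" "minor (ladder \<pi>) (\<Union>(block b ` Z)) U F"
      by (elim exE conjE) (rule that)
    let ?X = "X(j := Z)"
    have "?X i \<subseteq> ?V \<and> card (?X i) \<le> R \<and> minor (ladder \<pi>) (\<Union>(block b ` ?X i)) U F" if "i < Suc j"
      for i
      using X[of i] Z that by (cases "i = j") auto
    moreover have "disjoint_family_on ?X {..<Suc j}"
      unfolding lessThan_Suc using Z(1) by (intro disjoint_family_on_upd d) auto
    ultimately show ?case by blast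
  qed (auto simp: disjoint_family_on_def)
  then obtain X where X: "\<And>i. i < k \<Longrightarrow> X i \<subseteq> ?V"
      "\<And>i. i < k \<Longrightarrow> minor (ladder \<pi>) (\<Union>(block b ` X i)) U F"
    and d: "disjoint_family_on X {..<k}" by (metis (no_types, lifting) order_refl)
  show ?thesis by (rule packs_of_parts[OF bm X(1) d X(2)])
qed

section \<open>Menger's theorem\<close>

text \<open>Walks of a single vertex count, so a separator contains \<open>A \<inter> B\<close>; it
  may also use other vertices of \<open>A\<close> and \<open>B\<close>.\<close>

definition separates :: "('a \<times> 'a) set \<Rightarrow> 'a set \<Rightarrow> 'a set \<Rightarrow> 'a set \<Rightarrow> bool" where
  "separates E A B S \<longleftrightarrow> (\<forall>xs. walk E xs \<and> hd xs \<in> A \<and> last xs \<in> B \<longrightarrow> set xs \<inter> S \<noteq> {})"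

lemma walk_first_hit:
  assumes "walk E xs" "set xs \<inter> T \<noteq> {}"
  obtains ys where "walk E ys" "hd ys = hd xs" "last ys \<in> T" "set (butlast ys) \<inter> T = {}" "set ys \<subseteq>
    set xs"
    "distinct xs \<Longrightarrow> distinct ys" "set (tl ys) \<subseteq> set (tl xs)"
proof -
  have "\<exists>x\<in>set xs. x \<in> T" using assms(2) by blast
  from split_list_first_prop[OF this] obtain us x vs where
    xs: "xs = us @ x # vs" "x \<in> T" "\<forall>y\<in>set us. y \<notin> T" by blast
  show ?thesis
  proof (rule that[of "us @ [x]"])
    have "xs = (us @ [x]) @ vs" using xs by simp
    then show "walk E (us @ [x])" using assms(1) walk_appendD1 by blast
    show "set (tl (us @ [x])) \<subseteq> set (tl xs)" using xs by (cases us) auto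
  qed (use xs in \<open>auto simp: hd_append\<close>)
qed

lemma walk_last_hit:
  assumes "walk E xs" "set xs \<inter> T \<noteq> {}"
  obtains ys where "walk E ys" "last ys = last xs" "hd ys \<in> T" "set (tl ys) \<inter> T = {}" "set ys \<subseteq>
    set xs"
proof -
  have "\<exists>x\<in>set xs. x \<in> T" using assms(2) by blast
  from split_list_last_prop[OF this] obtain us x vs where
    xs: "xs = us @ x # vs" "x \<in> T" "\<forall>y\<in>set vs. y \<notin> T" by blast
  show ?thesis
    by (rule that[of "x # vs"]) (use xs assms(1) in \<open>auto dest: walk_appendD2\<close>)
qed

text \<open>An arc of a walk has its tail in \<open>butlast\<close> and its head in
  \<open>tl\<close>, so either alternative rules out \<open>(x, y)\<close>.\<close>

lemma walk_remove_arc: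
  assumes "walk (insert (x, y) F) xs" "x \<notin> set (butlast xs) \<or> y \<notin> set (tl xs)"
  shows "walk F xs"
  using assms
proof (induction xs)
  case (Cons u xs)
  show ?case
  proof (cases xs)
    case (Cons v ys)
    have w: "walk (insert (x, y) F) xs" "(u, v) \<in> insert (x, y) F"
      using Cons.prems(1) Cons by (auto simp: walk_def)
    have "x \<notin> set (butlast xs) \<or> y \<notin> set (tl xs)" using Cons.prems(2) Cons by auto
    then have "walk F xs" using Cons.IH w by blast
    moreover have "(u, v) \<in> F" using w(2) Cons.prems(2) Cons by auto
    ultimately show ?thesis using Cons by (simp add: walk_def)
  qed (simp add: walk_def)
qed (simp add: walk_def)

lemma walk_join:
  assumes "walk E (us @ [z])" "walk E (z # ws)"
  shows "walk E (us @ z # ws)"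
  using assms by (auto simp: walk_def successively_append_iff successively_Cons)

lemma bij_of_choices:
  assumes "finite T" "card T = k" "\<And>i. i < k \<Longrightarrow> g i \<in> T \<inter> X i" "disjoint_family_on X {..<k}"
  shows "bij_betw g {..<k} T"
proof -
  have "inj_on g {..<k}"
  proof (rule inj_onI, rule ccontr)
    fix i j assume ij: "i \<in> {..<k}" "j \<in> {..<k}" "g i = g j" "i \<noteq> j"
    then have "X i \<inter> X j = {}" using assms(4) by (auto simp: disjoint_family_on_def)
    then show False using assms(3)[of i] assms(3)[of j] ij by auto
  qed
  moreover have "g ` {..<k} \<subseteq> T" using assms(3) by auto
  ultimately show ?thesis using assms(1,2)
    by (metis bij_betw_def card_image card_lessThan card_subset_eq)
qed

text \<open>Induction on the arcs. If without \<open>(x, y)\<close> there is a separator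
  \<open>S\<close> of fewer than \<open>k\<close> vertices, then \<open>insert x S\<close> and
  \<open>insert y S\<close> separate with the arc present and have exactly \<open>k\<close>
  vertices. Separators of \<open>A\<close> from \<open>insert x S\<close>, or of
  \<open>insert y S\<close> from \<open>B\<close>, still separate \<open>A\<close> from
  \<open>B\<close>, so the induction hypothesis gives \<open>k\<close> paths on either side; these
  are joined at the vertices of \<open>S\<close> and across the arc.\<close>

theorem menger:
  assumes "finite E" "finite A"
    and "\<And>S. finite S \<Longrightarrow> separates E A B S \<Longrightarrow> k \<le> card S"
  shows "\<exists>p. (\<forall>i<k. walk E (p i) \<and> hd (p i) \<in> A \<and> last (p i) \<in> B) \<and>
           disjoint_family_on (\<lambda>i. set (p i)) {..<k}"
  using assms
proof (induction E arbitrary: A B rule: finite_induct)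
  case empty
  have "separates {} A B (A \<inter> B)"
    unfolding separates_def
  proof (intro allI impI)
    fix xs assume xs: "walk {} xs \<and> hd xs \<in> A \<and> last xs \<in> B"
    then obtain x where "xs = [x]"
      by (cases xs; cases "tl xs") (auto simp: walk_def successively_Cons)
    then show "set xs \<inter> (A \<inter> B) \<noteq> {}" using xs by simp
  qed
  then have "k \<le> card (A \<inter> B)" using empty by simp
  then obtain X where X: "X \<subseteq> A \<inter> B" "card X = k" "finite X" by (meson obtain_subset_with_card_n)
  then obtain g where "bij_betw g {..<k} X" using ex_bij_betw_nat_finite by (metis atLeast0LessThan)
  then show ?case using X
    by (intro exI[of _ "\<lambda>i. [g i]"]) (fastforce simp: walk_def
    bij_betw_def inj_on_def disjoint_family_on_def)
next
  case (insert e F)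
  obtain x y where e: "e = (x, y)" by (cases e)
  let ?E = "insert (x, y) F"
  show ?case
  proof (cases "\<forall>S. finite S \<longrightarrow> separates F A B S \<longrightarrow> k \<le> card S")
    case True
    then obtain p where "\<forall>i<k. walk F (p i) \<and> hd (p i) \<in> A \<and> last (p i) \<in> B"
        "disjoint_family_on (\<lambda>i. set (p i)) {..<k}"
      using insert.IH[OF insert.prems(1), of B] by blast
    then show ?thesis unfolding e using walk_mono[of F _ ?E] by blast
  next
    case False
    then obtain S where S: "finite S" "separates F A B S" "card S < k" by (auto simp: not_le)
    have sepx: "set xs \<inter> insert x S \<noteq> {}" and sepy: "set xs \<inter> insert y S \<noteq> {}"
      if "walk ?E xs" "hd xs \<in> A" "last xs \<in> B" for xs
    proof -
      have "set xs \<inter> S \<noteq> {}" if "x \<notin> set (butlast xs) \<or> y \<notin> set (tl xs)"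
        using walk_remove_arc[OF \<open>walk ?E xs\<close> that] S(2) \<open>hd xs \<in> A\<close> \<open>last xs \<in> B\<close>
        unfolding separates_def by blast
      then show "set xs \<inter> insert x S \<noteq> {}" "set xs \<inter> insert y S \<noteq> {}"
        using list.set_sel(2)[of xs y] that(1) by (auto simp: walk_def dest: in_set_butlastD)
    qed
    have "k \<le> card (insert x S)" "k \<le> card (insert y S)"
      using sepx sepy insert.prems(2)[of "insert x S"] insert.prems(2)[of "insert y S"] S(1)
      unfolding e separates_def by blast+
    then have xS: "x \<notin> S" "card (insert x S) = k" and yS: "y \<notin> S" "card (insert y S) = k"
      using S(1,3) by (auto simp: card_insert_if split: if_splits)
    \<comment> \<open>Up to its first vertex in \<open>insert x S\<close> a walk never leaves
      \<open>x\<close>, so this part of it avoids the arc \<open>(x, y)\<close>. The other side is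
      symmetric, with the last vertex in \<open>insert y S\<close>.\<close>
    have "k \<le> card X" if "finite X" "separates F A (insert x S) X" for X
    proof (rule insert.prems(2)[OF that(1)])
      show "separates (insert e F) A B X" unfolding e separates_def
      proof (intro allI impI)
        fix xs assume xs: "walk ?E xs \<and> hd xs \<in> A \<and> last xs \<in> B"
        then obtain ys where ys: "walk ?E ys" "hd ys = hd xs" "last ys \<in> insert x S"
            "set (butlast ys) \<inter> insert x S = {}" "set ys \<subseteq> set xs"
          using walk_first_hit[of ?E xs "insert x S"] sepx by metis
        have "walk F ys" by (rule walk_remove_arc[OF ys(1)]) (use ys(4) in blast)
        then have "walk F ys \<and> hd ys \<in> A \<and> last ys \<in> insert x S" using ys(2,3) xs by simp
        then have "set ys \<inter> X \<noteq> {}" using that(2) unfolding separates_def by blast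
        then show "set xs \<inter> X \<noteq> {}" using ys(5) by blast
      qed
    qed
    then obtain p0 where p0: "\<And>i. i < k \<Longrightarrow> walk F (p0 i)" "\<And>i. i < k \<Longrightarrow> hd (p0 i) \<in> A"
        "\<And>i. i < k \<Longrightarrow> last (p0 i) \<in> insert x S" "disjoint_family_on (\<lambda>i. set (p0 i)) {..<k}"
      using insert.IH[OF insert.prems(1), of "insert x S"] by metis
    have "k \<le> card X" if "finite X" "separates F (insert y S) B X" for X
    proof (rule insert.prems(2)[OF that(1)])
      show "separates (insert e F) A B X" unfolding e separates_def
      proof (intro allI impI)
        fix xs assume xs: "walk ?E xs \<and> hd xs \<in> A \<and> last xs \<in> B"
        then obtain ys where ys: "walk ?E ys" "last ys = last xs" "hd ys \<in> insert y S"
            "set (tl ys) \<inter> insert y S = {}" "set ys \<subseteq> set xs"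
          using walk_last_hit[of ?E xs "insert y S"] sepy by metis
        have "walk F ys" by (rule walk_remove_arc[OF ys(1)]) (use ys(4) in blast)
        then have "walk F ys \<and> hd ys \<in> insert y S \<and> last ys \<in> B" using ys(2,3) xs by simp
        then have "set ys \<inter> X \<noteq> {}" using that(2) unfolding separates_def by blast
        then show "set xs \<inter> X \<noteq> {}" using ys(5) by blast
      qed
    qed
    then obtain q0 where q0: "\<And>i. i < k \<Longrightarrow> walk F (q0 i)" "\<And>i. i < k \<Longrightarrow> hd (q0 i) \<in> insert y S"
        "\<And>i. i < k \<Longrightarrow> last (q0 i) \<in> B" "disjoint_family_on (\<lambda>i. set (q0 i)) {..<k}"
      using insert.IH[of "insert y S" B] S(1) by (metis finite_insert)
    have "\<exists>ys. walk F ys \<and> hd ys \<in> A \<and> last ys \<in> insert x S \<and> set (butlast ys) \<inter> insert x S = {} \<and>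
        set ys \<subseteq> set (p0 i)" if "i < k" for i
    proof -
      have "p0 i \<noteq> []" using p0(1)[OF that] by (simp add: walk_def)
      then have "set (p0 i) \<inter> insert x S \<noteq> {}" using p0(3)[OF that] last_in_set by blast
      from walk_first_hit[OF p0(1)[OF that] this] show ?thesis using p0(2)[OF that] by metis
    qed
    then obtain p where p: "\<And>i. i < k \<Longrightarrow> walk F (p i) \<and> hd (p i) \<in> A \<and> last (p i) \<in> insert x S \<and>
        set (butlast (p i)) \<inter> insert x S = {} \<and> set (p i) \<subseteq> set (p0 i)" by metis
    have "\<exists>ys. walk F ys \<and> last ys \<in> B \<and> hd ys \<in> insert y S \<and> set (tl ys) \<inter> insert y S = {} \<and>
        set ys \<subseteq> set (q0 i)" if "i < k" for i
    proof -
      have "q0 i \<noteq> []" using q0(1)[OF that] by (simp add: walk_def)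
      then have "set (q0 i) \<inter> insert y S \<noteq> {}" using q0(2)[OF that] hd_in_set by blast
      from walk_last_hit[OF q0(1)[OF that] this] show ?thesis using q0(3)[OF that] by metis
    qed
    then obtain q where q: "\<And>i. i < k \<Longrightarrow> walk F (q i) \<and> last (q i) \<in> B \<and> hd (q i) \<in> insert y S \<and>
        set (tl (q i)) \<inter> insert y S = {} \<and> set (q i) \<subseteq> set (q0 i)" by metis
    have pne: "p i \<noteq> []" and qne: "q i \<noteq> []" if "i < k" for i
      using p[OF that] q[OF that] by (auto simp: walk_def)
    have pd: "set (p i) \<inter> set (p j) = {}" if "i < k" "j < k" "i \<noteq> j" for i j
    proof -
      have "set (p0 i) \<inter> set (p0 j) = {}" using p0(4) that by (simp add: disjoint_family_on_def)
      then show ?thesis using p[of i] p[of j] that by blast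
    qed
    have qd: "set (q i) \<inter> set (q j) = {}" if "i < k" "j < k" "i \<noteq> j" for i j
    proof -
      have "set (q0 i) \<inter> set (q0 j) = {}" using q0(4) that by (simp add: disjoint_family_on_def)
      then show ?thesis using q[of i] q[of j] that by blast
    qed
    have "bij_betw (\<lambda>i. last (p i)) {..<k} (insert x S)"
    proof (rule bij_of_choices[where X = "\<lambda>i. set (p i)"])
      show "last (p i) \<in> insert x S \<inter> set (p i)" if "i < k" for i
        using p[OF that] last_in_set[OF pne[OF that]] by blast
    qed (use S(1) xS pd in \<open>auto simp: disjoint_family_on_def\<close>)
    note pb = this
    have qb: "bij_betw (\<lambda>i. hd (q i)) {..<k} (insert y S)"
    proof (rule bij_of_choices[where X = "\<lambda>i. set (q i)"])
      show "hd (q i) \<in> insert y S \<inter> set (q i)" if "i < k" for i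
        using q[OF that] hd_in_set[OF qne[OF that]] by blast
    qed (use S(1) yS qd in \<open>auto simp: disjoint_family_on_def\<close>)
    \<comment> \<open>Ends of the first family are matched with starts of the second:
      \<open>x\<close> with \<open>y\<close> across the arc, every vertex of \<open>S\<close> with
      itself.\<close>
    define \<tau> where "\<tau> = (\<lambda>s. if s = x then y else s)"
    have \<tau>: "bij_betw \<tau> (insert x S) (insert y S)"
      unfolding \<tau>_def bij_betw_def inj_on_def using xS(1) yS(1) by auto
    let ?qi = "inv_into {..<k} (\<lambda>i. hd (q i))"
    define c where "c i = ?qi (\<tau> (last (p i)))" for i
    have cb: "bij_betw c {..<k} {..<k}"
      using bij_betw_trans[OF bij_betw_trans[OF pb \<tau>] bij_betw_inv_into[OF qb]]
      by (simp add: c_def[abs_def] o_def)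
    have c: "c i < k" "hd (q (c i)) = \<tau> (last (p i))" if "i < k" for i
    proof -
      show "c i < k" using bij_betwE[OF cb] that by blast
      have "\<tau> (last (p i)) \<in> insert y S" using p[OF that] bij_betwE[OF \<tau>] by blast
      then show "hd (q (c i)) = \<tau> (last (p i))"
        unfolding c_def using bij_betw_inv_into_right[OF qb] by metis
    qed
    \<comment> \<open>A vertex common to both families yields a walk in \<open>F\<close> from
      \<open>A\<close> to \<open>B\<close>, which \<open>S\<close> has to meet. As the paths were
      cut at their first and last vertex in the separators, only the common vertex itself can lie in
      \<open>S\<close>.\<close>
    have cross: "z = last (p i) \<and> z = hd (q j) \<and> z \<in> S" if ij: "i < k" "j < k"
      and z: "z \<in> set (p i)" "z \<in> set (q j)" for i j z
    proof -
      obtain us us' where us: "p i = us @ z # us'" using z(1) by (meson split_list)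
      obtain vs' vs where vs: "q j = vs' @ z # vs" using z(2) by (meson split_list)
      have "walk F (us @ [z])" using p[OF ij(1)] us walk_appendD1[of F "us @ [z]" us'] by simp
      moreover have "walk F (z # vs)" using q[OF ij(2)] vs walk_appendD2[of F vs'] by simp
      ultimately have "walk F (us @ z # vs)" by (rule walk_join)
      moreover have "hd (us @ z # vs) \<in> A" using p[OF ij(1)] us by (auto simp: hd_append)
      moreover have "last (us @ z # vs) \<in> B" using q[OF ij(2)] vs by (auto simp: last_append)
      ultimately have "set (us @ z # vs) \<inter> S \<noteq> {}" using S(2) unfolding separates_def by blast
      moreover have "set us \<subseteq> set (butlast (p i))" unfolding us by (simp add: butlast_append)
      moreover have "set vs \<subseteq> set (tl (q j))" unfolding vs by (cases vs') auto
      ultimately have "z \<in> S" using p[OF ij(1)] q[OF ij(2)] by auto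
      moreover have "z = last (p i)"
      proof (rule ccontr)
        assume "z \<noteq> last (p i)"
        then have "z \<in> set (butlast (p i))" using z(1) pne[OF ij(1)]
          by (metis append_butlast_last_id in_set_conv_decomp
          rotate1.simps(2) set_ConsD set_rotate1)
        then show False using p[OF ij(1)] \<open>z \<in> S\<close> by blast
      qed
      moreover have "z = hd (q j)"
      proof (rule ccontr)
        assume "z \<noteq> hd (q j)"
        then have "z \<in> set (tl (q j))" using z(2) qne[OF ij(2)] by (metis list.collapse set_ConsD)
        then show False using q[OF ij(2)] \<open>z \<in> S\<close> by blast
      qed
      ultimately show ?thesis by blast
    qed
    define w where "w i = (if last (p i) = x then p i @ q (c i) else p i @ tl (q (c i)))" for i
    have wset: "set (w i) \<subseteq> set (p i) \<union> set (q (c i))" if "i < k" for i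
      unfolding w_def using qne[OF c(1)[OF that]] by (auto dest: list.set_sel(2)[rotated])
    have "walk ?E (w i) \<and> hd (w i) \<in> A \<and> last (w i) \<in> B" if i: "i < k" for i
    proof -
      note ci = c[OF i] and P = p[OF i] pne[OF i] and Q = q[OF c(1)[OF i]] qne[OF c(1)[OF i]]
      have wE: "walk ?E (p i)" "walk ?E (q (c i))" using P Q by (blast intro: walk_mono)+
      show ?thesis
      proof (cases "last (p i) = x")
        case True
        then have "hd (q (c i)) = y" using ci by (simp add: \<tau>_def)
        then have "walk ?E (p i @ q (c i))" using True wE by (intro walk_append) auto
        then show ?thesis unfolding w_def using True P Q by simp
      next
        case False
        then have h: "hd (q (c i)) = last (p i)" using ci by (simp add: \<tau>_def)
        show ?thesis
        proof (cases "tl (q (c i)) = []")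
          case True
          then have "q (c i) = [last (p i)]" using h Q(2) by (metis list.collapse)
          then show ?thesis unfolding w_def using \<open>last (p i) \<noteq> x\<close> P Q wE by simp
        next
          case F: False
          have eq: "p i @ tl (q (c i)) = butlast (p i) @ last (p i) # tl (q (c i))"
            using P(2) by (metis append.assoc append_Cons append_Nil append_butlast_last_id)
          have "walk ?E (butlast (p i) @ [last (p i)])" using wE(1) P(2) by simp
          moreover have "walk ?E (last (p i) # tl (q (c i)))" using wE(2) Q(2) h
            by (metis list.collapse)
          ultimately have "walk ?E (p i @ tl (q (c i)))" unfolding eq by (rule walk_join)
          then show ?thesis unfolding w_def using False F P Q by (simp add: last_tl)
        qed
      qed
    qed
    moreover have "disjoint_family_on (\<lambda>i. set (w i)) {..<k}"
      unfolding disjoint_family_on_def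
    proof (intro ballI impI)
      fix i j assume ij: "i \<in> {..<k}" "j \<in> {..<k}" "i \<noteq> j"
      have neq: "c i \<noteq> c j" using cb ij by (auto simp: bij_betw_def inj_on_def)
      have disj: "set (p a) \<inter> set (q (c b)) = {}" if ab: "a < k" "b < k" "a \<noteq> b" for a b
      proof (rule ccontr)
        assume "set (p a) \<inter> set (q (c b)) \<noteq> {}"
        then obtain z where "z \<in> set (p a)" "z \<in> set (q (c b))" by blast
        from cross[OF ab(1) c(1)[OF ab(2)] this] have z:
          "z = last (p a)" "z = \<tau> (last (p b))" "z \<in> S"
          using c(2)[OF ab(2)] by auto
        then have "last (p a) = last (p b)" using yS(1) by (auto simp: \<tau>_def split: if_splits)
        then show False using pb ab by (auto simp: bij_betw_def inj_on_def)
      qed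
      have "(set (p i) \<union> set (q (c i))) \<inter> (set (p j) \<union> set (q (c j))) = {}"
        using disj[of i j] disj[of j i] pd[of i j] qd[of "c i" "c j"] c(1)[of i] c(1)[of j] neq ij
        by auto
      then show "set (w i) \<inter> set (w j) = {}" using wset[of i] wset[of j] ij by blast
    qed
    ultimately show ?thesis unfolding e by blast
  qed
qed

section \<open>Brambles\<close>

text \<open>Members have to intersect, whereas the usual notion also admits members that are merely
  adjacent. The brambles that arise here consist of sets containing a majority of a fixed boundary,
  and such sets intersect.\<close>

definition bramble :: "('a \<times> 'a) set \<Rightarrow> 'a set \<Rightarrow> 'a set set \<Rightarrow> bool" where
  "bramble E W \<B> \<longleftrightarrow> (\<forall>B\<in>\<B>. conn E B \<and> B \<subseteq> W) \<and> (\<forall>B\<in>\<B>. \<forall>B'\<in>\<B>. B \<inter> B' \<noteq> {})"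

definition order_ge :: "'a set set \<Rightarrow> nat \<Rightarrow> bool" where
  "order_ge \<B> t \<longleftrightarrow> (\<forall>S. finite S \<and> card S < t \<longrightarrow> (\<exists>B\<in>\<B>. B \<inter> S = {}))"

lemma order_geD: "order_ge \<B> t \<Longrightarrow> finite S \<Longrightarrow> card S < t \<Longrightarrow> \<exists>B\<in>\<B>. B \<inter> S = {}"
  by (auto simp: order_ge_def)

lemma not_order_geE:
  assumes "\<not> order_ge \<B> t"
  obtains S where "finite S" "card S < t" "\<And>B. B \<in> \<B> \<Longrightarrow> B \<inter> S \<noteq> {}"
  using assms unfolding order_ge_def by blast

text \<open>Take a longest path that meets some member \<open>B\<close> exactly in its last vertex.
  If it missed a member \<open>B'\<close>, it could be prolonged inside \<open>B\<close> up to the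
  first vertex of \<open>B'\<close>, and would then meet \<open>B'\<close> exactly in the new
  end.\<close>

lemma bramble_path:
  assumes "sym E" "finite W" "bramble E W \<B>" "\<B> \<noteq> {}"
  obtains xs where "walk E xs" "distinct xs" "set xs \<subseteq> W" "\<And>B. B \<in> \<B> \<Longrightarrow> B \<inter> set xs \<noteq> {}"
proof -
  have br: "conn E B" "B \<subseteq> W" if "B \<in> \<B>" for B using assms(3) that by (auto simp: bramble_def)
  have meet: "B \<inter> B' \<noteq> {}" if "B \<in> \<B>" "B' \<in> \<B>" for B B' using assms(3) that
    by (auto simp: bramble_def)
  define good where "good xs \<longleftrightarrow> walk E xs \<and> distinct xs \<and> set xs \<subseteq> W \<and>
    (\<exists>B\<in>\<B>. set xs \<inter> B = {last xs})" for xs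
  obtain B0 where B0: "B0 \<in> \<B>" using assms(4) by blast
  obtain v where v: "v \<in> B0" using conn_not_empty[OF br(1)[OF B0]] by blast
  have "good [v]" using B0 v br(2)[OF B0] by (auto simp: good_def walk_def)
  moreover have "length xs < Suc (card W)" if "good xs" for xs
    using that assms(2) distinct_card[of xs] card_mono[of W "set xs"] by (auto simp: good_def)
  ultimately obtain xs where xs: "good xs" and max: "\<And>ys. good ys \<Longrightarrow> length ys \<le> length xs"
    using ex_has_greatest_nat[of good "[v]" length "Suc (card W)"] by (auto simp: le_less)
  obtain B where B: "B \<in> \<B>" "set xs \<inter> B = {last xs}" using xs by (auto simp: good_def)
  have "B' \<inter> set xs \<noteq> {}" if B': "B' \<in> \<B>" for B'
  proof
    assume no: "B' \<inter> set xs = {}"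
    obtain y where y: "y \<in> B" "y \<in> B'" using meet[OF B(1) B'] by blast
    have "last xs \<in> B" using B by blast
    then obtain ys where ys: "walk E ys" "distinct ys" "hd ys = last xs" "last ys = y" "set ys \<subseteq> B"
      using conn_path[OF br(1)[OF B(1)], of "last xs" y] y by blast
    have "set ys \<inter> B' \<noteq> {}" using ys y by (metis disjoint_iff last_in_set walk_def)
    from walk_first_hit[OF ys(1) this] obtain zs where
      zs: "walk E zs" "hd zs = last xs" "last zs \<in> B'" "set (butlast zs) \<inter> B' = {}" "set zs \<subseteq>
        B" "distinct zs"
      using ys by (metis order_trans)
    have xne: "xs \<noteq> []" using xs by (auto simp: good_def walk_def)
    then have "last xs \<notin> B'" using no by (meson disjoint_iff last_in_set)
    then obtain z zs' where z: "zs = last xs # z # zs'"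
      using zs(1-3) by (cases zs; cases "tl zs") (auto simp: walk_def)
    let ?ws = "xs @ z # zs'"
    have "set (z # zs') \<subseteq> B" "last xs \<notin> set (z # zs')" using zs(5,6) z by auto
    note zB = this
    have "set (z # zs') \<inter> set xs = {}"
    proof (rule equals0I)
      fix x assume x: "x \<in> set (z # zs') \<inter> set xs"
      then have "x \<in> set xs \<inter> B" using zB(1) by (meson IntD1 IntD2 IntI subsetD)
      then have "x = last xs" unfolding B(2) by (rule singletonD)
      then show False using zB(2) x by (metis IntD1)
    qed
    have "walk E ?ws"
      using xs zs(1) unfolding z good_def by (intro walk_append) (auto simp: walk_def)
    moreover have "distinct ?ws" using xs zs(6) \<open>set (z # zs') \<inter> set xs = {}\<close> z
      by (auto simp: good_def)
    moreover have "set ?ws \<subseteq> W" using xs zs(5) br(2)[OF B(1)] z by (auto simp: good_def)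
    moreover have "set ?ws \<inter> B' = {last ?ws}"
    proof -
      have "set (butlast (z # zs')) \<inter> B' = {}" using zs(4) z by auto
      moreover have "set (z # zs') = insert (last (z # zs')) (set (butlast (z # zs')))"
        by (metis append_butlast_last_id list.distinct(1)
        list.simps(15) rotate1.simps(2) set_rotate1)
      moreover have "last (z # zs') \<in> B'" using zs(3) z by simp
      ultimately show ?thesis using no by auto
    qed
    ultimately have "good ?ws" using B' unfolding good_def by blast
    from max[OF this] show False by simp
  qed
  then show ?thesis using xs that unfolding good_def by blast
qed

text \<open>Cut off the shortest prefix such that the members it meets have order at least
  \<open>t\<close>. One vertex earlier, fewer than \<open>t\<close> vertices hit all members met so
  far; hence at most \<open>t\<close> vertices hit all members met by the prefix, and the others
  keep order \<open>m * t\<close>. The path is given by \<open>successively\<close> and not by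
  \<open>walk\<close> because the remainder may be empty.\<close>

lemma bramble_segments:
  fixes E :: "('a \<times> 'a) set"
  assumes "t > 0" "successively (\<lambda>u v. (u, v) \<in> E) xs" "distinct xs"
    and "\<And>B. B \<in> \<B> \<Longrightarrow> B \<inter> set xs \<noteq> {}" "order_ge \<B> (m * t)"
  shows "\<exists>P \<C>. (\<forall>i<m. walk E (P i) \<and> distinct (P i) \<and> set (P i) \<subseteq> set xs \<and> \<C> i \<subseteq> \<B> \<and>
            order_ge (\<C> i) t \<and> (\<forall>B\<in>\<C> i. B \<inter> set (P i) \<noteq> {})) \<and>
          disjoint_family_on (\<lambda>i. set (P i)) {..<m}"
  using assms(2-)
proof (induction m arbitrary: \<B> xs)
  case 0
  then show ?case by (auto simp: disjoint_family_on_def)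
next
  case (Suc m)
  let ?hit = "\<lambda>n. {B \<in> \<B>. B \<inter> set (take n xs) \<noteq> {}}"
  have "order_ge \<B> t" using Suc.prems(4) unfolding order_ge_def
    by (metis le_add1 less_le_trans mult_Suc)
  moreover have "?hit (length xs) = \<B>" using Suc.prems(3) by auto
  ultimately have ex: "order_ge (?hit (length xs)) t" by simp
  define n where "n = (LEAST n. order_ge (?hit n) t)"
  have n: "order_ge (?hit n) t" unfolding n_def
    by (rule LeastI[of "\<lambda>n. order_ge (?hit n) t", OF ex])
  have least: "n \<le> n'" if "order_ge (?hit n') t" for n' unfolding n_def using that
    by (rule Least_le)
  have "n \<noteq> 0"
  proof
    assume "n = 0"
    then show False using order_geD[OF n, of "{}"] assms(1) by auto
  qed
  then obtain n' where n': "n = Suc n'" by (cases n) auto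
  then have "\<not> order_ge (?hit n') t" using least[of n'] by auto
  then obtain S where S: "finite S" "card S < t" "\<And>B. B \<in> ?hit n' \<Longrightarrow> B \<inter> S \<noteq> {}"
    by (rule not_order_geE) (rule that; assumption)
  have nle: "n \<le> length xs" using least[OF ex] .
  define S1 where "S1 = insert (xs ! n') S"
  have S1: "finite S1" "card S1 \<le> t" using S by (auto simp: S1_def card_insert_if)
  have hitS1: "B \<inter> S1 \<noteq> {}" if "B \<in> ?hit n" for B
  proof -
    have "take n xs = take n' xs @ [xs ! n']" using nle n' by (simp add: take_Suc_conv_app_nth)
    then show ?thesis using that S(3)[of B] by (auto simp: S1_def)
  qed
  let ?B' = "\<B> - ?hit n"
  have "order_ge ?B' (m * t)" unfolding order_ge_def
  proof (intro allI impI)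
    fix S' :: "'a set" assume S': "finite S' \<and> card S' < m * t"
    have "card (S' \<union> S1) < Suc m * t" using card_Un_le[of S' S1] S' S1 by simp
    then have "\<exists>B\<in>\<B>. B \<inter> (S' \<union> S1) = {}" using S' S1 by (intro order_geD[OF Suc.prems(4)]) auto
    then obtain B where "B \<in> \<B>" "B \<inter> (S' \<union> S1) = {}" by auto
    moreover from this have "B \<notin> ?hit n" using hitS1[of B] by auto
    ultimately have "B \<in> ?B'" "B \<inter> S' = {}" by auto
    then show "\<exists>B\<in>?B'. B \<inter> S' = {}" by (rule bexI[rotated])
  qed
  moreover have "B \<inter> set (drop n xs) \<noteq> {}" if "B \<in> ?B'" for B
  proof -
    have "set xs = set (take n xs) \<union> set (drop n xs)" by (metis append_take_drop_id set_append)
    then show ?thesis using Suc.prems(3)[of B] that by auto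
  qed
  moreover have succ: "successively (\<lambda>u v. (u, v) \<in> E) (take n xs)"
    "successively (\<lambda>u v. (u, v) \<in> E) (drop n xs)"
    using Suc.prems(1) by (metis append_take_drop_id successively_append_iff)+
  moreover have "distinct (drop n xs)" using Suc.prems(2) by simp
  ultimately obtain P \<C>
    where P: "\<forall>i<m. walk E (P i) \<and> distinct (P i) \<and> set (P i) \<subseteq> set (drop n xs) \<and> \<C> i \<subseteq> ?B' \<and>
            order_ge (\<C> i) t \<and> (\<forall>B\<in>\<C> i. B \<inter> set (P i) \<noteq> {})"
        and d: "disjoint_family_on (\<lambda>i. set (P i)) {..<m}"
    using Suc.IH[of "drop n xs" ?B'] by blast
  define P' \<C>' where "P' i = (case i of 0 \<Rightarrow> take n xs | Suc i \<Rightarrow> P i)"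
    and "\<C>' i = (case i of 0 \<Rightarrow> ?hit n | Suc i \<Rightarrow> \<C> i)" for i
  have "take n xs \<noteq> []" using \<open>n \<noteq> 0\<close> nle by auto
  then have w0: "walk E (take n xs)" using succ by (simp add: walk_def)
  have "walk E (P' i) \<and> distinct (P' i) \<and> set (P' i) \<subseteq> set xs \<and> \<C>' i \<subseteq> \<B> \<and>
            order_ge (\<C>' i) t \<and> (\<forall>B\<in>\<C>' i. B \<inter> set (P' i) \<noteq> {})" if "i < Suc m" for i
  proof (cases i)
    case 0
    then show ?thesis using w0 Suc.prems(2) n by (auto simp: P'_def \<C>'_def dest: in_set_takeD)
  next
    case (Suc j)
    then have "j < m" using that by simp
    with P have "walk E (P j) \<and> distinct (P j) \<and> set (P j) \<subseteq> set (drop n xs) \<and> \<C> j \<subseteq> ?B' \<and>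
            order_ge (\<C> j) t \<and> (\<forall>B\<in>\<C> j. B \<inter> set (P j) \<noteq> {})" by blast
    moreover have "set (drop n xs) \<subseteq> set xs" by (rule set_drop_subset)
    ultimately show ?thesis using Suc unfolding P'_def \<C>'_def by auto
  qed
  moreover have "disjoint_family_on (\<lambda>i. set (P' i)) {..<Suc m}"
  proof -
    have "set (take n xs) \<inter> set (drop n xs) = {}" using Suc.prems(2)
      by (rule set_take_disj_set_drop_if_distinct) simp
    then have "set (take n xs) \<inter> set (P j) = {}" if "j < m" for j using P that by blast
    then show ?thesis using d unfolding disjoint_family_on_def P'_def
      by (auto split: nat.split simp: Int_commute)
  qed
  ultimately show ?case by blast
qed

section \<open>Ladders between two segments of a path\<close>

text \<open>Cutting after the last visit to \<open>A\<close>, and then at the first visit to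
  \<open>B\<close>, leaves an interior outside both. It is nonempty because \<open>A\<close> and
  \<open>B\<close> are not adjacent, as a subdivided rung requires.\<close>

lemma walk_rung:
  assumes "sym E" "walk E w" "hd w \<in> A" "last w \<in> B" "A \<inter> B = {}" "\<And>a b. a \<in> A \<Longrightarrow> b \<in> B \<Longrightarrow> (a, b) \<notin> E"
  shows "\<exists>a c I. a \<in> A \<and> c \<in> B \<and> a \<in> set w \<and> c \<in> set w \<and> I \<subseteq> set w - A - B \<and> conn E I \<and>
           (\<exists>z\<in>I. (a, z) \<in> E) \<and> (\<exists>z\<in>I. (z, c) \<in> E)"
proof -
  have wne: "w \<noteq> []" using assms(2) by (simp add: walk_def)
  have "set w \<inter> A \<noteq> {}" using hd_in_set[OF wne] assms(3) by blast
  from walk_last_hit[OF assms(2) this] obtain ys where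
    ys: "walk E ys" "last ys = last w" "hd ys \<in> A" "set (tl ys) \<inter> A = {}" "set ys \<subseteq> set w" by metis
  have "ys \<noteq> []" using ys by (simp add: walk_def)
  then have "set ys \<inter> B \<noteq> {}" using last_in_set[of ys] assms(4) ys(2) by auto
  from walk_first_hit[OF ys(1) this] obtain zs where
    zs: "walk E zs" "hd zs = hd ys" "last zs \<in> B" "set (butlast zs) \<inter> B = {}" "set zs \<subseteq> set ys"
      "set (tl zs) \<subseteq> set (tl ys)" by metis
  have zne: "zs \<noteq> []" using zs by (simp add: walk_def)
  define a c mid where "a = hd zs" and "c = last zs" and "mid = butlast (tl zs)"
  have ac: "a \<in> A" "c \<in> B" using zs ys by (auto simp: a_def c_def)
  have "tl zs \<noteq> []"
  proof
    assume "tl zs = []"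
    then have "zs = [hd zs]" using zne by (metis list.collapse)
    then have "a = c" unfolding a_def c_def by (metis last.simps)
    then show False using ac assms(5) by blast
  qed
  then have z: "zs = a # mid @ [c]"
    using zne by (metis a_def append_butlast_last_id c_def last_tl list.collapse mid_def)
  have mid: "mid \<noteq> []"
  proof
    assume "mid = []"
    then have "(a, c) \<in> E" using zs(1) z by (simp add: walk_def)
    then show False using assms(6) ac by blast
  qed
  have "walk E mid" using walk_appendD1[OF walk_appendD2[of E "[a]" "mid @ [c]"] mid] zs(1)
    unfolding z by simp
  then have cm: "conn E (set mid)" by (rule conn_walk[OF assms(1)])
  have arcs: "(a, hd mid) \<in> E" "(last mid, c) \<in> E"
    using zs(1) mid unfolding z walk_def by (auto simp: successively_Cons successively_append_iff)
  have "set mid \<subseteq> set (tl zs)" "set mid \<subseteq> set (butlast zs)" "set mid \<subseteq> set zs"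
    unfolding z using mid by auto
  then have "set mid \<subseteq> set (tl ys)" "set mid \<inter> B = {}" "set mid \<subseteq> set w"
    using zs(4-6) ys(5) by (metis order_trans, metis disjoint_iff subsetD, metis order_trans)
  moreover from this(1) ys(4) have "set mid \<inter> A = {}" by (metis disjoint_iff subsetD)
  ultimately have m: "set mid \<subseteq> set w - A - B" by auto
  have "a \<in> set zs" "c \<in> set zs" using z by auto
  then have "a \<in> set w" "c \<in> set w" using zs(5) ys(5) by auto
  moreover have "hd mid \<in> set mid" "last mid \<in> set mid" using mid by auto
  ultimately show ?thesis
    using ac cm arcs m by (intro exI[of _ a] exI[of _ c]
    exI[of _ "set mid"] conjI bexI[of _ "hd mid"] bexI[of _ "last mid"])
qed

lemma enumerate_injection:
  fixes n :: nat
  assumes "inj_on f {..<n}"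
  shows "\<exists>x \<sigma>. (\<forall>i j. i < j \<longrightarrow> j < n \<longrightarrow> x i < (x j :: nat)) \<and> bij_betw \<sigma> {..<n} {..<n} \<and>
           (\<forall>j<n. f (\<sigma> j) = x j)"
proof -
  have "card (f ` {..<n}) = n" using card_image[OF assms] by simp
  then obtain x where x: "\<And>i. i < n \<Longrightarrow> x i \<in> f ` {..<n}" "\<And>i j. i < j \<Longrightarrow> j < n \<Longrightarrow> x i < x j"
    using finite_enumeration[of "f ` {..<n}" n] by auto
  define \<sigma> where "\<sigma> j = inv_into {..<n} f (x j)" for j
  have f\<sigma>: "f (\<sigma> j) = x j" "\<sigma> j < n" if "j < n" for j
    using f_inv_into_f[OF x(1)[OF that]] inv_into_into[OF x(1)[OF that]] by (simp_all add: \<sigma>_def)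
  have "inj_on \<sigma> {..<n}"
  proof (rule inj_onI, rule ccontr)
    fix i j assume ij: "i \<in> {..<n}" "j \<in> {..<n}" "\<sigma> i = \<sigma> j" "i \<noteq> j"
    then have "x i = x j" using f\<sigma>(1) by (metis lessThan_iff)
    then show False using x(2)[of i j] x(2)[of j i] ij by (cases "i < j") auto
  qed
  moreover have "\<sigma> ` {..<n} \<subseteq> {..<n}" using f\<sigma> by auto
  ultimately have "bij_betw \<sigma> {..<n} {..<n}"
    by (simp add: bij_betw_def endo_inj_surj)
  then show ?thesis using x(2) f\<sigma>(1) by (intro exI[of _ x] exI[of _ \<sigma>]) simp
qed

lemma rungs_ladder_model:
  assumes sym: "sym E" and p: "walk E p" "distinct p" and q: "walk E q" "distinct q"
    and pq: "set p \<inter> set q = {}" "set p \<subseteq> W" "set q \<subseteq> W"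
    and ac: "\<And>i. i < N \<Longrightarrow> a i \<in> set p" "\<And>i. i < N \<Longrightarrow> c i \<in> set q" "inj_on a {..<N}" "inj_on c {..<N}"
    and I: "\<And>i. i < N \<Longrightarrow> I i \<subseteq> W - set p - set q" "\<And>i. i < N \<Longrightarrow>
    conn E (I i)" "disjoint_family_on I {..<N}"
      "\<And>i. i < N \<Longrightarrow> \<exists>z\<in>I i. (a i, z) \<in> E" "\<And>i. i < N \<Longrightarrow> \<exists>z\<in>I i. (z, c i) \<in> E"
  shows "\<exists>\<pi> \<psi>. bij_betw \<pi> {..<N} {..<N} \<and> minor_model E W (cells N) (ladder \<pi>) \<psi>"
proof -
  have "\<exists>m. m < length p \<and> p ! m = a i" if "i < N" for i using ac(1)[OF that]
    by (metis in_set_conv_nth)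
  then obtain f where f: "\<And>i. i < N \<Longrightarrow> f i < length p" "\<And>i. i < N \<Longrightarrow> p ! f i = a i" by metis
  have "\<exists>m. m < length q \<and> q ! m = c i" if "i < N" for i using ac(2)[OF that]
    by (metis in_set_conv_nth)
  then obtain g where g: "\<And>i. i < N \<Longrightarrow> g i < length q" "\<And>i. i < N \<Longrightarrow> q ! g i = c i" by metis
  have injf: "inj_on f {..<N}" by (intro inj_onI) (metis ac(3) f(2) inj_onD lessThan_iff)
  obtain x \<sigma> where x: "\<And>i j. i < j \<Longrightarrow> j < N \<Longrightarrow> x i < (x j :: nat)" and \<sigma>: "bij_betw \<sigma> {..<N} {..<N}"
    and fx: "\<And>j. j < N \<Longrightarrow> f (\<sigma> j) = x j"
    using enumerate_injection[OF injf] by auto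
  have injg: "inj_on g {..<N}" by (intro inj_onI) (metis ac(4) g(2) inj_onD lessThan_iff)
  obtain y \<rho> where y: "\<And>i j. i < j \<Longrightarrow> j < N \<Longrightarrow> y i < (y j :: nat)" and \<rho>: "bij_betw \<rho> {..<N} {..<N}"
    and gy: "\<And>j. j < N \<Longrightarrow> g (\<rho> j) = y j"
    using enumerate_injection[OF injg] by auto
  obtain A where A: "rail_parts N x A" using rail_parts_increasing[of N x] x by blast
  obtain B where B: "rail_parts N y B" using rail_parts_increasing[of N y] y by blast
  \<comment> \<open>\<open>\<sigma>\<close> lists the rungs in their order along \<open>p\<close>
    and \<open>\<rho>\<close> along \<open>q\<close>; \<open>\<pi>\<close> translates the first
    numbering into the second.\<close>
  define \<pi> where "\<pi> = inv_into {..<N} \<rho> \<circ> \<sigma>"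
  have \<pi>: "bij_betw \<pi> {..<N} {..<N}"
    unfolding \<pi>_def by (rule bij_betw_trans[OF \<sigma> bij_betw_inv_into[OF \<rho>]])
  have \<sigma>N: "\<sigma> j < N" "\<pi> j < N" if "j < N" for j using bij_betwE[OF \<sigma>] bij_betwE[OF \<pi>] that by auto
  have \<rho>\<pi>: "\<rho> (\<pi> j) = \<sigma> j" if "j < N" for j
    unfolding \<pi>_def using bij_betw_inv_into_right[OF \<rho>, of "\<sigma> j"] \<sigma>N(1)[OF that] by simp
  have xl: "x j < length p" and yl: "y j < length q" if "j < N" for j
    using fx[OF that] gy[OF that] f(1)[OF \<sigma>N(1)[OF that]] g(1)[of "\<rho> j"] bij_betwE[OF \<rho>] that
    by auto
  have fi: "\<exists>i<N. m \<le> x i" "\<exists>i<N. m' \<le> y i" if "j < N" "m \<in> A j" "m' \<in> B j" for j m m'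
    using A B that unfolding rail_parts_def by simp_all
  have AW: "(!) p ` A j \<subseteq> W" and BW: "(!) q ` B j \<subseteq> W" if "j < N" for j
  proof -
    have "y j \<in> B j" "x j \<in> A j" using A B that by (simp_all add: rail_parts_def)
    then have "A j \<subseteq> {..<length p}" "B j \<subseteq> {..<length q}"
      using fi[OF that] xl yl by (meson lessThan_iff le_less_trans subsetI)+
    then show "(!) p ` A j \<subseteq> W" "(!) q ` B j \<subseteq> W" using pq(2,3) nth_mem by blast+
  qed
  have "\<exists>\<psi>. minor_model E W (cells N) (ladder \<pi>) \<psi>"
  proof (rule rails_minor_model[OF sym p q pq(1) A B xl yl AW BW, where I = "\<lambda>j. I (\<sigma> j)"])
    fix j assume j: "j < N"
    show "I (\<sigma> j) \<subseteq> W - set p - set q" "conn E (I (\<sigma> j))" using I(1,2)[OF \<sigma>N(1)[OF j]] .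
    have "a (\<sigma> j) = p ! x j" using f(2)[OF \<sigma>N(1)[OF j]] fx[OF j] by simp
    then show "\<exists>z\<in>I (\<sigma> j). (p ! x j, z) \<in> E" using I(4)[OF \<sigma>N(1)[OF j]] by simp
    have "c (\<sigma> j) = q ! y (\<pi> j)" using g(2)[OF \<sigma>N(1)[OF j]] gy[OF \<sigma>N(2)[OF j]] \<rho>\<pi>[OF j] by simp
    then show "\<exists>z\<in>I (\<sigma> j). (z, q ! y (\<pi> j)) \<in> E" using I(5)[OF \<sigma>N(1)[OF j]] by simp
  next
    show "disjoint_family_on (\<lambda>j. I (\<sigma> j)) {..<N}"
      unfolding disjoint_family_on_def
    proof (intro ballI impI)
      fix i j assume ij: "i \<in> {..<N}" "j \<in> {..<N}" "i \<noteq> j"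
      then have "\<sigma> i \<noteq> \<sigma> j" using \<sigma> by (auto simp: bij_betw_def inj_on_def)
      then show "I (\<sigma> i) \<inter> I (\<sigma> j) = {}" using I(3) \<sigma>N ij by (auto simp: disjoint_family_on_def)
    qed
  qed
  then show ?thesis using \<pi> by blast
qed

text \<open>Fewer than \<open>N\<close> vertices miss a member of \<open>\<C>\<close> and a member
  of \<open>\<D>\<close>. These two intersect, so their union contains a walk between the segments
  that avoids the given vertices, and Menger's theorem applies.\<close>

lemma bramble_segments_linked:
  assumes sym: "sym E" and "finite W" and br: "bramble E W \<B>"
    and p: "walk E p" "set p \<subseteq> W" and q: "walk E q" "set q \<subseteq> W"
    and \<C>: "\<C> \<subseteq> \<B>" "order_ge \<C> N" "\<And>B. B \<in> \<C> \<Longrightarrow> B \<inter> set p \<noteq> {}"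
    and \<D>: "\<D> \<subseteq> \<B>" "order_ge \<D> N" "\<And>B. B \<in> \<D> \<Longrightarrow> B \<inter> set q \<noteq> {}"
  shows "\<exists>w. (\<forall>i<N. walk (E \<inter> W \<times> W) (w i) \<and> hd (w i) \<in> set p \<and> last (w i) \<in> set q) \<and>
           disjoint_family_on (\<lambda>i. set (w i)) {..<N}"
proof (rule menger)
  show "finite (E \<inter> W \<times> W)" using assms(2) by simp
  fix S assume S: "finite S" "separates (E \<inter> W \<times> W) (set p) (set q) S"
  show "N \<le> card S"
  proof (rule ccontr)
    assume "\<not> N \<le> card S"
    then have "card S < N" by simp
    then obtain B B' where B: "B \<in> \<C>" "B \<inter> S = {}" "B' \<in> \<D>" "B' \<inter> S = {}"
      using order_geD[OF \<C>(2) S(1)] order_geD[OF \<D>(2) S(1)] by blast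
    then have BB: "B \<in> \<B>" "B' \<in> \<B>" using \<C>(1) \<D>(1) by auto
    then have c: "conn E B" "conn E B'" "B \<inter> B' \<noteq> {}" "B \<subseteq> W" "B' \<subseteq> W" using br
      by (auto simp: bramble_def)
    obtain u v where uv: "u \<in> B" "u \<in> set p" "v \<in> B'" "v \<in> set q" using \<C>(3)[OF B(1)] \<D>(3)[OF B(3)]
      by blast
    have "conn E (B \<union> B')" using c by (intro conn_Un[OF sym]) auto
    moreover have "conn (E \<inter> W \<times> W) (B \<union> B')"
    proof -
      have "(E \<inter> W \<times> W) \<inter> (B \<union> B') \<times> (B \<union> B') = E \<inter> (B \<union> B') \<times> (B \<union> B')" using c(4,5) by blast
      then show ?thesis using \<open>conn E (B \<union> B')\<close> unfolding conn_def by simp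
    qed
    ultimately obtain xs where "walk (E \<inter> W \<times> W) xs" "hd xs = u" "last xs = v" "set xs \<subseteq> B \<union> B'"
      using conn_path[of "E \<inter> W \<times> W" "B \<union> B'" u v] uv by blast
    then show False using S(2) uv B unfolding separates_def by blast
  qed
qed simp

lemma walk_subset:
  assumes "walk (E \<inter> W \<times> W) xs" "hd xs \<in> W"
  shows "set xs \<subseteq> W"
  using assms
proof (induction xs)
  case (Cons x xs)
  then show ?case by (cases xs) (auto simp: walk_def)
qed simp

lemma packs_of_clique:
  assumes "sym E" "minor_model E W {..<k * h} UNIV \<phi>" "finite U" "card U \<le> h"
  shows "packs E W k U F"
proof (rule packs_trans[OF assms(1,2)])
  have "minor UNIV {i * h..<Suc i * h} U F" for i
  proof (rule minor_of_clique[OF _ assms(3,4)])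
    show "minor_model UNIV {i * h..<Suc i * h} {..<h} UNIV (\<lambda>j. {i * h + j})"
      by (rule minor_modelI) auto
  qed
  moreover have "{i * h..<Suc i * h} \<subseteq> {..<k * h}" if "i < k" for i
  proof -
    have "Suc i * h \<le> k * h" using that by (intro mult_le_mono1) simp
    then show ?thesis by auto
  qed
  moreover have "disjoint_family_on (\<lambda>i. {i * h..<Suc i * h}) {..<k}"
    unfolding disjoint_family_on_def
  proof (intro ballI impI)
    fix i j :: nat assume "i \<noteq> j"
    then consider "Suc i \<le> j" | "Suc j \<le> i" by linarith
    then show "{i * h..<Suc i * h} \<inter> {j * h..<Suc j * h} = {}"
    proof cases
      case 1 then have "Suc i * h \<le> j * h" by (rule mult_le_mono1) then show ?thesis by auto
    next
      case 2 then have "Suc j * h \<le> i * h" by (rule mult_le_mono1) then show ?thesis by auto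
    qed
  qed
  ultimately show "packs UNIV {..<k * h} k U F"
    unfolding packs_def by (intro exI[of _ "\<lambda>i. {i * h..<Suc i * h}"]) auto
qed

text \<open>The order \<open>k * h * (b * M)\<close> pays for \<open>k * h\<close> segments, enough
  for \<open>k\<close> disjoint cliques of \<open>h\<close> branch sets, with subfamilies of order
  \<open>b * M\<close>, the number of rungs that \<open>ladder_packs\<close> needs.\<close>

theorem bramble_packs:
  assumes sym: "sym E" and "finite W" and br: "bramble E W \<B>" "order_ge \<B> (k * h * (b * M))"
    and lad: "minor (ladder id) (cells h) U F" and U: "finite U" "card U \<le> h" and "h > 0" "k > 0"
    and b: "b = 8 * h ^ 3 * 16 ^ h\<^sup>2" and R: "R = 2 + h + 2 * r * h\<^sup>2"
    and M: "2 * k * R \<le> M" "2 * M \<le> 2 ^ r"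
  shows "packs E W k U F"
proof -
  let ?N = "b * M"
  have N: "?N > 0" using M(1) R b \<open>h > 0\<close> \<open>k > 0\<close> by (auto intro!: gr0I)
  then have "k * h * ?N > 0" using \<open>h > 0\<close> \<open>k > 0\<close> by simp
  then have "\<B> \<noteq> {}" using order_geD[OF br(2), of "{}"] by auto
  then obtain xs where xs: "walk E xs" "distinct xs" "set xs \<subseteq> W" "\<And>B. B \<in> \<B> \<Longrightarrow> B \<inter> set xs \<noteq> {}"
    using bramble_path[OF sym assms(2) br(1)] by metis
  then have "successively (\<lambda>u v. (u, v) \<in> E) xs" by (simp add: walk_def)
  from bramble_segments[OF N this xs(2,4) br(2)] obtain P \<C> where
    P: "\<And>i. i < k * h \<Longrightarrow> walk E (P i) \<and> distinct (P i) \<and> set (P i) \<subseteq> set xs \<and> \<C> i \<subseteq> \<B> \<and>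
            order_ge (\<C> i) ?N \<and> (\<forall>B\<in>\<C> i. B \<inter> set (P i) \<noteq> {})"
    and d: "disjoint_family_on (\<lambda>i. set (P i)) {..<k * h}" by blast
  show ?thesis
  proof (cases "\<forall>i<k * h. \<forall>j<k * h. i \<noteq> j \<longrightarrow> (\<exists>x\<in>set (P i). \<exists>y\<in>set (P j). (x, y) \<in> E)")
    case True
    have "minor_model E W {..<k * h} UNIV (\<lambda>i. set (P i))"
    proof (rule minor_modelI)
      fix i assume i: "i \<in> {..<k * h}"
      show "conn E (set (P i))" "set (P i) \<subseteq> W" using P[of i] i xs(3) conn_walk[OF sym] by auto
      fix j assume j: "j \<in> {..<k * h}" "i \<noteq> j"
      show "set (P i) \<inter> set (P j) = {}" using d i j by (auto simp: disjoint_family_on_def)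
      show "\<exists>x\<in>set (P i). \<exists>y\<in>set (P j). (x, y) \<in> E" using True i j by auto
    qed
    then show ?thesis by (rule packs_of_clique[OF sym _ U])
  next
    case False
    then obtain i j where ij: "i < k * h" "j < k * h" "i \<noteq> j"
      and no: "\<And>x y. x \<in> set (P i) \<Longrightarrow> y \<in> set (P j) \<Longrightarrow> (x, y) \<notin> E" by blast
    let ?p = "P i" and ?q = "P j"
    have W: "set ?p \<subseteq> W" "set ?q \<subseteq> W" using P[OF ij(1)] P[OF ij(2)] xs(3) by auto
    have pq: "set ?p \<inter> set ?q = {}" using d ij by (auto simp: disjoint_family_on_def)
    have "\<exists>w. (\<forall>l<?N. walk (E \<inter> W \<times> W) (w l) \<and> hd (w l) \<in> set ?p \<and> last (w l) \<in> set ?q) \<and>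
           disjoint_family_on (\<lambda>l. set (w l)) {..<?N}"
      by (rule bramble_segments_linked[OF sym assms(2) br(1), where \<C> = "\<C> i" and \<D> = "\<C> j"])
        (use P[OF ij(1)] P[OF ij(2)] W in auto)
    then obtain w where w: "\<And>l. l < ?N \<Longrightarrow> walk (E \<inter> W \<times> W) (w l) \<and> hd (w l) \<in> set ?p \<and>
      last (w l) \<in> set ?q"
      and dw: "disjoint_family_on (\<lambda>l. set (w l)) {..<?N}" by blast
    have wW: "set (w l) \<subseteq> W" if "l < ?N" for l
      using w[OF that] W by (intro walk_subset) auto
    have "\<exists>a c I. a \<in> set ?p \<and> c \<in> set ?q \<and> a \<in> set (w l) \<and> c \<in> set (w l) \<and> I \<subseteq>
      set (w l) - set ?p - set ?q \<and>
           conn E I \<and> (\<exists>z\<in>I. (a, z) \<in> E) \<and> (\<exists>z\<in>I. (z, c) \<in> E)" if "l < ?N" for l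
      by (rule walk_rung[OF sym _ _ _ pq]) (use w[OF that] no in \<open>auto intro: walk_mono\<close>)
    then obtain a c I where aci: "\<And>l. l < ?N \<Longrightarrow> a l \<in> set ?p \<and> c l \<in> set ?q \<and> a l \<in> set (w l) \<and>
      c l \<in> set (w l) \<and>
           I l \<subseteq> set (w l) - set ?p - set ?q \<and>
           conn E (I l) \<and> (\<exists>z\<in>I l. (a l, z) \<in> E) \<and> (\<exists>z\<in>I l. (z, c l) \<in> E)" by metis
    have dl: "set (w l) \<inter> set (w l') = {}" if "l < ?N" "l' < ?N" "l \<noteq> l'" for l l'
      using dw that by (auto simp: disjoint_family_on_def)
    have "inj_on a {..<?N}" "inj_on c {..<?N}"
      using aci dl by (intro inj_onI; metis disjoint_iff lessThan_iff)+
    moreover have "disjoint_family_on I {..<?N}"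
      unfolding disjoint_family_on_def
    proof (intro ballI impI)
      fix l l' assume l: "l \<in> {..<?N}" "l' \<in> {..<?N}" "l \<noteq> l'"
      then show "I l \<inter> I l' = {}" using aci[of l] aci[of l'] dl[of l l'] by blast
    qed
    ultimately have "\<exists>\<pi> \<psi>. bij_betw \<pi> {..<?N} {..<?N} \<and> minor_model E W (cells ?N) (ladder \<pi>) \<psi>"
    proof (intro rungs_ladder_model[OF sym, of ?p ?q W ?N a c I])
      show "walk E ?p" "distinct ?p" "walk E ?q" "distinct ?q" using P[OF ij(1)] P[OF ij(2)]
        by simp_all
      fix l assume l: "l < ?N"
      show "a l \<in> set ?p" "c l \<in> set ?q" "conn E (I l)" "\<exists>z\<in>I l. (a l, z) \<in> E"
        "\<exists>z\<in>I l. (z, c l) \<in> E"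
        using aci[OF l] by simp_all
      show "I l \<subseteq> W - set ?p - set ?q" using aci[OF l] wW[OF l] by auto
    qed (use W pq in simp_all)
    then obtain \<pi> \<psi> where \<pi>: "bij_betw \<pi> {..<?N} {..<?N}"
      and \<psi>: "minor_model E W (cells ?N) (ladder \<pi>) \<psi>"
      by blast
    have "packs (ladder \<pi>) (cells ?N) k U F"
      by (rule ladder_packs[OF lad U \<open>h > 0\<close> b R M]) (use \<pi> in \<open>auto simp: bij_betw_def\<close>)
    then show ?thesis by (rule packs_trans[OF sym \<psi>])
  qed
qed

section \<open>Covering numbers and separations\<close>

text \<open>The counterpart of \<open>cover\<close> for minors, relative to the part
  \<open>W\<close> of the graph.\<close>

definition tau :: "('a \<times> 'a) set \<Rightarrow> 'a set \<Rightarrow> 'b set \<Rightarrow> ('b \<times> 'b) set \<Rightarrow> nat" where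
  "tau E W U F = (LEAST n. \<exists>X \<subseteq> W. card X = n \<and> \<not> minor E (W - X) U F)"

definition no_edges :: "('a \<times> 'a) set \<Rightarrow> 'a set \<Rightarrow> 'a set \<Rightarrow> bool" where
  "no_edges E A B \<longleftrightarrow> (\<forall>x\<in>A. \<forall>y\<in>B. (x, y) \<notin> E \<and> (y, x) \<notin> E)"

lemma tau_le: "X \<subseteq> W \<Longrightarrow> \<not> minor E (W - X) U F \<Longrightarrow> tau E W U F \<le> card X"
  unfolding tau_def by (rule Least_le) blast

lemma minor_empty: "U \<noteq> {} \<Longrightarrow> \<not> minor E {} U F"
  unfolding minor_def minor_model_def using conn_not_empty by fastforce

lemma tau_cover:
  assumes "U \<noteq> {}"
  obtains X where "X \<subseteq> W" "card X = tau E W U F" "\<not> minor E (W - X) U F"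
proof -
  have "\<exists>n. \<exists>X \<subseteq> W. card X = n \<and> \<not> minor E (W - X) U F"
    using minor_empty[OF assms, of E F] by (intro exI[of _ "card W"] exI[of _ W]) simp
  from LeastI_ex[OF this] show ?thesis using that unfolding tau_def by blast
qed

lemma tau_pos_minor: "0 < tau E W U F \<Longrightarrow> minor E W U F"
  using tau_le[of "{}" W E U F] by auto

lemma tau_empty [simp]: "U \<noteq> {} \<Longrightarrow> tau E {} U F = 0"
  using tau_le[of "{}" "{}" E U F] minor_empty[of U E F] by simp

lemma tau_remove:
  assumes "U \<noteq> {}" "S \<subseteq> W"
  shows "tau E W U F \<le> card S + tau E (W - S) U F"
proof -
  obtain X where X: "X \<subseteq> W - S" "card X = tau E (W - S) U F" "\<not> minor E (W - S - X) U F"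
    by (rule tau_cover[OF assms(1)])
  have "W - S - X = W - (S \<union> X)" by blast
  then have "tau E W U F \<le> card (S \<union> X)" using X assms(2) by (intro tau_le) auto
  also have "\<dots> \<le> card S + card X" by (rule card_Un_le)
  finally show ?thesis using X by simp
qed

lemma conn_one_side:
  assumes "conn E C" "C \<subseteq> A \<union> B" "no_edges E A B" "C \<inter> A \<noteq> {}" "A \<inter> B = {}"
  shows "C \<subseteq> A"
proof (rule ccontr)
  assume "\<not> C \<subseteq> A"
  then obtain x y where "x \<in> C" "x \<in> A" "y \<in> C" "y \<notin> A" using assms(4) by blast
  then obtain a b where "a \<in> C" "a \<in> A" "b \<in> C" "b \<notin> A" "(a, b) \<in> E"
    using conn_edge_out[OF assms(1), of x A y] by metis
  then show False using assms(2,3) by (auto simp: no_edges_def)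
qed

text \<open>Every single branch set stays on one side. If both sides occurred, connectedness of
  \<open>U\<close> would give an edge between vertices placed on different sides, and this edge
  would cross the separation.\<close>

lemma minor_one_side:
  assumes "conn F U" "minor E (A \<union> B) U F" "no_edges E A B" "A \<inter> B = {}"
  shows "minor E A U F \<or> minor E B U F"
proof -
  obtain \<phi> where \<phi>: "minor_model E (A \<union> B) U F \<phi>" using assms(2) by (auto simp: minor_def)
  note P = minor_modelD[OF \<phi>]
  have BA: "no_edges E B A" using assms(3) by (auto simp: no_edges_def)
  have side: "\<phi> u \<subseteq> A \<or> \<phi> u \<subseteq> B" if "u \<in> U" for u
  proof (cases "\<phi> u \<inter> A = {}")
    case True then show ?thesis using P(2)[OF that] by blast
  next
    case False then show ?thesis using conn_one_side[OF P(1,2)[OF that] assms(3) _ assms(4)]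
      by blast
  qed
  have ne: "\<phi> u \<noteq> {}" if "u \<in> U" for u using conn_not_empty[OF P(1)[OF that]] .
  have "(\<forall>u\<in>U. \<phi> u \<subseteq> A) \<or> (\<forall>u\<in>U. \<phi> u \<subseteq> B)"
  proof (rule ccontr)
    assume "\<not> ?thesis"
    then obtain u v where uv: "u \<in> U" "\<not> \<phi> u \<subseteq> A" "v \<in> U" "\<not> \<phi> v \<subseteq> B" by blast
    let ?X = "{w. \<phi> w \<subseteq> A}"
    have "v \<in> ?X" "u \<notin> ?X" using side uv by auto
    then obtain a b where ab: "a \<in> U" "a \<in> ?X" "b \<in> U" "b \<notin> ?X" "(a, b) \<in> F"
      using conn_edge_out[OF assms(1) uv(3) _ uv(1), of ?X] by metis
    then have "a \<noteq> b" by blast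
    then obtain x y where "x \<in> \<phi> a" "y \<in> \<phi> b" "(x, y) \<in> E" using P(4)[OF ab(1,3) _ ab(5)] by blast
    moreover have "\<phi> b \<subseteq> B" using side[OF ab(3)] ab(4) by blast
    ultimately show False using ab(2) assms(3) by (auto simp: no_edges_def)
  qed
  then show ?thesis
  proof
    assume "\<forall>u\<in>U. \<phi> u \<subseteq> A"
    then have "minor_model E A U F \<phi>" using P by (intro minor_modelI) auto
    then show ?thesis by (auto simp: minor_def)
  next
    assume "\<forall>u\<in>U. \<phi> u \<subseteq> B"
    then have "minor_model E B U F \<phi>" using P by (intro minor_modelI) auto
    then show ?thesis by (auto simp: minor_def)
  qed
qed

lemma tau_Un:
  assumes "conn F U" "no_edges E A B" "A \<inter> B = {}"
  shows "tau E (A \<union> B) U F \<le> tau E A U F + tau E B U F"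
proof -
  have U: "U \<noteq> {}" by (rule conn_not_empty[OF assms(1)])
  obtain X where X: "X \<subseteq> A" "card X = tau E A U F" "\<not> minor E (A - X) U F" by (rule tau_cover[OF U])
  obtain Y where Y: "Y \<subseteq> B" "card Y = tau E B U F" "\<not> minor E (B - Y) U F" by (rule tau_cover[OF U])
  have eq: "A \<union> B - (X \<union> Y) = (A - X) \<union> (B - Y)" using X(1) Y(1) assms(3) by blast
  have "\<not> minor E (A \<union> B - (X \<union> Y)) U F"
    unfolding eq using minor_one_side[OF assms(1), of E "A - X" "B - Y"] X(3) Y(3) assms(2,3)
    by (auto simp: no_edges_def)
  then have "tau E (A \<union> B) U F \<le> card (X \<union> Y)" using X Y by (intro tau_le) auto
  also have "\<dots> \<le> card X + card Y" by (rule card_Un_le)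
  finally show ?thesis using X Y by simp
qed

text \<open>Take a smallest set without edges to the rest of \<open>X\<close> that reaches
  \<open>\<theta>\<close> for some index. Removing one component from it leaves all covering numbers
  below \<open>\<theta>\<close>, and that component adds less than \<open>p\<close>.\<close>

lemma group_components:
  assumes sym: "sym E" and "finite X" "\<theta> > 0" and U: "\<And>j. j \<in> J \<Longrightarrow> conn F (U j)"
    and poor: "\<And>x j. x \<in> X \<Longrightarrow> j \<in> J \<Longrightarrow> tau E (component E X x) (U j) F < p"
    and rich: "i \<in> J" "\<theta> \<le> tau E X (U i) F"
  shows "\<exists>A \<subseteq> X. no_edges E A (X - A) \<and> (\<exists>i\<in>J. \<theta> \<le> tau E A (U i) F) \<and>
           (\<forall>j\<in>J. tau E A (U j) F < \<theta> + p)"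
proof -
  let ?Q = "\<lambda>A. A \<subseteq> X \<and> no_edges E A (X - A) \<and> (\<exists>i\<in>J. \<theta> \<le> tau E A (U i) F)"
  have "?Q X" using rich by (auto simp: no_edges_def)
  then obtain A where A: "?Q A" and min: "\<And>B. ?Q B \<Longrightarrow> card A \<le> card B"
    using arg_min_nat_lemma[of ?Q X card] by blast
  have finA: "finite A" using A assms(2) finite_subset by blast
  have "A \<noteq> {}"
  proof
    assume "A = {}"
    then obtain i where "i \<in> J" "\<theta> \<le> tau E {} (U i) F" using A by blast
    then show False using conn_not_empty[OF U] \<open>\<theta> > 0\<close> by auto
  qed
  then obtain x where x: "x \<in> A" by blast
  then have xX: "x \<in> X" using A by blast
  let ?C = "component E X x"
  have CX: "?C \<subseteq> X" by (rule component_subset[OF xX])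
  have "x \<in> ?C \<inter> A" using x by simp
  have CA: "?C \<subseteq> A"
    by (rule conn_one_side[OF conn_component[OF sym xX], of _ "X - A"])
      (use CX A \<open>x \<in> ?C \<inter> A\<close> in blast)+
  have noC: "no_edges E ?C (X - ?C)"
    unfolding no_edges_def
  proof (intro ballI conjI notI)
    fix y z assume yz: "y \<in> ?C" "z \<in> X - ?C"
    { assume "(y, z) \<in> E"
      then show False using component_closed[of y E X x z] yz CX by blast }
    { assume "(z, y) \<in> E"
      then have "(y, z) \<in> E" using sym by (auto dest: symD)
      then show False using component_closed[of y E X x z] yz CX by blast }
  qed
  have "A - ?C \<subset> A" using \<open>x \<in> ?C \<inter> A\<close> by blast
  then have "card (A - ?C) < card A" by (rule psubset_card_mono[OF finA])
  then have "\<not> ?Q (A - ?C)" using min by (metis not_le)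
  moreover have "no_edges E (A - ?C) (X - (A - ?C))"
    using A noC unfolding no_edges_def by blast
  ultimately have small: "tau E (A - ?C) (U j) F < \<theta>" if "j \<in> J" for j using A that
    by (meson Diff_subset not_le order_trans)
  have "tau E A (U j) F < \<theta> + p" if j: "j \<in> J" for j
  proof -
    have "tau E (?C \<union> (A - ?C)) (U j) F \<le> tau E ?C (U j) F + tau E (A - ?C) (U j) F"
      by (rule tau_Un[OF U[OF j]]) (use noC A in \<open>auto simp: no_edges_def\<close>)
    moreover have "?C \<union> (A - ?C) = A" using CA by blast
    ultimately show ?thesis using poor[OF xX j] small[OF j] by simp
  qed
  then show ?thesis using A by blast
qed

section \<open>Splitting off a part of controlled covering number\<close>

definition nbhd :: "('a \<times> 'a) set \<Rightarrow> 'a set \<Rightarrow> 'a set \<Rightarrow> 'a set" where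
  "nbhd E W D = {y \<in> W - D. \<exists>x\<in>D. (x, y) \<in> E}"

text \<open>If the boundary of \<open>D\<close> has the maximal size \<open>3T\<close>, then \<open>S\<close> exists because the connected sets containing
  more than half of the boundary would otherwise form a bramble of order \<open>T\<close>.\<close>

lemma split_connected_set:
  assumes sym: "sym E" and "finite W" "T > 0" and nobr: "\<And>\<B>. bramble E W \<B> \<Longrightarrow> \<not> order_ge \<B> T"
    and D: "conn E D" "D \<subseteq> W" "card (nbhd E W D) \<le> 3 * T"
  shows "\<exists>S \<subseteq> D. card S \<le> T \<and> (\<forall>x\<in>D - S. component E (D - S) x \<noteq> D \<and>
           card (nbhd E W (component E (D - S) x)) \<le> 3 * T)"
proof -
  let ?N = "nbhd E W D"
  have finN: "finite ?N" using assms(2) by (auto simp: nbhd_def)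
  have finD: "finite D" using assms(2) D finite_subset by blast
  have inner: "y \<in> S" if x: "x \<in> D - S" and y: "y \<in> nbhd E W (component E (D - S) x)" "y \<in> D"
    for x y S
  proof (rule ccontr)
    assume "y \<notin> S"
    obtain z where z: "z \<in> component E (D - S) x" "(z, y) \<in> E" "y \<notin> component E (D - S) x"
      using y(1) by (auto simp: nbhd_def)
    moreover have "z \<in> D - S" using z(1) component_subset[OF x] by blast
    ultimately show False using component_closed[OF z(1), of y] y(2) \<open>y \<notin> S\<close> by blast
  qed
  have outer: "y \<in> ?N" if "x \<in> D - S" "y \<in> nbhd E W (component E (D - S) x)" "y \<notin> D" for x y S
    using that component_subset[OF that(1), of E] by (auto simp: nbhd_def)
  show ?thesis
  \<comment> \<open>A smaller boundary has room for one more vertex: removing a single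
    \<open>v\<close> makes all components proper and adds at most \<open>v\<close> to their
    boundaries.\<close>
  proof (cases "card ?N < 3 * T")
    case True
    obtain v where v: "v \<in> D" using conn_not_empty[OF D(1)] by blast
    show ?thesis
    proof (intro exI[of _ "{v}"] conjI ballI)
      show "{v} \<subseteq> D" "card {v} \<le> T" using v \<open>T > 0\<close> by auto
      fix x assume x: "x \<in> D - {v}"
      show "component E (D - {v}) x \<noteq> D" using component_subset[OF x, of E] v by blast
      have "nbhd E W (component E (D - {v}) x) \<subseteq> insert v ?N" using inner[OF x] outer[OF x] by blast
      then have "card (nbhd E W (component E (D - {v}) x)) \<le> card (insert v ?N)" using finN
        by (intro card_mono) auto
      also have "\<dots> \<le> Suc (card ?N)" using finN by (simp add: card_insert_if)
      finally show "card (nbhd E W (component E (D - {v}) x)) \<le> 3 * T" using True by simp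
    qed
  next
    case False
    then have cN: "card ?N = 3 * T" using D(3) by simp
    define \<B> where "\<B> = {B. conn E B \<and> B \<subseteq> W \<and> 3 * T < 2 * card (B \<inter> ?N)}"
    have "B \<inter> B' \<noteq> {}" if "B \<in> \<B>" "B' \<in> \<B>" for B B'
    proof
      assume "B \<inter> B' = {}"
      then have "card (B \<inter> ?N) + card (B' \<inter> ?N) = card (B \<inter> ?N \<union> B' \<inter> ?N)"
        using finN by (intro card_Un_disjoint[symmetric]) auto
      also have "\<dots> \<le> card ?N" using finN by (intro card_mono) auto
      finally show False using that cN by (simp add: \<B>_def)
    qed
    then have "bramble E W \<B>" by (auto simp: bramble_def \<B>_def)
    then have "\<not> order_ge \<B> T" by (rule nobr)
    then obtain S where S: "finite S" "card S < T" "\<And>B. B \<in> \<B> \<Longrightarrow> B \<inter> S \<noteq> {}"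
      unfolding order_ge_def by blast
    show ?thesis
    proof (intro exI[of _ "S \<inter> D"] conjI ballI)
      show "S \<inter> D \<subseteq> D" by blast
      have "card (S \<inter> D) \<le> card S" using S(1) by (intro card_mono) auto
      then show "card (S \<inter> D) \<le> T" using S(2) by simp
      fix x assume x: "x \<in> D - S \<inter> D"
      let ?C = "component E (D - S \<inter> D) x" and ?X = "D \<union> ?N - S"
      have xX: "x \<in> ?X" using x by blast
      let ?K = "component E ?X x"
      have "?X \<subseteq> W" using D(2) by (auto simp: nbhd_def)
      have KX: "?K \<subseteq> ?X" by (rule component_subset[OF xX])
      have "?K \<notin> \<B>" using S(3)[of ?K] KX by blast
      then have K: "2 * card (?K \<inter> ?N) \<le> 3 * T"
        using conn_component[OF sym xX] KX \<open>?X \<subseteq> W\<close> by (auto simp: \<B>_def not_less)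
      have CX: "?C \<subseteq> ?X" using component_subset[OF x, of E] by blast
      have CK: "?C \<subseteq> ?K"
        by (rule conn_subset_component[OF conn_component[OF sym x] CX xX, of x]) auto
      have "nbhd E W ?C \<subseteq> ?K \<inter> ?N \<union> S"
      proof
        fix y assume y: "y \<in> nbhd E W ?C"
        show "y \<in> ?K \<inter> ?N \<union> S"
        proof (cases "y \<in> D")
          case True then show ?thesis using inner[OF x y] by blast
        next
          case False
          then have yN: "y \<in> ?N" using outer[OF x y] by blast
          obtain z where z: "z \<in> ?C" "(z, y) \<in> E" using y by (auto simp: nbhd_def)
          then have "y \<in> ?K" if "y \<notin> S"
            using component_closed[of z E ?X x y] CK CX yN that by blast
          then show ?thesis using yN by blast
        qed
      qed
      then have "card (nbhd E W ?C) \<le> card (?K \<inter> ?N \<union> S)" using finN S(1) by (intro card_mono) auto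
      also have "\<dots> \<le> card (?K \<inter> ?N) + card S" by (rule card_Un_le)
      \<comment> \<open>At most \<open>3 * T / 2\<close> old boundary vertices and fewer than
        \<open>T\<close> vertices of \<open>S\<close> stay below \<open>3 * T\<close>. That this is
        strict also gives \<open>?C \<noteq> D\<close>, since the boundary of \<open>D\<close> has
        size exactly \<open>3 * T\<close>.\<close>
      finally have le: "2 * card (nbhd E W ?C) < 6 * T" using K S(2) by linarith
      then show "card (nbhd E W ?C) \<le> 3 * T" by simp
      show "?C \<noteq> D" using le cN by auto
    qed
  qed
qed

text \<open>Call a set rich if it reaches \<open>\<theta> + T\<close> for some index, and let
  \<open>D\<close> be a smallest rich connected set with boundary at most \<open>3 * T\<close>. By
  minimality all components of \<open>D - S\<close> are poor, while \<open>D - S\<close> as a whole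
  still reaches \<open>\<theta>\<close>, the surplus \<open>T\<close> having paid for
  \<open>S\<close>. Grouping the components adds at most a poor one to \<open>\<theta>\<close>,
  whence \<open>2 * \<theta> + T\<close>; boundary and \<open>S\<close> together form the separator
  of size \<open>4 * T\<close>.\<close>

lemma split_rich_part:
  assumes sym: "sym E" and "finite W" "T > 0" "\<theta> > 0"
    and nobr: "\<And>\<B>. bramble E W \<B> \<Longrightarrow> \<not> order_ge \<B> T"
    and U: "\<And>j. j \<in> J \<Longrightarrow> conn F (U j)" and rich: "i \<in> J" "\<theta> + T \<le> tau E W (U i) F"
  shows "\<exists>S A. S \<subseteq> W \<and> A \<subseteq> W - S \<and> card S \<le> 4 * T \<and> no_edges E A (W - S - A) \<and>
           (\<exists>i\<in>J. \<theta> \<le> tau E A (U i) F) \<and> (\<forall>j\<in>J. tau E A (U j) F < 2 * \<theta> + T)"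
proof -
  have Une: "U j \<noteq> {}" if "j \<in> J" for j by (rule conn_not_empty[OF U[OF that]])
  let ?R = "\<lambda>D. conn E D \<and> D \<subseteq> W \<and> card (nbhd E W D) \<le> 3 * T \<and> (\<exists>j\<in>J. \<theta> + T \<le> tau E D (U j) F)"
  show ?thesis
  proof (cases "\<exists>D. ?R D")
    case False
    \<comment> \<open>A component of the whole of \<open>W\<close> has empty boundary, so reaching
      \<open>\<theta> + T\<close> would make it a rich set of the excluded kind.\<close>
    have poor: "tau E (component E W x) (U j) F < \<theta> + T" if x: "x \<in> W" and j: "j \<in> J" for x j
    proof (rule ccontr)
      assume "\<not> ?thesis"
      moreover have "nbhd E W (component E W x) = {}"
        using component_closed[of _ E W x] component_subset[OF x, of E] by (auto simp: nbhd_def)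
      ultimately have "?R (component E W x)"
        using conn_component[OF sym x] component_subset[OF x, of E] j by (auto simp: not_less)
      then show False using False by blast
    qed
    have "\<theta> \<le> tau E W (U i) F" using rich(2) by simp
    from group_components[where U = U and J = J
      and X = W, OF sym assms(2) \<open>\<theta> > 0\<close> U poor rich(1) this]
    obtain A where "A \<subseteq> W" "no_edges E A (W - A)" "\<exists>i\<in>J. \<theta> \<le> tau E A (U i) F"
      "\<forall>j\<in>J. tau E A (U j) F < \<theta> + (\<theta> + T)" by blast
    then show ?thesis by (intro exI[of _ "{}"] exI[of _ A]) auto
  next
    case True
    define R where "R = ?R"
    obtain D where "R D" and minR: "\<And>D'. R D' \<Longrightarrow> card D \<le> card D'"
      using True ex_has_least_nat[of R _ card] unfolding R_def[symmetric] by blast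
    then have D: "?R D" unfolding R_def by blast
    have min: "card D \<le> card D'" if "?R D'" for D' using minR[of D'] that unfolding R_def by blast
    have finD: "finite D" using D assms(2) finite_subset by blast
    obtain S where S: "S \<subseteq> D" "card S \<le> T"
      and C: "\<And>x. x \<in> D - S \<Longrightarrow> component E (D - S) x \<noteq> D"
        "\<And>x. x \<in> D - S \<Longrightarrow> card (nbhd E W (component E (D - S) x)) \<le> 3 * T"
      using split_connected_set[OF sym assms(2,3) nobr, of D] D by metis
    have poor: "tau E (component E (D - S) x) (U j) F < \<theta> + T" if x: "x \<in> D - S" and j: "j \<in> J"
      for x j
    proof (rule ccontr)
      assume "\<not> ?thesis"
      then have "?R (component E (D - S) x)"
        using conn_component[OF sym x] component_subset[OF x, of E] j C(2)[OF x] D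
        by (auto simp: not_less)
      moreover have "card (component E (D - S) x) < card D"
        using C(1)[OF x] component_subset[OF x, of E] finD by (intro psubset_card_mono) auto
      ultimately show False using min by (metis not_le)
    qed
    obtain j where j: "j \<in> J" "\<theta> + T \<le> tau E D (U j) F" using D by blast
    have "\<theta> \<le> tau E (D - S) (U j) F" using tau_remove[OF Une[OF j(1)] S(1), of E F] j(2) S(2)
      by linarith
    then obtain A where A: "A \<subseteq> D - S" "no_edges E A (D - S - A)" "\<exists>i\<in>J. \<theta> \<le> tau E A (U i) F"
        "\<forall>j\<in>J. tau E A (U j) F < \<theta> + (\<theta> + T)"
      using group_components[where U = U and J = J
      and X = "D - S", OF sym finite_Diff[OF finD] \<open>\<theta> > 0\<close> U poor j(1)]
      by blast
    let ?S = "nbhd E W D \<union> S"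
    have "card ?S \<le> card (nbhd E W D) + card S" by (rule card_Un_le)
    then have "card ?S \<le> 4 * T" using D S(2) by linarith
    moreover have "?S \<subseteq> W" using S(1) D by (auto simp: nbhd_def)
    moreover have "A \<subseteq> W - ?S" using A(1) D by (auto simp: nbhd_def)
    moreover have "no_edges E A (W - ?S - A)"
      unfolding no_edges_def
    proof (intro ballI conjI notI)
      fix x y assume xy: "x \<in> A" "y \<in> W - ?S - A"
      have no: False if "(x, y) \<in> E"
      proof (cases "y \<in> D")
        case True then show False using A(2) xy that by (auto simp: no_edges_def)
      next
        case False then show False using xy that A(1) by (auto simp: nbhd_def)
      qed
      { assume "(x, y) \<in> E" then show False by (rule no) }
      { assume "(y, x) \<in> E" then show False using no sym by (auto dest: symD) }
    qed
    ultimately show ?thesis using A(3,4) by (intro exI[of _ ?S] exI[of _ A]) auto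
  qed
qed

section \<open>Packings from repeated splitting\<close>

lemma packs_add:
  assumes "packs E A a U F" "packs E B b U F" "A \<inter> B = {}"
  shows "packs E (A \<union> B) (a + b) U F"
proof -
  obtain X where X: "\<And>i. i < a \<Longrightarrow> X i \<subseteq> A" "\<And>i. i < a \<Longrightarrow> minor E (X i) U F"
    "disjoint_family_on X {..<a}"
    using assms(1) by (auto simp: packs_def)
  obtain Y where Y: "\<And>i. i < b \<Longrightarrow> Y i \<subseteq> B" "\<And>i. i < b \<Longrightarrow> minor E (Y i) U F"
    "disjoint_family_on Y {..<b}"
    using assms(2) by (auto simp: packs_def)
  define Z where "Z i = (if i < a then X i else Y (i - a))" for i
  show ?thesis unfolding packs_def
  proof (intro exI[of _ Z] conjI allI impI)
    fix i assume i: "i < a + b"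
    then have ib: "i - a < b" if "\<not> i < a" using that by linarith
    show "Z i \<subseteq> A \<union> B" using X(1)[of i] Y(1)[of "i - a"] ib by (auto simp: Z_def)
    show "minor E (Z i) U F" using X(2)[of i] Y(2)[of "i - a"] ib by (auto simp: Z_def)
  next
    show "disjoint_family_on Z {..<a + b}" unfolding disjoint_family_on_def
    proof (intro ballI impI)
      fix i j assume ij: "i \<in> {..<a + b}" "j \<in> {..<a + b}" "i \<noteq> j"
      then have lt: "i - a < b \<or> i < a" "j - a < b \<or> j < a" by auto
      consider "i < a" "j < a" | "i < a" "a \<le> j" | "a \<le> i" "j < a" | "a \<le> i" "a \<le> j" by linarith
      then show "Z i \<inter> Z j = {}"
      proof cases
        case 1 then show ?thesis using X(3) ij(3) by (auto simp: Z_def disjoint_family_on_def)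
      next
        case 2 then show ?thesis using X(1)[of i] Y(1)[of "j - a"] lt assms(3) by (auto simp: Z_def)
      next
        case 3 then show ?thesis using X(1)[of j] Y(1)[of "i - a"] lt assms(3) by (auto simp: Z_def)
      next
        case 4
        then have "i - a < b" "j - a < b" "i - a \<noteq> j - a" using ij by auto
        then have "Y (i - a) \<inter> Y (j - a) = {}" using Y(3) by (auto simp: disjoint_family_on_def)
        then show ?thesis using 4 by (simp add: Z_def)
      qed
    qed
  qed
qed

lemma packs_1: "minor E W U F \<Longrightarrow> packs E W 1 U F"
  unfolding packs_def by (intro exI[of _ "\<lambda>_. W"]) (auto simp: disjoint_family_on_def)

lemma bramble_mono: "bramble E W' \<B> \<Longrightarrow> W' \<subseteq> W \<Longrightarrow> bramble E W \<B>"
  unfolding bramble_def by (meson order_trans)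

text \<open>Origin of the recursion for \<open>f\<close>: the part split off reaches
  \<open>f (n div 2)\<close> but stays below \<open>2 * f (n div 2) + T n\<close>, and the separator
  has at most \<open>4 * T n\<close> vertices. What is left for the other part is thus at least
  \<open>f n - 2 * f (n div 2) - 5 * T n\<close>.\<close>

lemma connected_packs:
  assumes sym: "sym E" and conn: "conn F U"
    and br: "\<And>n W \<B>. n > 0 \<Longrightarrow> finite W \<Longrightarrow> bramble E W \<B> \<Longrightarrow> order_ge \<B> (T n) \<Longrightarrow> packs E W n U F"
    and T: "\<And>n. n > 0 \<Longrightarrow> T n > 0"
    and f: "\<And>n. n > 0 \<Longrightarrow> f n > 0"
      "\<And>n. n > 1 \<Longrightarrow> 2 * f (n div 2) + f (n - n div 2) + 5 * T n \<le> f n"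
    and "finite W" "n > 0" "f n \<le> tau E W U F"
  shows "packs E W n U F"
  using assms(7-)
proof (induction n arbitrary: W rule: less_induct)
  case (less n)
  note Une = conn_not_empty[OF conn]
  show ?case
  proof (cases "n = 1")
    case True
    then have "0 < tau E W U F" using less.prems f(1)[of n] by linarith
    then show ?thesis using True tau_pos_minor packs_1 by metis
  next
    case False
    then have n: "n > 1" using less.prems by simp
    let ?a = "n div 2" and ?b = "n - n div 2"
    have ab: "?a > 0" "?b > 0" "?a < n" "?b < n" "?a + ?b = n" using n by auto
    show ?thesis
    proof (rule ccontr)
      assume no: "\<not> packs E W n U F"
      have nobr: "\<not> order_ge \<B> (T n)" if "bramble E W \<B>" for \<B>
        using br[OF less.prems(2,1) that] no by blast
      have "f ?a + T n \<le> tau E W U F" using f(2)[OF n] less.prems(3) by linarith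
      from split_rich_part[where J = "{()}"
        and U = "\<lambda>_. U", OF sym less.prems(1) T[OF less.prems(2)] f(1)[OF ab(1)] nobr conn _ this]
      obtain S A where SA: "S \<subseteq> W" "A \<subseteq> W - S" "card S \<le> 4 * T n" "no_edges E A (W - S - A)"
        "f ?a \<le> tau E A U F" "tau E A U F < 2 * f ?a + T n" by auto
      have fin: "finite A" "finite (W - S - A)" using SA less.prems(1)
        by (auto intro: finite_subset)
      have "tau E (A \<union> (W - S - A)) U F \<le> tau E A U F + tau E (W - S - A) U F"
        by (rule tau_Un[OF conn SA(4)]) blast
      moreover have "A \<union> (W - S - A) = W - S" using SA(2) by blast
      ultimately have "tau E W U F \<le> card S + (tau E A U F + tau E (W - S - A) U F)"
        using tau_remove[OF Une SA(1), of E F] by simp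
      then have "f ?b \<le> tau E (W - S - A) U F" using f(2)[OF n] less.prems(3) SA(3,6) by linarith
      then have "packs E (W - S - A) ?b U F" using less.IH[OF ab(4) fin(2) ab(2)] by blast
      moreover have "packs E A ?a U F" using less.IH[OF ab(3) fin(1) ab(1) SA(5)] .
      ultimately have "packs E (A \<union> (W - S - A)) (?a + ?b) U F" by (intro packs_add) auto
      then have "packs E W n U F" unfolding ab(5) by (rule packs_mono) (use SA in auto)
      then show False using no by blast
    qed
  qed
qed

text \<open>Which index is served by the part split off cannot be prescribed, so the covering
  numbers of all other indices have to survive. A round costs them less than
  \<open>2 * \<theta> + T\<close> for the part and at most \<open>4 * T\<close> for the separator,
  together at most \<open>3 * \<theta>\<close>.\<close>

lemma distribute_parts:
  assumes sym: "sym E" and "T > 0" "5 * T \<le> \<theta>" and "finite J" and conn: "\<And>j. j \<in> J \<Longrightarrow> conn F (U j)"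
    and "finite W" and nobr: "\<And>\<B>. bramble E W \<B> \<Longrightarrow> \<not> order_ge \<B> T"
    and big: "\<And>j. j \<in> J \<Longrightarrow> 3 * \<theta> * card J \<le> tau E W (U j) F"
  shows "\<exists>Y. (\<forall>j\<in>J. Y j \<subseteq> W \<and> \<theta> \<le> tau E (Y j) (U j) F) \<and> disjoint_family_on Y J"
  using assms(4-)
proof (induction "card J" arbitrary: J W)
  case 0
  then show ?case by (auto simp: disjoint_family_on_def)
next
  case (Suc m)
  have "J \<noteq> {}" using Suc.hyps(2) by auto
  then obtain j0 where j0: "j0 \<in> J" by blast
  have "3 * \<theta> * 1 \<le> 3 * \<theta> * card J" using Suc.hyps(2) by (intro mult_le_mono2) simp
  then have "\<theta> + T \<le> tau E W (U j0) F" using Suc.prems(5)[OF j0] assms(3) by linarith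
  moreover have "\<theta> > 0" using assms(2,3) by simp
  ultimately obtain S A i where SA: "S \<subseteq> W" "A \<subseteq> W - S" "card S \<le> 4 * T" "no_edges E A (W - S - A)"
      and i: "i \<in> J" "\<theta> \<le> tau E A (U i) F" and small: "\<forall>j\<in>J. tau E A (U j) F < 2 * \<theta> + T"
    using split_rich_part[where J = J and U = U, OF sym Suc.prems(3) \<open>T > 0\<close> _ Suc.prems(4,2) j0,
    where \<theta> = \<theta>]
    by blast
  let ?J = "J - {i}" and ?W = "W - S - A"
  have cJ: "card J = Suc (card ?J)" using card.remove[OF Suc.prems(1) i(1)] .
  have big: "3 * \<theta> * card ?J \<le> tau E ?W (U j) F" if j: "j \<in> ?J" for j
  proof -
    have jJ: "j \<in> J" using j by blast
    have "tau E (A \<union> ?W) (U j) F \<le> tau E A (U j) F + tau E ?W (U j) F"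
      by (rule tau_Un[OF Suc.prems(2)[OF jJ] SA(4)]) blast
    moreover have "A \<union> ?W = W - S" using SA(2) by blast
    ultimately have "tau E W (U j) F \<le> card S + (tau E A (U j) F + tau E ?W (U j) F)"
      using tau_remove[OF conn_not_empty[OF Suc.prems(2)[OF jJ]] SA(1), of E F] by simp
    moreover have "3 * \<theta> * card J = 3 * \<theta> + 3 * \<theta> * card ?J" unfolding cJ by simp
    moreover have "tau E A (U j) F < 2 * \<theta> + T" using small jJ by blast
    ultimately show ?thesis using Suc.prems(5)[OF jJ] SA(3) assms(3) by linarith
  qed
  have nobr: "\<not> order_ge \<B> T" if "bramble E ?W \<B>" for \<B>
    using Suc.prems(4)[OF bramble_mono[OF that]] by blast
  have "m = card ?J" using cJ Suc.hyps(2) by simp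
  then obtain Y where Y: "\<forall>j\<in>?J. Y j \<subseteq> ?W \<and> \<theta> \<le> tau E (Y j) (U j) F" "disjoint_family_on Y ?J"
    using Suc.hyps(1)[of ?J ?W] Suc.prems(1-3) nobr big by auto
  let ?Y = "Y(i := A)"
  have "\<forall>j\<in>J. ?Y j \<subseteq> W \<and> \<theta> \<le> tau E (?Y j) (U j) F" using Y(1) i SA(2) by auto
  moreover have "disjoint_family_on ?Y (insert i ?J)"
    by (rule disjoint_family_on_upd[OF Y(2)]) (use Y(1) in auto)
  then have "disjoint_family_on ?Y J" using i(1) by (simp add: insert_absorb)
  ultimately show ?case by blast
qed

text \<open>The indices are the components themselves as vertex sets, so isomorphic components stay
  distinct and each has a host \<open>Y j\<close> of its own. No edge of \<open>F\<close> inside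
  \<open>U\<close> joins different components, hence no adjacency is required between different
  hosts.\<close>

lemma minor_of_components:
  assumes "sym F" and J: "J = component F U ` U"
    and Y: "\<And>j. j \<in> J \<Longrightarrow> minor E (Y j) j F" "disjoint_family_on Y J"
  shows "minor E (\<Union>(Y ` J)) U F"
proof -
  have "\<exists>\<phi>. minor_model E (Y j) j F \<phi>" if "j \<in> J" for j using Y(1)[OF that] by (simp add: minor_def)
  then obtain \<phi> where \<phi>: "\<And>j. j \<in> J \<Longrightarrow> minor_model E (Y j) j F (\<phi> j)" by metis
  let ?c = "component F U"
  have c: "?c u \<in> J" "u \<in> ?c u" if "u \<in> U" for u using that J by auto
  have eq: "?c v = ?c u" if "u \<in> U" "v \<in> U" "v \<in> ?c u" for u v
  proof
    show "?c v \<subseteq> ?c u" using conn_subset_component[OF conn_component[OF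
      assms(1) that(2)] component_subset[OF that(2)] that(1), of v]
      that(3) by simp
    have "?c u \<subseteq> ?c v"
      by (rule conn_subset_component[OF conn_component[OF
      assms(1) that(1)] component_subset[OF that(1)] that(2) that(3)]) simp
    then show "?c u \<subseteq> ?c v" .
  qed
  have "minor_model E (\<Union>(Y ` J)) U F (\<lambda>u. \<phi> (?c u) u)"
  proof (rule minor_modelI)
    fix u assume u: "u \<in> U"
    show "conn E (\<phi> (?c u) u)" using minor_modelD(1)[OF \<phi>[OF c(1)[OF u]]] c(2)[OF u] by blast
    have sub: "\<phi> (?c u) u \<subseteq> Y (?c u)" if "u \<in> U" for u
      using minor_modelD(2)[OF \<phi>[OF c(1)[OF that]]] c(2)[OF that] by blast
    then show "\<phi> (?c u) u \<subseteq> \<Union>(Y ` J)" using c(1)[OF u] u by blast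
    fix v assume v: "v \<in> U" "u \<noteq> v"
    show "\<phi> (?c u) u \<inter> \<phi> (?c v) v = {}"
    proof (cases "?c u = ?c v")
      case True
      then show ?thesis using minor_modelD(3)[OF \<phi>[OF c(1)[OF
        u]], of u v] c(2)[OF u] c(2)[OF v(1)] v(2) by simp
    next
      case False
      then have "Y (?c u) \<inter> Y (?c v) = {}" using Y(2) c(1)[OF u] c(1)[OF v(1)]
        by (auto simp: disjoint_family_on_def)
      then show ?thesis using sub[OF u] sub[OF v(1)] by blast
    qed
    assume uv: "(u, v) \<in> F"
    then have vc: "v \<in> ?c u" using component_closed[of u F U u v] u v by simp
    then have "?c v = ?c u" using eq u v by blast
    then show "\<exists>x\<in>\<phi> (?c u) u. \<exists>y\<in>\<phi> (?c v) v. (x, y) \<in> E"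
      using minor_modelD(4)[OF \<phi>[OF c(1)[OF u]], of u v] c(2)[OF u] vc v(2) uv by simp
  qed
  then show ?thesis by (auto simp: minor_def)
qed

lemma packs_of_components:
  assumes "sym F" and J: "J = component F U ` U"
    and Y: "\<And>j. j \<in> J \<Longrightarrow> Y j \<subseteq> W" "\<And>j. j \<in> J \<Longrightarrow> packs E (Y j) n j F" "disjoint_family_on Y J"
  shows "packs E W n U F"
proof -
  have "\<exists>X. (\<forall>i<n. X i \<subseteq> Y j \<and> minor E (X i) j F) \<and> disjoint_family_on X {..<n}" if "j \<in> J" for j
    using Y(2)[OF that] by (simp add: packs_def)
  then obtain X where X: "\<And>j. j \<in> J \<Longrightarrow> (\<forall>i<n. X j i \<subseteq> Y j \<and> minor E (X j i) j F) \<and>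
    disjoint_family_on (X j) {..<n}"
    by metis
  show ?thesis unfolding packs_def
  proof (intro exI[of _ "\<lambda>i. \<Union>j\<in>J. X j i"] conjI allI impI)
    fix i assume i: "i < n"
    show "(\<Union>j\<in>J. X j i) \<subseteq> W" using X Y(1) i by blast
    show "minor E (\<Union>j\<in>J. X j i) U F"
    proof (rule minor_of_components[OF assms(1) J])
      show "minor E (X j i) j F" if "j \<in> J" for j using X[OF that] i by blast
      show "disjoint_family_on (\<lambda>j. X j i) J"
        using Y(3) X i unfolding disjoint_family_on_def by blast
    qed
  next
    show "disjoint_family_on (\<lambda>i. \<Union>j\<in>J. X j i) {..<n}"
      unfolding disjoint_family_on_def
    proof (intro ballI impI)
      fix i i' assume ii: "i \<in> {..<n}" "i' \<in> {..<n}" "i \<noteq> i'"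
      have "X j i \<inter> X j' i' = {}" if jj: "j \<in> J" "j' \<in> J" for j j'
      proof (cases "j = j'")
        case True
        then show ?thesis using X[OF jj(1)] ii by (auto simp: disjoint_family_on_def)
      next
        case False
        then have "Y j \<inter> Y j' = {}" using Y(3) jj by (auto simp: disjoint_family_on_def)
        then show ?thesis using X[OF jj(1)] X[OF jj(2)] ii by blast
      qed
      then show "(\<Union>j\<in>J. X j i) \<inter> (\<Union>j\<in>J. X j i') = {}" by blast
    qed
  qed
qed

text \<open>A set that covers the minors of one component covers those of the whole graph. Without a
  small cover every component therefore has the large covering number that
  \<open>distribute_parts\<close> asks for.\<close>

theorem small_cover:
  assumes sym: "sym E" "sym F" and U: "finite U" "U \<noteq> {}"
    and br: "\<And>n W \<B>. n > 0 \<Longrightarrow> finite W \<Longrightarrow> bramble E W \<B> \<Longrightarrow> order_ge \<B> (T n) \<Longrightarrow> packs E W n U F"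
    and T: "\<And>n. n > 0 \<Longrightarrow> T n > 0"
    and f: "\<And>n. n > 0 \<Longrightarrow> 5 * T n \<le> f n"
      "\<And>n. n > 1 \<Longrightarrow> 2 * f (n div 2) + f (n - n div 2) + 5 * T n \<le> f n"
    and "finite W" "n > 0" "\<not> packs E W n U F"
  shows "\<exists>X \<subseteq> W. card X \<le> 3 * f n * card U \<and> \<not> minor E (W - X) U F"
proof (rule ccontr)
  assume no: "\<not> ?thesis"
  define J where "J = component F U ` U"
  have J: "finite J" "card J \<le> card U" using U by (auto simp: J_def card_image_le)
  have Jsub: "j \<subseteq> U" and Jconn: "conn F j" if "j \<in> J" for j
    using that component_subset[of _ U F] conn_component[OF sym(2), of _ U] by (auto simp: J_def)
  have fpos: "f m > 0" if "m > 0" for m using f(1)[OF that] T[OF that] by linarith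
  have nobr: "\<not> order_ge \<B> (T n)" if "bramble E W \<B>" for \<B> using br[OF assms(10,9) that] assms(11)
    by blast
  have big: "3 * f n * card J \<le> tau E W j F" if j: "j \<in> J" for j
  proof (rule ccontr)
    assume "\<not> ?thesis"
    then have lt: "tau E W j F < 3 * f n * card J" by simp
    obtain X where X: "X \<subseteq> W" "card X = tau E W j F" "\<not> minor E (W - X) j F"
      by (rule tau_cover[OF conn_not_empty[OF Jconn[OF j]]])
    have "3 * f n * card J \<le> 3 * f n * card U" using J(2) by (rule mult_le_mono2)
    then have "card X \<le> 3 * f n * card U" using X(2) lt by linarith
    moreover have "\<not> minor E (W - X) U F" using X(3) minor_subset[OF _ Jsub[OF j]] by blast
    ultimately show False using no X(1) by blast
  qed
  obtain Y where Y: "\<forall>j\<in>J. Y j \<subseteq> W \<and> f n \<le> tau E (Y j) j F" "disjoint_family_on Y J"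
    using distribute_parts[where U = "\<lambda>j. j", OF sym(1) T[OF
    assms(10)] f(1)[OF assms(10)] J(1) Jconn assms(9) nobr big]
    by blast
  have "packs E (Y j) n j F" if j: "j \<in> J" for j
  proof (rule connected_packs[OF sym(1) Jconn[OF j] _ T fpos f(2)])
    show "packs E W' m j F" if "m > 0" "finite W'" "bramble E W' \<B>" "order_ge \<B> (T m)" for m W' \<B>
      using br[OF that] Jsub[OF j] by (rule packs_subset)
    show "finite (Y j)" using Y(1) j assms(9) finite_subset by blast
    show "f n \<le> tau E (Y j) j F" using Y(1) j by blast
  qed (use assms(10) in auto)
  then have "packs E W n U F" using packs_of_components[OF sym(2) J_def, of Y W E n] Y by blast
  then show False using assms(11) by blast
qed

section \<open>Models as minors\<close>

lemma conn_mono: "conn E B \<Longrightarrow> E \<subseteq> E' \<Longrightarrow> conn E' B"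
  unfolding conn_def using rtrancl_mono[of "E \<inter> B \<times> B" "E' \<inter> B \<times> B"] by blast

lemma minor_relation_mono:
  assumes "minor E W U F" "E \<subseteq> E'"
  shows "minor E' W U F"
proof -
  obtain \<phi> where \<phi>: "minor_model E W U F \<phi>" using assms(1) by (auto simp: minor_def)
  have "minor_model E' W U F \<phi>"
  proof (rule minor_modelI)
    fix u assume u: "u \<in> U"
    show "conn E' (\<phi> u)" by (rule conn_mono[OF minor_modelD(1)[OF \<phi> u] assms(2)])
    show "\<phi> u \<subseteq> W" by (rule minor_modelD(2)[OF \<phi> u])
    fix v assume v: "v \<in> U" "u \<noteq> v"
    show "\<phi> u \<inter> \<phi> v = {}" by (rule minor_modelD(3)[OF \<phi> u v])
    assume "(u, v) \<in> F"
    then show "\<exists>x\<in>\<phi> u. \<exists>y\<in>\<phi> v. (x, y) \<in> E'" using minor_modelD(4)[OF \<phi> u v] assms(2) by blast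
  qed
  then show ?thesis by (auto simp: minor_def)
qed

lemma minor_compose:
  assumes "sym E" "minor E W X F" "minor F X U H"
  shows "minor E W U H"
proof -
  obtain \<psi> where \<psi>: "minor_model E W X F \<psi>" using assms(2) by (auto simp: minor_def)
  have "minor E (\<Union>(\<psi> ` X)) U H" by (rule minor_trans[OF assms(1) \<psi> assms(3) order_refl])
  then show ?thesis by (rule minor_mono) (use minor_modelD(2)[OF \<psi>] in blast)
qed

lemma conn_image:
  assumes "conn E B"
  shows "conn {(r x, r y) |x y. (x, y) \<in> E \<and> r x \<noteq> r y} (r ` B)"
proof -
  let ?E = "{(r x, r y) |x y. (x, y) \<in> E \<and> r x \<noteq> r y}"
  have "(r x, r y) \<in> (?E \<inter> r ` B \<times> r ` B)\<^sup>*" if "(x, y) \<in> (E \<inter> B \<times> B)\<^sup>*" for x y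
    using that
  proof induction
    case (step y z)
    show ?case
    proof (cases "r y = r z")
      case False
      then have "(r y, r z) \<in> ?E \<inter> r ` B \<times> r ` B" using step.hyps by auto
      then show ?thesis using step.IH by (rule rtrancl_into_rtrancl[rotated])
    qed (use step.IH in simp)
  qed simp
  then show ?thesis using assms unfolding conn_def by auto
qed

lemma pair_graph_sym:
  assumes "pair_graph G"
  shows "sym (parcs G)"
proof -
  interpret pair_graph G by fact
  show ?thesis using arcs_symmetric by (auto intro: symI)
qed

text \<open>An isomorphism carries a separate arc map and new tail and head functions. Between pair
  graphs the latter must be \<open>fst\<close> and \<open>snd\<close>, so the vertex map determines
  the arc map.\<close>

lemma digraph_iso_pair_iff:
  assumes "pair_graph A"
  shows "digraph_iso (with_proj A) (with_proj B) \<longleftrightarrow>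
    (\<exists>g. inj_on g (pverts A) \<and> pverts B = g ` pverts A \<and> parcs B = map_prod g g ` parcs A)"
proof
  interpret pair_graph A by fact
  assume "digraph_iso (with_proj A) (with_proj B)"
  then obtain f where f: "pre_digraph.digraph_isomorphism (with_proj A) f"
    and B: "with_proj B = app_iso f (with_proj A)"
    by (auto simp: digraph_iso_def)
  let ?g = "iso_verts f"
  have v: "pverts B = ?g ` pverts A" using B by (metis verts_app_iso with_proj_simps(1))
  have a: "parcs B = iso_arcs f ` parcs A" using B by (metis arcs_app_iso with_proj_simps(2))
  have ht: "iso_tail f = fst" "iso_head f = snd"
    using arg_cong[OF B, of tail] arg_cong[OF B, of head]
    by (simp_all add: tail_app_iso head_app_iso)
  have "iso_arcs f e = map_prod ?g ?g e" if "e \<in> parcs A" for e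
    using f that unfolding pre_digraph.digraph_isomorphism_def ht
    by (cases e) (auto simp: prod_eq_iff)
  then have "parcs B = map_prod ?g ?g ` parcs A" using a by auto
  moreover have "inj_on ?g (pverts A)" using f by (simp add: pre_digraph.digraph_isomorphism_def)
  ultimately show "\<exists>g. inj_on g (pverts A) \<and> pverts B = g ` pverts A \<and>
    parcs B = map_prod g g ` parcs A"
    using v by blast
next
  interpret pair_graph A by fact
  assume "\<exists>g. inj_on g (pverts A) \<and> pverts B = g ` pverts A \<and> parcs B = map_prod g g ` parcs A"
  then obtain g where g: "inj_on g (pverts A)" "pverts B = g ` pverts A"
    "parcs B = map_prod g g ` parcs A" by blast
  let ?f = "\<lparr>iso_verts = g, iso_arcs = map_prod g g, iso_head = snd, iso_tail = fst\<rparr>"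
  have "inj_on (map_prod g g) (parcs A)"
    by (rule inj_on_subset[OF map_prod_inj_on[OF g(1) g(1)]]) (auto dest: in_arcsD1 in_arcsD2)
  then have "pre_digraph.digraph_isomorphism (with_proj A) ?f"
    using g(1) unfolding pre_digraph.digraph_isomorphism_def by (auto intro: wf_digraph_axioms)
  moreover have "with_proj B = app_iso ?f (with_proj A)"
    using g(2,3) by (simp add: app_iso_def with_proj_def)
  ultimately show "digraph_iso (with_proj A) (with_proj B)" unfolding digraph_iso_def by blast
qed

lemma contract_edge_minor:
  assumes "pair_graph G" "(u, v) \<in> parcs G"
  shows "minor (parcs G) (pverts G) (pverts (contract_edge u v G)) (parcs (contract_edge u v G))"
proof -
  interpret pair_graph G by fact
  have uv: "u \<in> pverts G" "v \<in> pverts G" "u \<noteq> v" using assms(2) no_loops' in_arcsD1 in_arcsD2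
    by auto
  let ?r = "id(v := u)"
  define \<phi> where "\<phi> x = {y \<in> pverts G. ?r y = x}" for x
  have pv: "pverts (contract_edge u v G) = pverts G - {v}"
    and pa: "parcs (contract_edge u v G) = {(?r x, ?r y) | x y. (x, y) \<in> parcs G \<and> ?r x \<noteq> ?r y}"
    by (simp_all add: contract_edge_def Let_def)
  have u: "\<phi> u = {u} \<union> {v}" using uv by (auto simp: \<phi>_def)
  have x: "\<phi> x = {x}" if "x \<in> pverts G - {v}" "x \<noteq> u" for x using that by (auto simp: \<phi>_def)
  have "minor_model (parcs G) (pverts G) (pverts G - {v}) (parcs (contract_edge u v G)) \<phi>"
  proof (rule minor_modelI)
    fix w assume w: "w \<in> pverts G - {v}"
    show "conn (parcs G) (\<phi> w)"
    proof (cases "w = u")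
      case True
      then show ?thesis unfolding True u using assms(2)
        by (intro conn_Un[OF pair_graph_sym[OF assms(1)]]) auto
    qed (use x[OF w] in simp)
    show "\<phi> w \<subseteq> pverts G" by (auto simp: \<phi>_def)
    fix w' assume "w' \<in> pverts G - {v}" "w \<noteq> w'"
    then show "\<phi> w \<inter> \<phi> w' = {}" by (auto simp: \<phi>_def)
    assume "(w, w') \<in> parcs (contract_edge u v G)"
    then obtain a b where "(a, b) \<in> parcs G" "w = ?r a" "w' = ?r b" unfolding pa by auto
    moreover from this have "a \<in> \<phi> w" "b \<in> \<phi> w'" unfolding \<phi>_def using in_arcsD1 in_arcsD2 by auto
    ultimately show "\<exists>x\<in>\<phi> w. \<exists>y\<in>\<phi> w'. (x, y) \<in> parcs G" by blast
  qed
  then show ?thesis unfolding pv by (auto simp: minor_def)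
qed

lemma contractible_to_minor:
  assumes "pair_graph M" "contractible_to M H"
  shows "minor (parcs M) (pverts M) (pverts H) (parcs H)"
proof -
  obtain M' where st: "contraction_step\<^sup>*\<^sup>* M M'"
    and iso: "digraph_iso (with_proj M') (with_proj H)"
    using assms(2) by (auto simp: contractible_to_def)
  have "pair_graph M' \<and> minor (parcs M) (pverts M) (pverts M') (parcs M')"
    using st
  proof induction
    case base
    have "minor_model (parcs M) (pverts M) (pverts M) (parcs M) (\<lambda>x. {x})"
      by (rule minor_modelI) auto
    then show ?case using assms(1) by (auto simp: minor_def)
  next
    case (step M1 M2)
    then obtain u v where uv: "(u, v) \<in> parcs M1" "M2 = contract_edge u v M1"
      by (auto simp: contraction_step_def)
    have "pair_graph M1" "minor (parcs M) (pverts M) (pverts M1) (parcs M1)" using step.IH by auto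
    then show ?case unfolding uv(2)
      using pair_graph_contract_edge[OF _ uv(1)] contract_edge_minor[OF _ uv(1)]
        minor_compose[OF pair_graph_sym[OF assms(1)]] by blast
  qed
  then have M': "pair_graph M'" and m: "minor (parcs M) (pverts M) (pverts M') (parcs M')" by auto
  interpret M': pair_graph M' by (rule M')
  obtain g where g: "inj_on g (pverts M')" "pverts H = g ` pverts M'"
    "parcs H = map_prod g g ` parcs M'"
    using iso unfolding digraph_iso_pair_iff[OF M'] by blast
  let ?i = "inv_into (pverts M') g"
  have i: "?i (g x) = x" if "x \<in> pverts M'" for x using inv_into_f_f[OF g(1) that] .
  have "minor_model (parcs M') (pverts M') (pverts H) (parcs H) (\<lambda>y. {?i y})"
  proof (rule minor_modelI)
    fix u assume u: "u \<in> pverts H"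
    then obtain x where x: "x \<in> pverts M'" "u = g x" using g(2) by blast
    show "conn (parcs M') {?i u}" by simp
    show "{?i u} \<subseteq> pverts M'" using x i by simp
    fix v assume v: "v \<in> pverts H" "u \<noteq> v"
    then obtain y where y: "y \<in> pverts M'" "v = g y" using g(2) by blast
    show "{?i u} \<inter> {?i v} = {}" using x y i v by auto
    assume "(u, v) \<in> parcs H"
    then obtain a b where "(a, b) \<in> parcs M'" "u = g a" "v = g b" using g(3) by auto
    moreover from this have "a \<in> pverts M'" "b \<in> pverts M'" using M'.in_arcsD1 M'.in_arcsD2 by auto
    ultimately show "\<exists>x\<in>{?i u}. \<exists>y\<in>{?i v}. (x, y) \<in> parcs M'" using i by simp
  qed
  then have "minor (parcs M') (pverts M') (pverts H) (parcs H)" by (auto simp: minor_def)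
  then show ?thesis by (rule minor_compose[OF pair_graph_sym[OF assms(1)] m])
qed

text \<open>The map \<open>c\<close> sends every vertex to the vertex of \<open>H\<close> into which it is contracted.\<close>

lemma contractible_to_classes:
  assumes "pair_graph M" "pair_graph H" "c ` pverts M = pverts H"
    and "\<And>u. u \<in> pverts H \<Longrightarrow> conn (parcs M) {x \<in> pverts M. c x = u}"
    and "\<And>x y. (x, y) \<in> parcs M \<Longrightarrow> c x \<noteq> c y \<Longrightarrow> (c x, c y) \<in> parcs H"
    and "\<And>u v. (u, v) \<in> parcs H \<Longrightarrow> \<exists>x y. (x, y) \<in> parcs M \<and> c x = u \<and> c y = v"
  shows "contractible_to M H"
  using assms(1,3-)
proof (induction "card (pverts M)" arbitrary: M rule: less_induct)
  case less
  interpret M: pair_graph M by (rule less.prems(1))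
  interpret H: pair_graph H by (rule assms(2))
  show ?case
  proof (cases "inj_on c (pverts M)")
    case True
    have "parcs H = map_prod c c ` parcs M"
    proof
      show "parcs H \<subseteq> map_prod c c ` parcs M" using less.prems(5) by force
      show "map_prod c c ` parcs M \<subseteq> parcs H"
      proof
        fix e assume "e \<in> map_prod c c ` parcs M"
        then obtain x y where xy: "(x, y) \<in> parcs M" "e = (c x, c y)" by auto
        then have "x \<in> pverts M" "y \<in> pverts M" "x \<noteq> y"
          using M.in_arcsD1 M.in_arcsD2 M.no_loops' by auto
        then have "c x \<noteq> c y" using True by (auto dest: inj_onD)
        then show "e \<in> parcs H" using less.prems(4) xy by blast
      qed
    qed
    then have "digraph_iso (with_proj M) (with_proj H)"
      unfolding digraph_iso_pair_iff[OF less.prems(1)] using True less.prems(2) by metis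
    then show ?thesis unfolding contractible_to_def by blast
  next
    case False
    then obtain x y where xy: "x \<in> pverts M" "y \<in> pverts M" "c x = c y" "x \<noteq> y"
      by (auto simp: inj_on_def)
    let ?B = "{z \<in> pverts M. c z = c x}"
    have "conn (parcs M) ?B" using less.prems(2,3) xy(1) by blast
    \<comment> \<open>A class with two vertices is connected and so contains an edge. Contracting it
      preserves all hypotheses for the same map \<open>c\<close>.\<close>
    then obtain a b where ab: "a \<in> ?B" "a \<in> {x}" "b \<in> ?B" "b \<notin> {x}" "(a, b) \<in> parcs M"
      using conn_edge_out[of "parcs M" ?B x "{x}" y] xy by auto
    let ?r = "id(b := a)" and ?M = "contract_edge a b M"
    have cab: "c a = c b" "a \<noteq> b" "b \<in> pverts M" "a \<in> pverts M" using ab by auto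
    have cr: "c (?r z) = c z" for z using cab by simp
    have pv: "pverts ?M = pverts M - {b}"
      and pa: "parcs ?M = {(?r x, ?r y) | x y. (x, y) \<in> parcs M \<and> ?r x \<noteq> ?r y}"
      by (simp_all add: contract_edge_def Let_def)
    have rv: "pverts ?M = ?r ` pverts M" unfolding pv using cab by (auto simp: image_iff)
    have "contractible_to ?M H"
    proof (rule less.hyps)
      show "card (pverts ?M) < card (pverts M)" unfolding pv
        using cab(3) M.pair_finite_verts by (intro psubset_card_mono) auto
      show "pair_graph ?M" by (rule pair_graph_contract_edge[OF less.prems(1) ab(5)])
      show "c ` pverts ?M = pverts H" unfolding rv image_image cr using less.prems(2) .
      fix u v
      { assume u: "u \<in> pverts H"
        have "{x \<in> pverts ?M. c x = u} = ?r ` {x \<in> pverts M. c x = u}"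
        proof
          show "{x \<in> pverts ?M. c x = u} \<subseteq> ?r ` {x \<in> pverts M. c x = u}"
          proof
            fix x assume "x \<in> {x \<in> pverts ?M. c x = u}"
            then have "x \<in> pverts M" "c x = u" "x = ?r x" unfolding pv by auto
            then show "x \<in> ?r ` {x \<in> pverts M. c x = u}" by blast
          qed
          show "?r ` {x \<in> pverts M. c x = u} \<subseteq> {x \<in> pverts ?M. c x = u}"
            unfolding pv using cab by auto
        qed
        then show "conn (parcs ?M) {x \<in> pverts ?M. c x = u}"
          using conn_image[OF less.prems(3)[OF u], of ?r] unfolding pa by simp }
      { assume "(u, v) \<in> parcs H"
        then obtain x y where xy: "(x, y) \<in> parcs M" "c x = u" "c y = v" using less.prems(5)
          by blast
        moreover have "u \<noteq> v" using \<open>(u, v) \<in> parcs H\<close> H.no_loops' by auto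
        ultimately have "?r x \<noteq> ?r y" using cr by metis
        then have "(?r x, ?r y) \<in> parcs ?M" unfolding pa using xy by blast
        then show "\<exists>x y. (x, y) \<in> parcs ?M \<and> c x = u \<and> c y = v" using cr xy by metis }
    next
      fix x y assume "(x, y) \<in> parcs ?M" "c x \<noteq> c y"
      then obtain x' y' where "(x', y') \<in> parcs M" "x = ?r x'" "y = ?r y'" unfolding pa by auto
      then show "(c x, c y) \<in> parcs H" using less.prems(4)[of x' y'] \<open>c x \<noteq> c y\<close> cr by metis
    qed
    moreover have "contraction_step M ?M" using ab(5) by (auto simp: contraction_step_def)
    ultimately show ?thesis unfolding contractible_to_def
      by (meson converse_rtranclp_into_rtranclp)
  qed
qed

lemma minor_submodel:
  assumes G: "pair_graph G" and H: "pair_graph H" and m: "minor (parcs G) W (pverts H) (parcs H)"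
    and W: "W \<subseteq> pverts G"
  obtains M where "M \<in> submodels H G" "pverts M \<subseteq> W"
proof -
  interpret G: pair_graph G by (rule G)
  interpret H: pair_graph H by (rule H)
  obtain \<phi> where \<phi>: "minor_model (parcs G) W (pverts H) (parcs H) \<phi>" using m
    by (auto simp: minor_def)
  note P = minor_modelD[OF \<phi>]
  let ?V = "\<Union>(\<phi> ` pverts H)"
  define c where "c x = (SOME u. u \<in> pverts H \<and> x \<in> \<phi> u)" for x
  have c: "c x = u" if "u \<in> pverts H" "x \<in> \<phi> u" for x u
    unfolding c_def by (rule some_equality) (use that P(3) in blast)+
  \<comment> \<open>The subgraph is not induced: arcs of \<open>G\<close> between branch sets of
    nonadjacent vertices of \<open>H\<close> would survive the contractions, so they are left
    out.\<close>
  define A where "A = {(x, y) \<in> parcs G. x \<in> ?V \<and> y \<in> ?V \<and> (c x = c y \<or> (c x, c y) \<in> parcs H)}"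
  let ?M = "\<lparr>pverts = ?V, parcs = A\<rparr>"
  have VW: "?V \<subseteq> W" using P(2) by blast
  have finV: "finite ?V" using VW W G.pair_finite_verts finite_subset by metis
  have AV: "A \<subseteq> ?V \<times> ?V" by (auto simp: A_def)
  have symH: "sym (parcs H)" and symG: "sym (parcs G)" using G H pair_graph_sym by auto
  have M: "pair_graph ?M"
  proof
    show "finite (pverts ?M)" using finV by simp
    show "finite (parcs ?M)" using finite_subset[OF AV] finV by simp
    show "fst e \<in> pverts ?M" "snd e \<in> pverts ?M" if "e \<in> parcs ?M" for e
      using subsetD[OF AV, of e] that by (auto simp: mem_Times_iff)
    show "fst e \<noteq> snd e" if "e \<in> parcs ?M" for e using that G.no_loops' by (auto simp: A_def)
    have "sym A" unfolding A_def using symG symH by (auto simp: sym_def)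
    then show "symmetric (with_proj ?M)" by (simp add: symmetric_def)
  qed
  have "subgraph (with_proj ?M) (with_proj G)"
  proof -
    interpret M: pair_graph ?M by (rule M)
    show ?thesis unfolding subgraph_def compatible_def
      using VW W M.wf_digraph_axioms G.wf_digraph_axioms by (auto simp: A_def)
  qed
  moreover have "contractible_to ?M H"
  proof (rule contractible_to_classes[OF M H, of c])
    have cls: "{x \<in> pverts ?M. c x = u} = \<phi> u" if "u \<in> pverts H" for u
      using c that by auto
    have ne: "\<phi> u \<noteq> {}" if "u \<in> pverts H" for u by (rule conn_not_empty[OF P(1)[OF that]])
    show "c ` pverts ?M = pverts H"
    proof
      show "c ` pverts ?M \<subseteq> pverts H" using c by auto
      show "pverts H \<subseteq> c ` pverts ?M"
      proof
        fix u assume u: "u \<in> pverts H"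
        then obtain x where "x \<in> \<phi> u" using ne by blast
        then show "u \<in> c ` pverts ?M" using c[OF u] u by force
      qed
    qed
    show "conn (parcs ?M) {x \<in> pverts ?M. c x = u}" if u: "u \<in> pverts H" for u
    proof -
      have "A \<inter> \<phi> u \<times> \<phi> u = parcs G \<inter> \<phi> u \<times> \<phi> u" using c[OF u] u by (auto simp: A_def)
      then show ?thesis unfolding cls[OF u] using P(1)[OF u] by (simp add: conn_def)
    qed
    show "(c x, c y) \<in> parcs H" if "(x, y) \<in> parcs ?M" "c x \<noteq> c y" for x y using that
      by (auto simp: A_def)
    show "\<exists>x y. (x, y) \<in> parcs ?M \<and> c x = u \<and> c y = v" if uv: "(u, v) \<in> parcs H" for u v
    proof -
      have "u \<in> pverts H" "v \<in> pverts H" "u \<noteq> v" using uv H.in_arcsD1 H.in_arcsD2 H.no_loops'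
        by auto
      moreover from this obtain x y where "x \<in> \<phi> u" "y \<in> \<phi> v" "(x, y) \<in> parcs G" using P(4) uv
        by blast
      ultimately show ?thesis using c uv by (intro exI[of _ x] exI[of _ y]) (auto simp: A_def)
    qed
  qed
  ultimately have "?M \<in> submodels H G" using M by (simp add: submodels_def)
  moreover have "pverts ?M \<subseteq> W" using VW by simp
  ultimately show ?thesis by (rule that)
qed

section \<open>Packing and covering numbers in terms of minors\<close>

lemma submodel_minor:
  assumes "M \<in> submodels H G"
  shows "minor (parcs G) (pverts M) (pverts H) (parcs H)"
proof -
  have "pair_graph M" "contractible_to M H" "parcs M \<subseteq> parcs G"
    using assms by (auto simp: submodels_def subgraph_def)
  then show ?thesis using contractible_to_minor minor_relation_mono by blast
qed

lemma submodel_verts: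
  assumes "M \<in> submodels H G" "pverts H \<noteq> {}"
  shows "pverts M \<noteq> {}" "pverts M \<subseteq> pverts G"
  using assms contractible_to_null[of M H] by (auto simp: submodels_def subgraph_def)

lemma card_packing_le_pack:
  assumes "pair_graph G" "is_packing H G F"
  shows "card F \<le> pack H G"
  unfolding pack_def by (rule Max_ge[OF packings_finite_nonempty(1)[OF
  assms(1)]]) (use assms(2) in blast)

lemma cover_le_card_cover:
  assumes "pair_graph G" "pverts H \<noteq> {}" "is_cover H G X"
  shows "cover H G \<le> card X"
  unfolding cover_def by (rule Min_le[OF covers_finite_nonempty(1)[OF
  assms(1,2)]]) (use assms(3) in blast)

lemma packs_le_pack:
  assumes "pair_graph G" "pair_graph H" "pverts H \<noteq> {}"
    and "packs (parcs G) (pverts G) n (pverts H) (parcs H)"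
  shows "n \<le> pack H G"
proof -
  obtain X where X: "\<And>i. i < n \<Longrightarrow> X i \<subseteq> pverts G" "\<And>i. i < n \<Longrightarrow>
    minor (parcs G) (X i) (pverts H) (parcs H)"
    and d: "disjoint_family_on X {..<n}"
    using assms(4) by (auto simp: packs_def)
  have "\<exists>M. M \<in> submodels H G \<and> pverts M \<subseteq> X i" if "i < n" for i
    using minor_submodel[OF assms(1,2) X(2)[OF that] X(1)[OF that]] by blast
  then obtain M where M: "\<And>i. i < n \<Longrightarrow> M i \<in> submodels H G \<and> pverts (M i) \<subseteq> X i" by metis
  have disj: "pverts (M i) \<inter> pverts (M j) = {}" if "i < n" "j < n" "i \<noteq> j" for i j
  proof -
    have "X i \<inter> X j = {}" using d that by (auto simp: disjoint_family_on_def)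
    then show ?thesis using M[OF that(1)] M[OF that(2)] by blast
  qed
  have "inj_on M {..<n}"
  proof (rule inj_onI, rule ccontr)
    fix i j assume ij: "i \<in> {..<n}" "j \<in> {..<n}" "M i = M j" "i \<noteq> j"
    then have "pverts (M i) = {}" using disj[of i j] by auto
    then show False using submodel_verts(1)[of "M i" H G] M[of i] ij assms(3) by auto
  qed
  then have "card (M ` {..<n}) = n" by (simp add: card_image)
  moreover have "is_packing H G (M ` {..<n})"
    unfolding is_packing_def pairwise_def disjnt_def using M disj by (auto) (metis disjoint_iff)
  ultimately show ?thesis using card_packing_le_pack[OF assms(1)] by metis
qed

lemma pack_le_cover:
  assumes "pair_graph G" "pverts H \<noteq> {}"
  shows "pack H G \<le> cover H G"
proof -
  interpret pair_graph G by fact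
  have "pack H G \<in> {card F |F. is_packing H G F}"
    unfolding pack_def by (rule Max_in[OF packings_finite_nonempty[OF assms(1)]])
  then obtain F where F: "is_packing H G F" "card F = pack H G" by auto
  have "cover H G \<in> {card X |X. is_cover H G X}"
    unfolding cover_def by (rule Min_in[OF covers_finite_nonempty[OF assms]])
  then obtain X where X: "is_cover H G X" "card X = cover H G" by auto
  have finX: "finite X" using X pair_finite_verts by (auto simp: is_cover_def intro: finite_subset)
  have "\<exists>x. x \<in> pverts M \<inter> X" if "M \<in> F" for M
    using that F X unfolding is_packing_def is_cover_def by blast
  then obtain g where g: "\<And>M. M \<in> F \<Longrightarrow> g M \<in> pverts M \<inter> X" by metis
  have "inj_on g F"
  proof (rule inj_onI, rule ccontr)
    fix M N assume MN: "M \<in> F" "N \<in> F" "g M = g N" "M \<noteq> N"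
    then have "disjnt (pverts M) (pverts N)" using F(1) by (auto simp: is_packing_def pairwise_def)
    then show False using g[OF MN(1)] g[OF MN(2)] MN(3) by (auto simp: disjnt_def)
  qed
  then have "card F \<le> card X" using g finX by (intro card_inj_on_le) auto
  then show ?thesis using F(2) X(2) by simp
qed

lemma pack_0_cover_0:
  assumes "pair_graph G" "pverts H \<noteq> {}" "pack H G = 0"
  shows "cover H G = 0"
proof -
  have "submodels H G = {}"
  proof (rule ccontr)
    assume "submodels H G \<noteq> {}"
    then obtain M where "M \<in> submodels H G" by blast
    then have "is_packing H G {M}" by (simp add: is_packing_def)
    then show False using card_packing_le_pack[OF assms(1), of H "{M}"] assms(3) by simp
  qed
  then have "is_cover H G {}" by (simp add: is_cover_def)
  then show ?thesis using cover_le_card_cover[OF assms(1,2)] by fastforce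
qed

section \<open>The bound\<close>

text \<open>For positive \<open>n\<close> this is \<open>log 2 (2 * n)\<close> rounded up. The
  factor 2 makes it positive at \<open>n = 1\<close>, and with it
  \<open>bramble_bound\<close>.\<close>

definition log_bound :: "nat \<Rightarrow> nat" where
  "log_bound n = (LEAST l. 2 * n \<le> 2 ^ l)"

lemma log_bound: "2 * n \<le> 2 ^ log_bound n"
  unfolding log_bound_def
proof (rule LeastI)
  show "2 * n \<le> 2 ^ (2 * n)" by (simp add: less_imp_le)
qed

lemma log_bound_le: "2 * n \<le> 2 ^ l \<Longrightarrow> log_bound n \<le> l"
  unfolding log_bound_def by (rule Least_le)

lemma log_bound_mono: "m \<le> n \<Longrightarrow> log_bound m \<le> log_bound n"
  using log_bound[of n] by (intro log_bound_le) simp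

lemma log_bound_pos: "n > 0 \<Longrightarrow> log_bound n > 0"
  using log_bound[of n] by (cases "log_bound n") auto

text \<open>If \<open>l\<close> is one below the least exponent, then
  \<open>2 ^ l \<le> 2 * (k + 1) \<le> 4 * max 2 k\<close>. The additive terms 1 and 2 are absorbed
  because \<open>max 2 k\<close> has logarithm at least 1.\<close>

lemma log_bound_log:
  assumes "k > 0"
  shows "real (log_bound (k + 1)) \<le> 4 * log 2 (max 2 (real k))"
proof -
  let ?l = "log_bound (k + 1)" and ?m = "max 2 (real k)"
  have "?l > 0" using log_bound_pos by simp
  then obtain l where l: "?l = Suc l" by (cases ?l) auto
  then have "\<not> 2 * (k + 1) \<le> 2 ^ l" using log_bound_le[of "k + 1" l] by auto
  then have "real (2 ^ l) \<le> real (2 * (k + 1))" by (intro of_nat_mono) simp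
  then have "2 ^ l \<le> 4 * ?m" using assms by simp
  then have "2 powr real l \<le> 4 * ?m" by (simp add: powr_realpow)
  then have "real l \<le> log 2 (4 * ?m)" by (subst le_log_iff) auto
  also have "\<dots> = log 2 4 + log 2 ?m" by (rule log_mult_pos) auto
  also have "log 2 (4 :: real) = 2" using log2_of_power_eq[of 4 2] by simp
  finally have "real l \<le> 2 + log 2 ?m" .
  moreover have "1 \<le> log 2 ?m" by (subst le_log_iff) auto
  moreover have "real ?l = 1 + real l" using l by simp
  ultimately show ?thesis by linarith
qed

text \<open>38 is the sum of the coefficients 4, 2, 24 and 8 in the estimate of \<open>2 * R\<close>
  in \<open>bramble_bound_packs\<close>, where \<open>x\<close> is \<open>h\<^sup>2\<close>; 64 is a
  power of 2 above it.\<close>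

lemma square_le_64_power: "x \<ge> 1 \<Longrightarrow> 38 * x\<^sup>2 \<le> (64::nat) ^ x"
proof (induction x rule: dec_induct)
  case (step x)
  have "Suc x \<le> 2 * x" using step.hyps by simp
  then have "(Suc x)\<^sup>2 \<le> (2 * x)\<^sup>2" by (rule power_mono) simp
  then have "38 * (Suc x)\<^sup>2 \<le> 4 * (38 * x\<^sup>2)" by (simp add: power_mult_distrib)
  also have "\<dots> \<le> 4 * 64 ^ x" using step.IH by simp
  finally show ?case by simp
qed simp

text \<open>The part independent of \<open>n\<close> in \<open>n * h * (b * M)\<close>, with
  \<open>b = 8 * h ^ 3 * 16 ^ h\<^sup>2\<close> columns per block and
  \<open>M = 64 ^ h\<^sup>2 * n * log_bound n\<close> blocks on each rail.\<close>

definition bramble_factor :: "nat \<Rightarrow> nat" where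
  "bramble_factor h = 8 * h ^ 4 * 1024 ^ h\<^sup>2"

definition bramble_bound :: "nat \<Rightarrow> nat \<Rightarrow> nat" where
  "bramble_bound h n = bramble_factor h * n\<^sup>2 * log_bound n"

text \<open>\<open>R\<close> grows with \<open>r\<close>, \<open>M\<close> must be at least
  \<open>2 * n * R\<close>, and \<open>2 ^ r\<close> at least \<open>2 * M\<close>. As
  \<open>R\<close> is only linear in \<open>r\<close>, the choice
  \<open>r = 6 * h\<^sup>2 + 2 * l\<close> satisfies all three: \<open>64 ^ h\<^sup>2\<close> equals
  \<open>2 ^ (6 * h\<^sup>2)\<close> and absorbs the polynomial in \<open>h\<close>, and
  \<open>2 * n * l\<close> is at most \<open>2 ^ (2 * l)\<close>.\<close>

lemma bramble_bound_packs:
  assumes "sym E" "finite W" "bramble E W \<B>" "order_ge \<B> (bramble_bound h n)"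
    and "minor (ladder id) (cells h) U F" "finite U" "card U \<le> h" "h > 0" "n > 0"
  shows "packs E W n U F"
proof -
  define l where "l = log_bound n"
  have l: "l > 0" "2 * n \<le> 2 ^ l" unfolding l_def using log_bound log_bound_pos[OF \<open>n > 0\<close>] by auto
  define r where "r = 6 * h\<^sup>2 + 2 * l"
  define R where "R = 2 + h + 2 * r * h\<^sup>2"
  define M where "M = 64 ^ h\<^sup>2 * n * l"
  define b where "b = 8 * h ^ 3 * 16 ^ h\<^sup>2"
  have pw: "(16::nat) ^ h\<^sup>2 * 64 ^ h\<^sup>2 = 1024 ^ h\<^sup>2" by (simp add: power_mult_distrib[symmetric])
  have "n * h * (b * M) = 8 * h ^ 4 * (16 ^ h\<^sup>2 * 64 ^ h\<^sup>2) * n\<^sup>2 * l"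
    unfolding b_def M_def
    by (simp only: power2_eq_square[of n] power3_eq_cube power4_eq_xxxx mult_ac)
  then have order: "n * h * (b * M) = bramble_bound h n"
    unfolding pw bramble_bound_def bramble_factor_def l_def .
  have h2: "1 \<le> h\<^sup>2" "h \<le> h\<^sup>2" using \<open>h > 0\<close> by (auto simp: power2_eq_square)
  have h4: "h\<^sup>2 \<le> h\<^sup>2 * h\<^sup>2" by (rule le_square)
  have "2 * R = (4 + 2 * h + 24 * (h\<^sup>2 * h\<^sup>2)) + 8 * h\<^sup>2 * l" unfolding R_def r_def
    by (simp add: algebra_simps)
  also have "\<dots> \<le> (4 + 2 * h + 24 * (h\<^sup>2 * h\<^sup>2)) * l + 8 * h\<^sup>2 * l" using l(1) by simp
  also have "\<dots> = (4 + 2 * h + 24 * (h\<^sup>2 * h\<^sup>2) + 8 * h\<^sup>2) * l" by (simp add: algebra_simps)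
  also have "\<dots> \<le> (38 * (h\<^sup>2)\<^sup>2) * l"
  proof (rule mult_le_mono1)
    show "4 + 2 * h + 24 * (h\<^sup>2 * h\<^sup>2) + 8 * h\<^sup>2 \<le> 38 * (h\<^sup>2)\<^sup>2"
      unfolding power2_eq_square[of "h\<^sup>2"] using h2 h4 by linarith
  qed
  also have "\<dots> \<le> 64 ^ h\<^sup>2 * l" using square_le_64_power[OF h2(1)] by (rule mult_le_mono1)
  finally have "2 * R * n \<le> 64 ^ h\<^sup>2 * l * n" by (rule mult_le_mono1)
  then have M1: "2 * n * R \<le> M" unfolding M_def by (simp add: mult_ac)
  have "2 * M = 64 ^ h\<^sup>2 * ((2 * n) * l)" unfolding M_def by simp
  also have "\<dots> \<le> 64 ^ h\<^sup>2 * (2 ^ l * 2 ^ l)" 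
    using mult_le_mono[OF l(2) less_imp_le[OF less_exp]] by (rule mult_le_mono2)
  also have "\<dots> = (2 ^ 6) ^ h\<^sup>2 * (2 ^ l * 2 ^ l)" by simp
  also have "\<dots> = 2 ^ r" unfolding r_def mult_2 power_add power_mult ..
  finally have M2: "2 * M \<le> 2 ^ r" .
  show ?thesis
    by (rule bramble_packs[OF assms(1-3) _ assms(5-9) b_def
    R_def M1 M2]) (use assms(4) order in simp)
qed

text \<open>For even \<open>n\<close> both sides are equal; for \<open>n = 2 * a + 1\<close> the
  right one is larger by \<open>4 * a - 1\<close>, which is why \<open>n = 1\<close> is
  excluded.\<close>

lemma halves_le:
  fixes n :: nat
  assumes "n > 1"
  shows "4 * (2 * (n div 2)\<^sup>2 + (n - n div 2)\<^sup>2) \<le> 3 * n\<^sup>2"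
proof (cases "even n")
  case True
  then obtain a where "n = 2 * a" by blast
  then show ?thesis by (simp add: power2_eq_square)
next
  case False
  then obtain a where a: "n = 2 * a + 1" by (rule oddE)
  then have "n div 2 = a" "n - n div 2 = a + 1" "a \<ge> 1" using assms by auto
  then show ?thesis unfolding a by (simp add: power2_eq_square algebra_simps)
qed

text \<open>Origin of the 20: for \<open>f = c * T\<close> with \<open>T\<close> quadratic, up to a
  logarithm bounded by its value at \<open>n\<close>, the recursion asks for
  \<open>3 * c / 4 + 5 \<le> c\<close>, and 20 is the least solution.\<close>

lemma bramble_bound_halves:
  assumes "n > 1"
  shows "2 * (20 * bramble_bound h (n div 2)) + 20 * bramble_bound h (n - n div 2) + 5 * bramble_bound h n
    \<le> 20 * bramble_bound h n"
proof -
  let ?K = "bramble_factor h * log_bound n" and ?a = "n div 2" and ?b = "n - n div 2"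
  have le: "bramble_bound h m \<le> ?K * m\<^sup>2" if "m \<le> n" for m
  proof -
    have "bramble_factor h * m\<^sup>2 * log_bound m \<le> bramble_factor h * m\<^sup>2 * log_bound n"
      by (rule mult_le_mono2[OF log_bound_mono[OF that]])
    then show ?thesis unfolding bramble_bound_def by (simp add: mult_ac)
  qed
  have "5 * (4 * (2 * bramble_bound h ?a + bramble_bound h ?b)) \<le>
    5 * (4 * (2 * (?K * ?a\<^sup>2) + ?K * ?b\<^sup>2))"
    using le[of ?a] le[of ?b] by simp
  also have "\<dots> = 5 * (?K * (4 * (2 * ?a\<^sup>2 + ?b\<^sup>2)))" by (simp add: algebra_simps)
  also have "\<dots> \<le> 5 * (?K * (3 * n\<^sup>2))" by (intro mult_le_mono2 halves_le assms)
  also have "\<dots> = 15 * bramble_bound h n" unfolding bramble_bound_def by simp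
  finally show ?thesis by simp
qed

lemma bramble_bound_pos: "h > 0 \<Longrightarrow> n > 0 \<Longrightarrow> bramble_bound h n > 0"
  using log_bound_pos by (simp add: bramble_bound_def bramble_factor_def)

text \<open>The first number of copies that cannot be packed is one above the packing number, so the
  bound is taken there. The factor 60 is the 3 of \<open>small_cover\<close> times the 20 of the
  recursion.\<close>

lemma cover_le_bramble_bound:
  assumes G: "pair_graph G" and H: "pair_graph H" and "pathwidth H \<le> 2" and ne: "pverts H \<noteq> {}"
  shows "cover H G \<le> 60 * bramble_bound (card (pverts H)) (pack H G + 1) * card (pverts H)"
proof -
  interpret G: pair_graph G by (rule G)
  interpret H: pair_graph H by (rule H)
  let ?h = "card (pverts H)" and ?n = "pack H G + 1"
  have h: "?h > 0" using ne H.pair_finite_verts by (simp add: card_gt_0_iff)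
  have "\<not> packs (parcs G) (pverts G) ?n (pverts H) (parcs H)"
    using packs_le_pack[OF G H ne, of ?n] by auto
  then have "\<exists>X \<subseteq> pverts G. card X \<le> 3 * (20 * bramble_bound ?h ?n) * ?h \<and>
      \<not> minor (parcs G) (pverts G - X) (pverts H) (parcs H)"
  proof (intro small_cover[where T = "bramble_bound ?h" and f = "\<lambda>n. 20 * bramble_bound ?h n"])
    show "packs (parcs G) W n (pverts H) (parcs H)"
      if "n > 0" "finite W" "bramble (parcs G) W \<B>" "order_ge \<B> (bramble_bound ?h n)" for n W \<B>
      by (rule bramble_bound_packs[OF pair_graph_sym[OF G]
      that(2-4) pathwidth_2_ladder_minor[OF H assms(3)]])
        (use H.pair_finite_verts h that(1) in auto)
  qed (use pair_graph_sym[OF G] pair_graph_sym[OF H] H.pair_finite_verts G.pair_finite_verts ne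
      bramble_bound_pos[OF h] bramble_bound_halves in auto)
  then obtain X where X: "X \<subseteq> pverts G" "card X \<le> 60 * bramble_bound ?h ?n * ?h"
      "\<not> minor (parcs G) (pverts G - X) (pverts H) (parcs H)" by auto
  have "is_cover H G X" unfolding is_cover_def
  proof (intro conjI ballI notI)
    fix M assume M: "M \<in> submodels H G" "pverts M \<inter> X = {}"
    then have "pverts M \<subseteq> pverts G - X" using submodel_verts(2)[OF M(1) ne] by blast
    then show False using minor_mono[OF submodel_minor[OF M(1)]] X(3) by blast
  qed (rule X(1))
  then have "cover H G \<le> card X" by (rule cover_le_card_cover[OF G ne])
  then show ?thesis using X(2) by linarith
qed

text \<open>The exponent 28 is 13 + 5 + 10: the constant \<open>7680 = 60 * 8 * 4 * 4\<close> is
  below \<open>2 ^ 13\<close>, \<open>h ^ 5\<close> is at most \<open>32 ^ h\<^sup>2\<close>, and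
  \<open>1024 ^ h\<^sup>2\<close> comes from \<open>bramble_factor\<close>. The two factors 4
  account for passing from \<open>k + 1\<close> to \<open>k\<close> in the square and in the
  logarithm.\<close>

lemma bramble_bound_powr:
  assumes "h > 0" "k > 0"
  shows "real (60 * bramble_bound h (k + 1) * h) \<le> 2 powr (28 * (real h)\<^sup>2) * (real k)\<^sup>2 * log 2 (max 2 (real k))"
proof -
  let ?L = "log 2 (max 2 (real k))"
  have L: "0 \<le> ?L" by (simp add: le_log_iff)
  have k: "(real (k + 1))\<^sup>2 \<le> 4 * (real k)\<^sup>2"
  proof -
    have "(real (k + 1))\<^sup>2 \<le> (2 * real k)\<^sup>2" using assms(2) by (intro power_mono) auto
    then show ?thesis by (simp add: power_mult_distrib)
  qed
  have hp: "real h \<le> 2 ^ h\<^sup>2"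
  proof -
    have "h < 2 ^ h" by simp
    also have "(2::nat) ^ h \<le> 2 ^ h\<^sup>2" using assms(1)
      by (intro power_increasing) (auto simp: power2_eq_square)
    finally have "real h < real (2 ^ h\<^sup>2)" by (simp only: of_nat_less_iff)
    then show ?thesis by simp
  qed
  have "(real h) ^ 5 \<le> (2 ^ h\<^sup>2) ^ 5" by (rule power_mono[OF hp]) simp
  then have h5: "(real h) ^ 5 \<le> 32 ^ h\<^sup>2"
    by (simp add: power_mult[symmetric] mult.commute[of _ 5] power_mult)
  have "(8192::real) ^ 1 \<le> 8192 ^ h\<^sup>2" using assms(1) by (intro power_increasing) auto
  then have c8: "(7680::real) \<le> 8192 ^ h\<^sup>2" by simp
  have pw: "(8192::real) ^ h\<^sup>2 * 32 ^ h\<^sup>2 * 1024 ^ h\<^sup>2 = 2 powr (28 * (real h)\<^sup>2)"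
  proof -
    have "(8192::real) ^ h\<^sup>2 * 32 ^ h\<^sup>2 * 1024 ^ h\<^sup>2 = (2 ^ 28) ^ h\<^sup>2"
      by (simp add: power_mult_distrib[symmetric])
    also have "\<dots> = 2 ^ (28 * h\<^sup>2)" by (rule power_mult[symmetric])
    also have "\<dots> = 2 powr real (28 * h\<^sup>2)" by (rule powr_realpow[symmetric]) simp
    finally show ?thesis by simp
  qed
  have "real (60 * bramble_bound h n * h) = 480 * real h ^ 5 * 1024 ^ h\<^sup>2 * ((real n)\<^sup>2 * real (log_bound n))" for n
    unfolding bramble_bound_def bramble_factor_def by (simp add: power_numeral_reduce mult_ac)
  then have "real (60 * bramble_bound h (k + 1) * h) =
      480 * real h ^ 5 * 1024 ^ h\<^sup>2 * ((real (k + 1))\<^sup>2 * real (log_bound (k + 1)))" .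
  also have "\<dots> \<le> 480 * real h ^ 5 * 1024 ^ h\<^sup>2 * ((4 * (real k)\<^sup>2) * (4 * ?L))"
    by (intro mult_left_mono mult_mono k log_bound_log assms(2)) (use L in auto)
  also have "\<dots> = (7680 * real h ^ 5 * 1024 ^ h\<^sup>2) * ((real k)\<^sup>2 * ?L)" by simp
  also have "\<dots> \<le> (8192 ^ h\<^sup>2 * 32 ^ h\<^sup>2 * 1024 ^ h\<^sup>2) * ((real k)\<^sup>2 * ?L)"
    by (intro mult_right_mono mult_mono h5 c8) (use L in auto)
  finally show ?thesis unfolding pw by (simp add: mult.assoc)
qed

(* The vertices are natural numbers because the constant c has to be chosen before H and G, so that
   it must not depend on vertex types; every finite graph is isomorphic to one with vertices in nat.
   The maximum in the logarithm only concerns k = 1, where log 2 k = 0 would give the bound 0. *)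
theorem theorem1:
  shows "\<exists>c :: real. \<forall>H :: nat pair_pre_digraph. \<forall>h :: nat.
           pair_graph H \<and> h = card (pverts H) \<and> h > 5 \<and> pathwidth H \<le> 2 \<longrightarrow>
           (\<exists>f :: nat \<Rightarrow> real.
              (\<forall>k. f k \<le> 2 powr (c * (real h)\<^sup>2) * (real k)\<^sup>2 * log 2 (max 2 (real k))) \<and>
              (\<forall>G :: nat pair_pre_digraph. \<forall>k :: nat.
                 pair_graph G \<and> k = pack H G \<longrightarrow>
                 k \<le> cover H G \<and> real (cover H G) \<le> f k))"
proof (intro exI[of _ 28] allI impI)
  fix H :: "nat pair_pre_digraph" and h :: nat
  assume H: "pair_graph H \<and> h = card (pverts H) \<and> h > 5 \<and> pathwidth H \<le> 2"
  then have ne: "pverts H \<noteq> {}" by auto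
  define f where "f k = 2 powr (28 * (real h)\<^sup>2) * (real k)\<^sup>2 * log 2 (max 2 (real k))" for k :: nat
  have "real (cover H G) \<le> f (pack H G)" if G: "pair_graph G" for G :: "nat pair_pre_digraph"
  \<comment> \<open>\<open>f 0\<close> is 0 while \<open>bramble_bound h 1\<close> is positive, so
    this case rests on the absence of any model.\<close>
  proof (cases "pack H G = 0")
    case True
    then show ?thesis using pack_0_cover_0[OF G ne True] by (simp add: f_def)
  next
    case False
    have "real (cover H G) \<le> real (60 * bramble_bound h (pack H G + 1) * h)"
      using cover_le_bramble_bound[OF G _ _ ne] H by (intro of_nat_mono) auto
    also have "\<dots> \<le> f (pack H G)" unfolding f_def using H False by (intro bramble_bound_powr) auto
    finally show ?thesis .
  qed
  moreover have "pack H G \<le> cover H G" if "pair_graph G" for G :: "nat pair_pre_digraph"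
    by (rule pack_le_cover[OF that ne])
  ultimately show "\<exists>f :: nat \<Rightarrow> real.
              (\<forall>k. f k \<le> 2 powr (28 * (real h)\<^sup>2) * (real k)\<^sup>2 * log 2 (max 2 (real k))) \<and>
              (\<forall>G :: nat pair_pre_digraph. \<forall>k :: nat.
                 pair_graph G \<and> k = pack H G \<longrightarrow>
                 k \<le> cover H G \<and> real (cover H G) \<le> f k)"
    by (intro exI[of _ f]) (simp add: f_def)
qed

end
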